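(* Let $a$ be a positive rational number, let $s\ge 3$ be an integer, and let $r$ be an integer with $1\le r<s$ if $s$ is odd and $1\le r\le s-1$ if $s$ is even. Let $\alpha$ be the number such that, as $n\to\infty$, $k=\alpha n$ maximizes the summand $\binom{n}{k}^s a^k$ (it is found by computing the ratio of consecutive terms, setting it equal to $1$, and solving for $\alpha$ as $n\to\infty$). Let $$B(n)=\sum_{k=0}^{n}\binom{n}{k}^s a^k ,$$ and let $A(n)$ be the solution of the same homogeneous linear recurrence with polynomial coefficients, of order $L$, say, that is satisfied by $B(n)$ by the Zeilberger algorithm, but with the following initial conditions: for $n=0,\dots,L-1$, $A(n)$ is the coefficient of $t^r$ in the Taylor expansion about $t=0$ of $$\sum_{k=0}^{n}\left(\frac{n!}{(1+t)_k\,(1-t)_{n-k}}\right)^s a^k .$$ Then the sequence $A(n)/B(n)$ converges, with exponentially decaying error, to the constant $$c=\lim_{n\to\infty}c^{(s)}_r(n,\lfloor \alpha n\rfloor),$$ where exponentially decaying error means that there exist constants $C>0$ and $\rho>1$ such that $$\left|\frac{A(n)}{B(n)}-c\right|\le \frac{C}{\rho^n}.$$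
   Context: Rising factorial (Pochhammer symbol): $(x)_m:=x(x+1)\cdots(x+m-1)$; in particular $(1)_m=m!$. For integers $0\le k\le n$, $c^{(s)}_r(n,k)$ denotes the coefficient of $t^r$ in the Taylor expansion about $t=0$ of the rational function of $t$ $$\frac{k!^s\,(n-k)!^s}{(1+t)_k^s\,(1-t)_{n-k}^s}.$$ Zeilberger algorithm: applied to $F(n,k)=\binom{n}{k}^s a^k$, it furnishes, for some non-negative integer $L$ (the order), polynomials $p_0(n),\dots,p_L(n)$ in $n$ and a certificate $G(n,k)$, with $G(n,k)/F(n,k)$ a rational function of $(n,k)$, such that $$p_0(n)F(n,k)+p_1(n)F(n+1,k)+\dots+p_L(n)F(n+L,k)=G(n,k+1)-G(n,k).$$ Summing over $k$, and because the summand contains $\binom{n}{k}$, the right side vanishes and one obtains the homogeneous recurrence $\sum_{i=0}^{L}p_i(n)B(n+i)=0$. This is the recurrence of order $L$ referred to in the claim; $A(n)$ satisfies $\sum_{i=0}^{L}p_i(n)A(n+i)=0$. *)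

theory Defs
  imports "HOL-Analysis.Analysis" "HOL-Computational_Algebra.Polynomial"
begin

definition taylor_coeff :: "(real \<Rightarrow> real) \<Rightarrow> nat \<Rightarrow> real" where
  "taylor_coeff f r = (deriv ^^ r) f 0 / fact r"

text \<open>The index \<open>k\<close> ranges over all integers, with the usual convention that the binomial
  coefficient vanishes for \<open>k < 0\<close> (and for \<open>k > n\<close>); this is what makes the
  telescoping sum over \<open>k\<close> vanish.\<close>

definition summand :: "nat \<Rightarrow> real \<Rightarrow> nat \<Rightarrow> int \<Rightarrow> real" where
  "summand s a n k = (if k < 0 then 0 else real (n choose nat k) ^ s * a ^ nat k)"

definition binom_sum :: "nat \<Rightarrow> real \<Rightarrow> nat \<Rightarrow> real" where
  "binom_sum s a n = (\<Sum>k=0..n. real (n choose k) ^ s * a ^ k)"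

definition deformed_sum :: "nat \<Rightarrow> real \<Rightarrow> nat \<Rightarrow> real \<Rightarrow> real" where
  "deformed_sum s a n t =
     (\<Sum>k=0..n. (fact n / (pochhammer (1 + t) k * pochhammer (1 - t) (n - k))) ^ s * a ^ k)"

definition c_coeff :: "nat \<Rightarrow> nat \<Rightarrow> nat \<Rightarrow> nat \<Rightarrow> real" where
  "c_coeff s r n k =
     taylor_coeff (\<lambda>t. (fact k ^ s * fact (n - k) ^ s) /
                       (pochhammer (1 + t) k ^ s * pochhammer (1 - t) (n - k) ^ s)) r"

text \<open>``As \<open>n \<rightarrow> \<infinity>\<close>, \<open>k = \<alpha> n\<close> maximizes \<open>F n k\<close>'': the maximizers over
  \<open>0 \<le> k \<le> n\<close>, however ties are broken, are located at \<open>\<alpha> n + o(n)\<close>.\<close>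

definition asymptotic_maximizer :: "(nat \<Rightarrow> int \<Rightarrow> real) \<Rightarrow> real \<Rightarrow> bool" where
  "asymptotic_maximizer F \<alpha> \<longleftrightarrow>
     (\<forall>\<kappa>::nat \<Rightarrow> nat. (\<forall>n. is_arg_max (\<lambda>k. F n (int k)) (\<lambda>k. k \<le> n) (\<kappa> n)) \<longrightarrow>
        (\<lambda>n. real (\<kappa> n) / real n) \<longlonglongrightarrow> \<alpha>)"

text \<open>A polynomial in two variables \<open>n\<close>, \<open>k\<close> is represented as a polynomial in \<open>k\<close>
  whose coefficients are polynomials in \<open>n\<close>.\<close>

definition eval2 :: "real poly poly \<Rightarrow> real \<Rightarrow> real \<Rightarrow> real" where
  "eval2 P n k = poly (poly P [:k:]) n"

text \<open>The outcome of the Zeilberger algorithm for \<open>F\<close>: an operator of order \<open>L\<close> with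
  polynomial coefficients \<open>p 0, \<dots>, p L\<close> and a certificate \<open>G\<close> such that \<open>G / F\<close> is a
  rational function \<open>N / D\<close> of \<open>(n, k)\<close>. Away from the zeros of \<open>D\<close> this prescribes
  \<open>G = (N / D) F\<close>; at a zero of \<open>D\<close> (which in practice meets a zero of \<open>F\<close>, for instance at
  \<open>k = n + 1\<close>) the value of \<open>G\<close> is tied down by the telescoping equation only.
  For each \<open>n\<close> the denominator must not vanish identically in \<open>k\<close>: otherwise nothing
  would link \<open>G\<close> to \<open>F\<close> for that \<open>n\<close>, and summation over \<open>k\<close> would not yield the
  recurrence there. This can always be achieved by multiplying all of \<open>p\<close> and \<open>G\<close> by a
  polynomial in \<open>n\<close>.\<close>

definition zeilberger_recurrence ::
    "(nat \<Rightarrow> int \<Rightarrow> real) \<Rightarrow> nat \<Rightarrow> (nat \<Rightarrow> real poly) \<Rightarrow> bool" where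
  "zeilberger_recurrence F L p \<longleftrightarrow>
     p L \<noteq> 0 \<and>
     (\<exists>(G :: nat \<Rightarrow> int \<Rightarrow> real) N D.
        (\<forall>n::nat. \<exists>x::real. eval2 D (real n) x \<noteq> 0) \<and>
        (\<forall>n k. eval2 D (real n) (of_int k) \<noteq> 0 \<longrightarrow>
           G n k = eval2 N (real n) (of_int k) / eval2 D (real n) (of_int k) * F n k) \<and>
        (\<forall>n k. (\<Sum>i\<le>L. poly (p i) (real n) * F (n + i) k) = G n (k + 1) - G n k))"

definition satisfies_recurrence :: "nat \<Rightarrow> (nat \<Rightarrow> real poly) \<Rightarrow> (nat \<Rightarrow> real) \<Rightarrow> bool" where
  "satisfies_recurrence L p u \<longleftrightarrow> (\<forall>n. (\<Sum>i\<le>L. poly (p i) (real n) * u (n + i)) = 0)"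

text \<open>The solution \<open>A\<close> of the recurrence with the initial values \<open>v\<close>. If the leading
  coefficient \<open>p L\<close> has no zero among the natural numbers, this is the usual initial value
  problem with data for \<open>n < L\<close>, and the last clause is void. If \<open>p L\<close> vanishes at a natural
  number \<open>n\<close>, the recurrence puts no constraint on \<open>A (n + L)\<close> in terms of the preceding
  values, and ``the'' solution is well determined only if this value is prescribed as well.\<close>

definition solution_with_initial_values ::
    "nat \<Rightarrow> (nat \<Rightarrow> real poly) \<Rightarrow> (nat \<Rightarrow> real) \<Rightarrow> (nat \<Rightarrow> real) \<Rightarrow> bool" where
  "solution_with_initial_values L p v A \<longleftrightarrow>
     satisfies_recurrence L p A \<and>
     (\<forall>n<L. A n = v n) \<and>
     (\<forall>n. poly (p L) (real n) = 0 \<longrightarrow> A (n + L) = v (n + L))"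

end

(* Put b = a^(1/s) and let C(n, z) = n! / (Gamma(1 + z) Gamma(n + 1 - z)) be the entire binomial
   coefficient. Up to the factor f(t) = (Gamma(1 + t) Gamma(1 - t) b^(-t))^s, which does not depend
   on n, the deformed sum is the shifted sum S_n(t) of (C(n, k + t) b^(k + t))^s over 0 <= k <= n.

   The recurrence: the certificate identity is an identity of rational functions in (n, k), so it
   may be shifted to k + t. Summing over -M <= k < M leaves boundary terms that are O(t^s), because
   1 / Gamma vanishes at the non-positive integers. Hence the coefficients of t^r with r < s satisfy
   the recurrence, and A(n) is the coefficient of t^r in f(t) S_n(t).

   The convergence: S_n(t) - S_n(0) is a contour integral of (C(n, z) b^z)^s against
   pi cot(pi (z - t)) - pi cot(pi z) over a rectangle of height proportional to n. The kernel decays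
   like exp(-2 pi |Im z|), whereas the summand exceeds its real maximum there by a factor of at
   most about exp(|Im z|); so S_n(t) is constant up to an exponentially small relative error, and
   A(n) / B(n) tends to the coefficient of t^r in f. By Euler's product for Gamma, this is also the
   limit of the coefficients c_r(n, k) when k / n tends to b / (1 + b) = alpha. *)

theory Submission
  imports Defs "HOL-Complex_Analysis.Complex_Analysis"
begin

subsection \<open>Lower bounds for products of distances to integers\<close>

text \<open>The delicate point is the growth of the summand off the real axis. With y = |Im z|, the
  sine in the reflection formula alone contributes exp(pi y) to C(n, z), hence exp(s pi y) to the
  summand, which for s >= 3 beats the decay exp(-2 pi y) of the kernel. The denominator gives this
  factor back: up to factorials, the distances from z to 0, ..., k and to k + 1, ..., n multiply to
  two truncated Euler products, each about the square root of sinh(pi y), so that together they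
  supply exp(pi y). Truncation after m factors costs at most exp(y^2 / (2 m)); for m >= \<delta> n
  and y = \<epsilon> n this is the exponential of a small multiple of y if \<epsilon> is small
  against \<delta>. Where one of the products is too short, that is for k near 0 or n, the term (n
  choose k) b^k is itself exponentially smaller than (1 + b)^n, and the crude factor exp(pi y) is
  affordable, again for small \<epsilon>. The estimates are uniform in the complex disc |t| <= 1/4,
  so Cauchy's inequality transfers them to Taylor coefficients.\<close>

lemma prod_one_plus_square_tail_le:
  fixes y :: real
  assumes "1 \<le> m" "m \<le> N"
  shows "(\<Prod>i=Suc m..N. 1 + y\<^sup>2 / (real i)\<^sup>2) \<le> exp (y\<^sup>2 * (1 / real m - 1 / real N))"
  using assms(2)
proof (induction N rule: dec_induct)
  case base
  then show ?case by simp
next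
  case (step N)
  \<comment> \<open>Comparing 1 / i^2 with the telescoping 1 / (i - 1) - 1 / i makes the whole tail
    beyond \<open>m\<close> cost no more than \<open>exp (y\<^sup>2 / m)\<close>.\<close>
  have "1 / (real (Suc N))\<^sup>2 \<le> 1 / real N - 1 / real (Suc N)"
  proof -
    have "0 < real N" using step assms by simp
    moreover have "1 / (real (Suc N))\<^sup>2 \<le> 1 / (real N * real (Suc N))"
      using \<open>0 < real N\<close> by (intro divide_left_mono) (auto simp: power2_eq_square)
    ultimately show ?thesis by (simp add: field_simps)
  qed
  hence "y\<^sup>2 * (1 / (real (Suc N))\<^sup>2) \<le> y\<^sup>2 * (1 / real N - 1 / real (Suc N))"
    by (intro mult_left_mono) auto
  hence "1 + y\<^sup>2 / (real (Suc N))\<^sup>2 \<le> exp (y\<^sup>2 * (1 / real N - 1 / real (Suc N)))"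
    by (intro order.trans[OF exp_ge_add_one_self]) auto
  hence "(\<Prod>i=Suc m..N. 1 + y\<^sup>2 / (real i)\<^sup>2) * (1 + y\<^sup>2 / (real (Suc N))\<^sup>2)
      \<le> exp (y\<^sup>2 * (1 / real m - 1 / real N)) * exp (y\<^sup>2 * (1 / real N - 1 / real (Suc N)))"
    by (intro mult_mono step.IH) (auto intro!: add_nonneg_nonneg)
  also have "\<dots> = exp (y\<^sup>2 * (1 / real m - 1 / real (Suc N)))"
    by (simp add: exp_add[symmetric] algebra_simps)
  finally show ?case using step by (simp add: prod.nat_ivl_Suc')
qed

text \<open>Euler's sine product on the imaginary axis, where each factor turns into 1 + y^2 / k^2
  and the sine into i sinh.\<close>

lemma sinh_product_formula_real:
  fixes y :: real
  shows "(\<lambda>n. pi * y * (\<Prod>k=1..n. 1 + y\<^sup>2 / (real k)\<^sup>2)) \<longlonglongrightarrow> sinh (pi * y)"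
proof -
  have "(\<lambda>n. Im (of_real pi * (\<i> * of_real y) * (\<Prod>k=1..n. 1 - (\<i> * of_real y)\<^sup>2 / of_nat k^2)))
          \<longlonglongrightarrow> Im (sin (of_real pi * (\<i> * of_real y)))"
    by (intro tendsto_Im sin_product_formula_complex)
  moreover have "Im (of_real pi * (\<i> * of_real y) * (\<Prod>k=1..n. 1 - (\<i> * of_real y)\<^sup>2 / of_nat k^2))
      = pi * y * (\<Prod>k=1..n. 1 + y\<^sup>2 / (real k)\<^sup>2)" for n
  proof -
    have "(\<Prod>k=1..n. 1 - (\<i> * of_real y)\<^sup>2 / of_nat k^2) = 
       of_real (\<Prod>k=1..n. 1 + y\<^sup>2 / (real k)\<^sup>2)"
      by (simp add: power_mult_distrib)
    hence "of_real pi * (\<i> * of_real y) * (\<Prod>k=1..n. 1 - (\<i> * of_real y)\<^sup>2 / of_nat k^2) =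
       \<i> * of_real (pi * y * (\<Prod>k=1..n. 1 + y\<^sup>2 / (real k)\<^sup>2))"
      by (simp only: of_real_mult) (simp only: mult_ac)
    thus ?thesis by (simp only: Im_i_times Re_complex_of_real)
  qed
  moreover have "Im (sin (of_real pi * (\<i> * of_real y))) = sinh (pi * y)"
  proof -
    have "sin (of_real pi * (\<i> * complex_of_real y)) = \<i> * of_real (sinh (pi * y))"
      using sin_i_times[of "of_real (pi * y)"]
      by (simp add: sinh_def exp_of_real[symmetric] exp_minus mult_ac scaleR_conv_of_real)
    thus ?thesis by simp
  qed
  ultimately show ?thesis by (simp only:)
qed

text \<open>Euler's product cut off after \<open>m\<close> factors; the part cut off is bounded
  uniformly in \<open>N\<close> by the preceding tail estimate.\<close>

lemma sinh_le_prod_one_plus_square: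
  fixes y :: real
  assumes "1 \<le> m" "0 \<le> y"
  shows "sinh (pi * y) \<le> pi * y * (\<Prod>i=1..m. 1 + y\<^sup>2 / (real i)\<^sup>2) * exp (y\<^sup>2 / real m)"
proof (rule LIMSEQ_le_const2[OF sinh_product_formula_real], intro exI allI impI)
  fix N assume "m \<le> N"
  have nonneg: "0 \<le> (\<Prod>i\<in>A. 1 + y\<^sup>2 / (real i)\<^sup>2)" for A
    by (intro prod_nonneg) (auto intro!: add_nonneg_nonneg)
  have "(\<Prod>i=1..N. 1 + y\<^sup>2 / (real i)\<^sup>2) =
        (\<Prod>i=1..m. 1 + y\<^sup>2 / (real i)\<^sup>2) * (\<Prod>i=Suc m..N. 1 + y\<^sup>2 / (real i)\<^sup>2)"
    using prod.ub_add_nat[of 1 m "\<lambda>i. 1 + y\<^sup>2 / (real i)\<^sup>2" "N - m"] \<open>m \<le> N\<close> by simp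
  also have "(\<Prod>i=Suc m..N. 1 + y\<^sup>2 / (real i)\<^sup>2) \<le> exp (y\<^sup>2 * (1 / real m - 1 / real N))"
    by (rule prod_one_plus_square_tail_le) fact+
  also have "\<dots> \<le> exp (y\<^sup>2 / real m)"
    using assms \<open>m \<le> N\<close> by (auto simp: algebra_simps)
  finally have "(\<Prod>i=1..N. 1 + y\<^sup>2 / (real i)\<^sup>2)
       \<le> (\<Prod>i=1..m. 1 + y\<^sup>2 / (real i)\<^sup>2) * exp (y\<^sup>2 / real m)"
    using nonneg by (simp add: mult_left_mono)
  hence "pi * y * (\<Prod>i=1..N. 1 + y\<^sup>2 / (real i)\<^sup>2)
       \<le> pi * y * ((\<Prod>i=1..m. 1 + y\<^sup>2 / (real i)\<^sup>2) * exp (y\<^sup>2 / real m))"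
    using assms by (intro mult_left_mono) auto
  thus "pi * y * (\<Prod>i=1..N. 1 + y\<^sup>2 / (real i)\<^sup>2)
       \<le> pi * y * (\<Prod>i=1..m. 1 + y\<^sup>2 / (real i)\<^sup>2) * exp (y\<^sup>2 / real m)"
    by (simp add: mult.assoc)
qed

lemma exp_le_four_sinh:
  fixes y :: real assumes "1 \<le> y" shows "exp (pi * y) \<le> 4 * sinh (pi * y)"
proof -
  have "1 * 1 \<le> pi * y" using assms pi_gt3 by (intro mult_mono) auto
  hence 1: "2 \<le> exp (pi * y)" using exp_ge_add_one_self[of "pi * y"] by linarith
  have "exp (- (pi * y)) \<le> 1" using assms by simp
  hence "2 * exp (- (pi * y)) \<le> exp (pi * y)" using 1 by linarith
  thus ?thesis by (simp add: sinh_def)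
qed

text \<open>The factors on the left are the distances from iy to 0, ..., k. Pulling \<open>i\<close>
  out of the factor with index i leaves a truncated Euler product; the factor with index 0 is
  \<open>y\<close>.\<close>

lemma prod_sqrt_eq:
  fixes y :: real
  assumes "0 < y"
  shows "(\<Prod>i\<le>k. sqrt ((real i)\<^sup>2 + y\<^sup>2)) = y * fact k * sqrt (\<Prod>i=1..k. 1 + y\<^sup>2 / (real i)\<^sup>2)"
proof (induction k)
  case 0
  then show ?case using assms by simp
next
  case (Suc k)
  have "sqrt ((real (Suc k))\<^sup>2 + y\<^sup>2) = sqrt ((real (Suc k))\<^sup>2 * (1 + y\<^sup>2 / (real (Suc k))\<^sup>2))"
    by (simp add: field_simps)
  also have "\<dots> = real (Suc k) * sqrt (1 + y\<^sup>2 / (real (Suc k))\<^sup>2)"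
    by (simp only: real_sqrt_mult real_sqrt_abs abs_of_nat)
  finally show ?case using Suc by (simp add: real_sqrt_mult del: of_nat_Suc)
qed

text \<open>Integers j <= k are at horizontal distance at least k - j from z, and integers j > k at
  least j - k - 1. So each side sees horizontal distances at least 0, 1, 2, ... at height
  \<open>y\<close>, and \<open>prod_sqrt_eq\<close> evaluates both products.\<close>

lemma prod_norm_diff_ge:
  fixes z :: complex
  assumes "real k \<le> Re z" "Re z < real k + 1" "k < n" "Im z \<noteq> 0"
  defines "y \<equiv> \<bar>Im z\<bar>"
  shows "y * fact k * sqrt (\<Prod>i=1..k. 1 + y\<^sup>2 / (real i)\<^sup>2) *
         (y * fact (n - k - 1) * sqrt (\<Prod>i=1..n-k-1. 1 + y\<^sup>2 / (real i)\<^sup>2))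
           \<le> (\<Prod>j\<le>n. norm (of_nat j - z))"
proof -
  have y: "y > 0" using assms by auto
  have norm_ge: "sqrt (u\<^sup>2 + y\<^sup>2) \<le> norm (of_nat j - z)" if "0 \<le> u" "u \<le> \<bar>real j - Re z\<bar>" for u j
  proof -
    have "u\<^sup>2 \<le> (real j - Re z)\<^sup>2" using that by (metis abs_le_square_iff abs_of_nonneg)
    thus ?thesis by (simp add: cmod_def y_def)
  qed
  have "y * fact k * sqrt (\<Prod>i=1..k. 1 + y\<^sup>2 / (real i)\<^sup>2) *
         (y * fact (n - k - 1) * sqrt (\<Prod>i=1..n-k-1. 1 + y\<^sup>2 / (real i)\<^sup>2)) = 
     (\<Prod>i\<le>k. sqrt ((real i)\<^sup>2 + y\<^sup>2)) * (\<Prod>i\<le>n-k-1. sqrt ((real i)\<^sup>2 + y\<^sup>2))"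
    using y by (simp add: prod_sqrt_eq)
  also have "(\<Prod>i\<le>k. sqrt ((real i)\<^sup>2 + y\<^sup>2)) = (\<Prod>j\<le>k. sqrt ((real (k - j))\<^sup>2 + y\<^sup>2))"
    by (intro prod.reindex_bij_witness[of _ "\<lambda>j. k - j" "\<lambda>j. k - j"]) auto
  also have "\<dots> \<le> (\<Prod>j\<le>k. norm (of_nat j - z))"
    using assms by (intro prod_mono conjI norm_ge) auto
  also have "(\<Prod>i\<le>n-k-1. sqrt ((real i)\<^sup>2 + y\<^sup>2)) = (\<Prod>j=Suc k..n. sqrt ((real (j - k - 1))\<^sup>2 + y\<^sup>2))"
    using assms by (intro prod.reindex_bij_witness[of _ "\<lambda>j. j - k - 1" "\<lambda>j. j + k + 1"]) auto
  also have "\<dots> \<le> (\<Prod>j=Suc k..n. norm (of_nat j - z))"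
    using assms by (intro prod_mono conjI norm_ge) auto
  also have "(\<Prod>j\<le>k. norm (of_nat j - z)) * \<dots> = (\<Prod>j\<le>n. norm (of_nat j - z))"
    using assms prod.ub_add_nat[of 0 k "\<lambda>j. norm (of_nat j - z)" "n - k"] 
    by (simp add: atMost_atLeast0)
  finally show ?thesis by (simp add: mult_left_mono mult_right_mono prod_nonneg)
qed

text \<open>To the left of 0 every j >= 1 is at distance at least j. The factor for j = 0 is kept as
  it is, since \<open>Re z \<le> 0\<close> gives no positive lower bound for it.\<close>

lemma prod_norm_diff_ge_left:
  fixes z :: complex
  assumes "Re z \<le> 0"
  shows "norm z * fact n \<le> (\<Prod>j\<le>n. norm (of_nat j - z))"
proof -
  have "fact n = (\<Prod>j=1..n. real j)" by (simp add: fact_prod)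
  also have "\<dots> \<le> (\<Prod>j=1..n. norm (of_nat j - z))"
  proof (intro prod_mono conjI)
    fix j :: nat
    have "real j \<le> \<bar>Re (of_nat j - z)\<bar>" using assms by simp
    thus "real j \<le> norm (of_nat j - z)" using abs_Re_le_cmod order.trans by blast
  qed auto
  finally show ?thesis
    by (simp add: atMost_atLeast0 prod.atLeast_Suc_atMost mult_left_mono)
qed

lemma prod_norm_diff_ge_right:
  fixes z :: complex
  assumes "Re z \<ge> real n"
  shows "norm (of_nat n - z) * fact n \<le> (\<Prod>j\<le>n. norm (of_nat j - z))"
proof -
  have "norm (of_nat n - z) * fact n \<le> (\<Prod>j\<le>n. norm (of_nat j - (of_nat n - z)))"
    using assms by (intro prod_norm_diff_ge_left) auto
  also have "\<dots> = (\<Prod>j\<le>n. norm (of_nat j - z))"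
  proof (intro prod.reindex_bij_witness[of _ "\<lambda>j. n - j" "\<lambda>j. n - j"])
    fix j assume "j \<in> {..n}"
    thus "norm (of_nat (n - j) - z) = norm (of_nat j - (of_nat n - z))"
      by (subst norm_minus_commute) (auto simp: of_nat_diff algebra_simps)
  qed auto
  finally show ?thesis .
qed

subsection \<open>The entire binomial coefficient\<close>

definition cbinom :: "nat \<Rightarrow> complex \<Rightarrow> complex" where
  "cbinom n z = fact n * rGamma (1 + z) * rGamma (of_nat n + 1 - z)"

lemma holomorphic_cbinom [holomorphic_intros]: "cbinom n holomorphic_on A"
  unfolding cbinom_def by (intro holomorphic_intros)

lemma cbinom_of_nat:
  assumes "k \<le> n"
  shows "cbinom n (of_nat k) = of_nat (n choose k)"
proof -
  have "rGamma (1 + of_nat k) = (1 / fact k :: complex)" for k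
    using Gamma_fact[of k, where ?'a = complex] by (simp add: rGamma_inverse_Gamma divide_inverse)
  from this[of k] this[of "n - k"] show ?thesis using assms
    by (simp add: cbinom_def binomial_fact of_nat_diff add.commute add_diff_eq)
qed

text \<open>\<open>pochhammer (- z) (Suc n)\<close> is the product of j - z over 0 <= j <= n, so by
  reflection C(n, z) is a sine divided by this product. The multiplied form also holds at the
  integers, where the product vanishes.\<close>

lemma cbinom_mult_pochhammer:
  "cbinom n z * pochhammer (- z) (Suc n) = - (fact n * sin (of_real pi * z) / of_real pi)"
proof -
  have "rGamma (- z) = pochhammer (- z) (Suc n) * rGamma (of_nat n + 1 - z)"
    using pochhammer_rGamma[of "-z" "Suc n"] by (simp add: algebra_simps)
  moreover have "rGamma (- z) * rGamma (1 + z) = - sin (of_real pi * z) / of_real pi"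
    using rGamma_reflection_complex[of "- z"] by simp
  ultimately show ?thesis by (simp add: cbinom_def mult_ac)
qed

lemma norm_sin_le_exp_Im: "norm (sin z) \<le> exp \<bar>Im z\<bar>"
proof -
  have "norm (exp (\<i> * z) - exp (- (\<i> * z))) \<le> exp (- Im z) + exp (Im z)"
    by (intro order.trans[OF norm_triangle_ineq4]) simp
  also have "\<dots> \<le> exp \<bar>Im z\<bar> + exp \<bar>Im z\<bar>" by (intro add_mono) auto
  finally show ?thesis by (simp add: sin_exp_eq norm_divide norm_mult)
qed

text \<open>Each of the bounds for \<open>cbinom\<close> below comes from a particular lower bound
  \<open>P\<close> for the product of distances.\<close>

lemma norm_cbinom_le:
  assumes "0 < P" "P \<le> (\<Prod>j\<le>n. norm (of_nat j - z))"
  shows "norm (cbinom n z) \<le> fact n * exp (pi * \<bar>Im z\<bar>) / (pi * P)"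
proof -
  have "norm (pochhammer (- z) (Suc n)) = (\<Prod>j\<le>n. norm (of_nat j - z))"
    by (simp add: pochhammer_prod prod_norm[symmetric] atMost_atLeast0 atLeastLessThanSuc_atLeastAtMost)
  hence "norm (cbinom n z) * P \<le> norm (cbinom n z) * norm (pochhammer (- z) (Suc n))"
    using assms by (intro mult_left_mono) auto
  also have "\<dots> = fact n * norm (sin (of_real pi * z)) / pi"
    by (simp add: norm_mult[symmetric] cbinom_mult_pochhammer) (simp add: norm_mult norm_divide)
  also have "\<dots> \<le> fact n * exp (pi * \<bar>Im z\<bar>) / pi"
    using norm_sin_le_exp_Im[of "of_real pi * z"]
    by (intro divide_right_mono mult_left_mono) (auto simp: abs_mult)
  finally show ?thesis using assms by (simp add: field_simps)
qed

lemma fact_quotient_eq: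
  assumes "k < n"
  shows "fact n / (fact k * fact (n - k - 1)) = real (n choose k) * real (n - k)"
proof -
  have "(fact (n - k) :: real) = real (n - k) * fact (n - k - 1)"
    using assms by (intro fact_reduce) auto
  moreover have "real (n - k) \<noteq> 0" using assms by simp
  moreover have "real (n choose k) = fact n / (fact k * fact (n - k))"
    using assms by (intro binomial_fact) auto
  ultimately show ?thesis by (simp del: of_nat_diff)
qed

text \<open>The exp(pi y) of the sine cancels against the two truncated Euler products, one on each
  side of z; only the truncation error remains.\<close>

lemma norm_cbinom_le_interior:
  fixes z :: complex
  assumes "real k \<le> Re z" "Re z < real k + 1" "1 \<le> k" "k + 1 < n" "1 \<le> \<bar>Im z\<bar>"
  shows "norm (cbinom n z) \<le> 4 * real n * real (n choose k) *
           exp ((Im z)\<^sup>2 * (1 / real k + 1 / real (n - k - 1)) / 2)"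
proof -
  define y l where "y = \<bar>Im z\<bar>" and "l = n - k - 1"
  have y: "y \<ge> 1" and l: "l \<ge> 1" using assms by (auto simp: y_def l_def)
  define S where "S = (\<lambda>k. \<Prod>i=1..k. 1 + y\<^sup>2 / (real i)\<^sup>2)"
  have S: "S k \<ge> 1" for k
    unfolding S_def by (intro prod_ge_1) auto
  have sinh_S: "exp (pi * y) \<le> 4 * (pi * y * S k * exp (y\<^sup>2 / real k))" if "k \<ge> 1" for k
    using sinh_le_prod_one_plus_square[of k y] exp_le_four_sinh[of y] that y by (simp add: S_def)
  define E where "E = exp (y\<^sup>2 * (1 / real k + 1 / real l) / 2)"
  \<comment> \<open>One copy of exp(pi y) is bounded by the product of length k, the other by that
    of length l. The square root then contains sqrt(S k) sqrt(S l), exactly what the distances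
    contribute to \<open>P\<close>.\<close>
  have "(exp (pi * y))\<^sup>2 \<le> (4 * (pi * y * S k * exp (y\<^sup>2 / real k))) * (4 * (pi * y * S l * exp (y\<^sup>2 / real l)))"
    unfolding power2_eq_square[of "exp (pi * y)"] using S[of k] y
    by (intro mult_mono sinh_S[OF \<open>1 \<le> k\<close>] sinh_S[OF l]) auto
  also have "\<dots> = (4 * pi * y)\<^sup>2 * (S k * S l) * E\<^sup>2"
    by (simp add: E_def power2_eq_square mult_ac exp_add[symmetric] add_divide_distrib distrib_left)
  finally have "sqrt ((exp (pi * y))\<^sup>2) \<le> sqrt ((4 * pi * y)\<^sup>2 * (S k * S l) * E\<^sup>2)"
    by (rule real_sqrt_le_mono)
  hence key: "exp (pi * y) \<le> 4 * pi * y * (sqrt (S k) * sqrt (S l)) * E"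
    using y by (simp add: real_sqrt_mult E_def)
  define P where "P = y * fact k * sqrt (S k) * (y * fact l * sqrt (S l))"
  have P: "0 < P" using y S[of k] S[of l] unfolding P_def by (intro mult_pos_pos) auto
  have "norm (cbinom n z) \<le> fact n * exp (pi * \<bar>Im z\<bar>) / (pi * P)"
  proof (rule norm_cbinom_le)
    show "P \<le> (\<Prod>j\<le>n. norm (of_nat j - z))"
      unfolding P_def S_def y_def l_def using assms by (intro prod_norm_diff_ge) auto
  qed (rule P)
  also have "\<dots> \<le> fact n * (4 * pi * y * (sqrt (S k) * sqrt (S l)) * E) / (pi * P)"
    unfolding y_def[symmetric] using P by (intro divide_right_mono mult_left_mono key) auto
  also have "\<dots> = 4 * (fact n / (fact k * fact l)) * E / y"
    using y S[of k] S[of l] by (simp add: P_def field_simps)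
  also have "fact n / (fact k * fact l) = real (n choose k) * real (n - k)"
    unfolding l_def using assms by (intro fact_quotient_eq) auto
  also have "4 * (real (n choose k) * real (n - k)) * E / y \<le> 4 * (real (n choose k) * real n) * E / 1"
    using y by (intro frac_le mult_right_mono mult_left_mono mult_nonneg_nonneg) (auto simp: E_def)
  finally show ?thesis by (simp add: E_def y_def l_def mult_ac)
qed

text \<open>Only the factorials are kept from the two products, so exp(pi y) survives. This also
  covers k = 0 and k = n - 1, where one of the truncated products is empty.\<close>

lemma norm_cbinom_le_any:
  fixes z :: complex
  assumes "real k \<le> Re z" "Re z < real k + 1" "k < n" "1 \<le> \<bar>Im z\<bar>"
  shows "norm (cbinom n z) \<le> real n * real (n choose k) * exp (pi * \<bar>Im z\<bar>)"
proof -
  define y l where "y = \<bar>Im z\<bar>" and "l = n - k - 1"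
  have y: "y \<ge> 1" using assms by (auto simp: y_def)
  define S where "S = (\<lambda>k. \<Prod>i=1..k. 1 + y\<^sup>2 / (real i)\<^sup>2)"
  have S: "S k \<ge> 1" for k
    unfolding S_def by (intro prod_ge_1) auto
  have "(1 * fact k * 1) * (1 * fact l * 1) \<le> y * fact k * sqrt (S k) * (y * fact l * sqrt (S l))"
    using y S[of k] S[of l] by (intro mult_mono) auto
  also have "\<dots> \<le> (\<Prod>j\<le>n. norm (of_nat j - z))"
    unfolding S_def y_def l_def using assms by (intro prod_norm_diff_ge) auto
  finally have "fact k * fact l \<le> (\<Prod>j\<le>n. norm (of_nat j - z))" by simp
  hence "norm (cbinom n z) \<le> fact n * exp (pi * y) / (pi * (fact k * fact l))"
    unfolding y_def by (intro norm_cbinom_le) auto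
  also have "\<dots> \<le> fact n * exp (pi * y) / (1 * (fact k * fact l))"
    using pi_gt3 by (intro divide_left_mono mult_right_mono) auto
  also have "\<dots> = (fact n / (fact k * fact l)) * exp (pi * y)"
    by simp
  also have "fact n / (fact k * fact l) = real (n choose k) * real (n - k)"
    unfolding l_def using assms by (intro fact_quotient_eq) auto
  also have "\<dots> * exp (pi * y) \<le> real (n choose k) * real n * exp (pi * y)"
    by (intro mult_right_mono mult_left_mono) auto
  finally show ?thesis by (simp add: y_def mult_ac)
qed

text \<open>The constant 1/2 is the distance of the vertical sides Re z = -1/2 and Re z = n + 1/2
  from the integers 0, ..., n.\<close>

lemma norm_cbinom_le_outside:
  fixes z :: complex
  assumes "Re z \<le> 0 \<and> 1 / 2 \<le> norm z \<or> real n \<le> Re z \<and> 1 / 2 \<le> norm (of_nat n - z)"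
  shows "norm (cbinom n z) \<le> exp (pi * \<bar>Im z\<bar>)"
proof -
  have "1 / 2 * fact n \<le> (\<Prod>j\<le>n. norm (of_nat j - z))"
    using assms
  proof
    assume "Re z \<le> 0 \<and> 1 / 2 \<le> norm z"
    thus ?thesis by (intro order.trans[OF mult_right_mono prod_norm_diff_ge_left]) auto
  next
    assume "real n \<le> Re z \<and> 1 / 2 \<le> norm (of_nat n - z)"
    thus ?thesis by (intro order.trans[OF mult_right_mono prod_norm_diff_ge_right]) auto
  qed
  hence "norm (cbinom n z) \<le> fact n * exp (pi * \<bar>Im z\<bar>) / (pi * (1 / 2 * fact n))"
    by (intro norm_cbinom_le) auto
  also have "\<dots> \<le> exp (pi * \<bar>Im z\<bar>)"
    using pi_gt3 by (simp add: field_simps)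
  finally show ?thesis .
qed

section \<open>Binomial terms near the two ends of the range\<close>

lemma binomial_power_le_tilted:
  fixes b u :: real
  assumes "0 < b" "0 < u" "k \<le> n"
  shows "real (n choose k) * b ^ k \<le> (b / u) ^ k * (1 + u) ^ n"
proof -
  \<comment> \<open>Exponential tilting: a single term is at most the whole expansion of (1 + u)^n,
    and u is free to be chosen according to the position of k.\<close>
  have "real (n choose k) * u ^ k \<le> (\<Sum>j\<le>n. real (n choose j) * u ^ j)"
    using assms by (intro member_le_sum) auto
  also have "\<dots> = (1 + u) ^ n"
    by (simp add: binomial_ring[of u 1 n] add.commute[of 1 u] mult_ac)
  finally have "(b / u) ^ k * (real (n choose k) * u ^ k) \<le> (b / u) ^ k * (1 + u) ^ n"
    using assms by (intro mult_left_mono) auto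
  thus ?thesis using assms by (simp add: power_divide field_simps)
qed

text \<open>Tilting with u = b / 2 lowers the base 1 + b to 1 + b / 2 at the price 2^k, and u = 2 b
  lowers it to b + 1 / 2 at the price 2^(n - k). Each price is small near its own end. The doubled
  width \<open>2 * \<delta>\<close> at the upper end leaves room for passing from n - k to n - k -
  1.\<close>

lemma edge_binomial_bound:
  fixes b :: real
  assumes b: "0 < b"
  obtains \<delta> \<epsilon> q where "0 < \<delta>" "0 < \<epsilon>" "0 < q" "q < 1"
    "\<And>n k. k \<le> n \<Longrightarrow> real k \<le> \<delta> * real n \<or> real (n - k) \<le> 2 * \<delta> * real n \<Longrightarrow>
       real (n choose k) * b ^ k * exp (pi * \<epsilon> * real n) \<le> (q * (1 + b)) ^ n"
proof -
  define \<theta> where "\<theta> = max (1 + b / 2) (b + 1 / 2) / (1 + b)"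
  have \<theta>: "0 < \<theta>" "\<theta> < 1" using b by (auto simp: \<theta>_def field_simps max_def)
  \<comment> \<open>The gain \<theta>^n = exp(-4 \<gamma> n) is spent as follows: one \<gamma> n
    pays for 2^k or 2^(n - k), one pays for \<open>exp (pi * \<epsilon> * real n)\<close>, and the
    remaining 2 \<gamma> n form \<open>q ^ n\<close>.\<close>
  define \<gamma> where "\<gamma> = - ln \<theta> / 4"
  have \<gamma>: "\<gamma> > 0" using \<theta> by (simp add: \<gamma>_def)
  define \<delta> \<epsilon> q where "\<delta> = \<gamma> / (2 * ln 2)" and "\<epsilon> = \<gamma> / pi" and "q = exp (- (2 * \<gamma>))"
  have \<theta>_eq: "\<theta> = exp (- (4 * \<gamma>))" using \<theta> by (simp add: \<gamma>_def)
  have main: "real (n choose k) * b ^ k * exp (pi * \<epsilon> * real n) \<le> (q * (1 + b)) ^ n"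
    if kn: "k \<le> n" and edge: "real k \<le> \<delta> * real n \<or> real (n - k) \<le> 2 * \<delta> * real n" for n k
  proof -
    have "real (n choose k) * b ^ k \<le> exp (\<gamma> * real n) * (\<theta> * (1 + b)) ^ n"
      using edge
    proof
      assume k: "real k \<le> \<delta> * real n"
      have "real (n choose k) * b ^ k \<le> (b / (b / 2)) ^ k * (1 + b / 2) ^ n"
        using b kn by (intro binomial_power_le_tilted) auto
      also have "(b / (b / 2)) ^ k = exp (ln 2 * real k)"
        using b by (simp add: mult.commute[of "ln 2"] exp_of_nat_mult)
      also have "\<dots> \<le> exp (\<gamma> * real n)"
      proof -
        have "ln 2 * real k \<le> ln 2 * (\<delta> * real n)" using k by (intro mult_left_mono) auto
        also have "\<dots> = \<gamma> / 2 * real n" by (simp add: \<delta>_def)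
        also have "\<dots> \<le> \<gamma> * real n" using \<gamma> by (intro mult_right_mono) auto
        finally show ?thesis by simp
      qed
      also have "(1 + b / 2) ^ n \<le> (\<theta> * (1 + b)) ^ n"
        using b by (intro power_mono) (auto simp: \<theta>_def)
      finally show ?thesis using b by (simp add: mult_left_mono mult_right_mono)
    next
      assume k: "real (n - k) \<le> 2 * \<delta> * real n"
      have "real (n choose k) * b ^ k \<le> (b / (2 * b)) ^ k * (1 + 2 * b) ^ n"
        using b kn by (intro binomial_power_le_tilted) auto
      also have "\<dots> = 2 ^ (n - k) * (b + 1 / 2) ^ n"
      proof -
        have "(1 + 2 * b) ^ n = 2 ^ n * (b + 1 / 2) ^ n"
          by (simp add: power_mult_distrib[symmetric] algebra_simps)
        moreover have "(2::real) ^ n = 2 ^ k * 2 ^ (n - k)" using kn by (simp add: power_add[symmetric])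
        ultimately show ?thesis using b by (simp add: power_divide)
      qed
      also have "(2::real) ^ (n - k) = exp (ln 2 * real (n - k))"
        by (simp add: mult.commute[of "ln 2"] exp_of_nat_mult del: of_nat_diff)
      also have "\<dots> \<le> exp (\<gamma> * real n)"
      proof -
        have "ln 2 * real (n - k) \<le> ln 2 * (2 * \<delta> * real n)" using k by (intro mult_left_mono) auto
        also have "\<dots> = \<gamma> * real n" by (simp add: \<delta>_def)
        finally show ?thesis by simp
      qed
      also have "(b + 1 / 2) ^ n \<le> (\<theta> * (1 + b)) ^ n"
        using b by (intro power_mono) (auto simp: \<theta>_def)
      finally show ?thesis using b by (simp add: mult_left_mono mult_right_mono)
    qed
    hence "real (n choose k) * b ^ k * exp (pi * \<epsilon> * real n) \<le>
        exp (\<gamma> * real n) * (\<theta> * (1 + b)) ^ n * exp (pi * \<epsilon> * real n)"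
      by (intro mult_right_mono) auto
    also have "\<dots> = (exp \<gamma> * \<theta> * exp \<gamma> * (1 + b)) ^ n"
      by (simp add: \<epsilon>_def power_mult_distrib exp_of_nat2_mult mult_ac)
    also have "exp \<gamma> * \<theta> * exp \<gamma> = q"
      by (simp add: \<theta>_eq q_def exp_add[symmetric])
    finally show ?thesis .
  qed
  have "0 < \<delta>" "0 < \<epsilon>" "0 < q" "q < 1"
    using \<gamma> by (auto simp: \<delta>_def \<epsilon>_def q_def)
  from that[OF this main] show ?thesis by blast
qed

subsection \<open>Summation by the residue theorem\<close>

lemma contour_integrable_rectpath:
  assumes "continuous_on (path_image (rectpath a c)) f"
  shows "f contour_integrable_on rectpath a c"
proof -
  define b d where "b = Complex (Re c) (Im a)" and "d = Complex (Re a) (Im c)"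
  have rp: "rectpath a c = linepath a b +++ linepath b c +++ linepath c d +++ linepath d a"
    by (simp add: rectpath_def b_def d_def Let_def)
  show ?thesis
    using assms unfolding rp
    by (auto simp: path_image_join intro!: contour_integrable_continuous_linepath 
             elim: continuous_on_subset)
qed

lemma contour_integral_rectpath_bound:
  assumes cont: "continuous_on (path_image (rectpath a c)) f"
    and ac: "Re a \<le> Re c" "Im a \<le> Im c"
    and B: "\<And>z. z \<in> path_image (rectpath a c) \<Longrightarrow> norm (f z) \<le> B"
  shows "norm (contour_integral (rectpath a c) f) \<le> B * (2 * (Re c - Re a) + 2 * (Im c - Im a))"
proof -
  define b d where "b = Complex (Re c) (Im a)" and "d = Complex (Re a) (Im c)"
  have rp: "rectpath a c = linepath a b +++ linepath b c +++ linepath c d +++ linepath d a"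
    by (simp add: rectpath_def b_def d_def Let_def)
  have pi: "path_image (rectpath a c) = 
    closed_segment a b \<union> closed_segment b c \<union> closed_segment c d \<union> closed_segment d a"
    unfolding rp by (simp add: path_image_join Un_assoc)
  have "a \<in> path_image (rectpath a c)" unfolding pi by simp
  hence "0 \<le> B" using B norm_ge_zero order.trans by blast
  have int: "f contour_integrable_on linepath u v"
      and bound: "norm (contour_integral (linepath u v) f) \<le> B * norm (v - u)"
    if "closed_segment u v \<subseteq> path_image (rectpath a c)" for u v
  proof -
    show "f contour_integrable_on linepath u v"
      using continuous_on_subset[OF cont that] by (rule contour_integrable_continuous_linepath)
    thus "norm (contour_integral (linepath u v) f) \<le> B * norm (v - u)"
      using that B \<open>0 \<le> B\<close> by (intro contour_integral_bound_linepath) auto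
  qed
  have seg: "closed_segment a b \<subseteq> path_image (rectpath a c)"
     "closed_segment b c \<subseteq> path_image (rectpath a c)"
     "closed_segment c d \<subseteq> path_image (rectpath a c)"
     "closed_segment d a \<subseteq> path_image (rectpath a c)"
    unfolding pi by auto
  have n: "norm (b - a) = Re c - Re a" "norm (c - b) = Im c - Im a"
     "norm (d - c) = Re c - Re a" "norm (a - d) = Im c - Im a"
    using ac by (auto simp: b_def d_def cmod_def)
  have "contour_integral (rectpath a c) f = contour_integral (linepath a b) f +
     (contour_integral (linepath b c) f + (contour_integral (linepath c d) f + contour_integral (linepath d a) f))"
    unfolding rp using int seg by (simp add: valid_path_join)
  also have "norm \<dots> \<le> B * norm (b - a) + (B * norm (c - b) + (B * norm (d - c) + B * norm (a - d)))"
    by (intro norm_triangle_le add_mono bound seg order.trans[OF norm_triangle_ineq])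
  finally show ?thesis by (simp add: n algebra_simps)
qed

lemma sin_pi_diff_eq_0D:
  assumes "sin (of_real pi * (z - t)) = (0::complex)"
  obtains m :: int where "z = of_int m + t"
proof -
  obtain m :: int where "of_real pi * (z - t) = complex_of_real (of_int m * pi)"
    using assms by (auto simp: sin_eq_0)
  hence "of_real pi * (z - t) = of_real pi * of_int m" by (simp add: mult.commute)
  hence "z - t = of_int m" by (subst (asm) mult_left_cancel) auto
  thus ?thesis by (intro that[of m]) (simp add: algebra_simps)
qed

lemma contour_integral_rectpath_cot:
  fixes F :: "complex \<Rightarrow> complex" and n :: nat
  assumes F: "F holomorphic_on UNIV" and t: "norm t \<le> 1 / 4" and Y: "Y > 1 / 4"
  defines "R \<equiv> rectpath (Complex (- 1 / 2) (- Y)) (Complex (real n + 1 / 2) Y)"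
  shows "contour_integral R (\<lambda>z. F z * (of_real pi * cot (of_real pi * (z - t)))) =
           2 * of_real pi * \<i> * (\<Sum>k\<le>n. F (of_nat k + t))" (is "contour_integral R ?f = _")
    and "continuous_on (path_image R) (\<lambda>z. F z * (of_real pi * cot (of_real pi * (z - t))))"
proof -
  have t': "\<bar>Re t\<bar> \<le> 1 / 4" "\<bar>Im t\<bar> \<le> 1 / 4"
    using t abs_Re_le_cmod[of t] abs_Im_le_cmod[of t] by linarith+
  \<comment> \<open>As |Re t| <= 1/4, the poles m + t with m < 0 or m > n have real part at most
    -3/4 or at least n + 3/4. The value 5/8 lies between 1/2 and 3/4, so the strip contains the
    rectangle but none of these poles.\<close>
  define S where "S = {z. - 5 / 8 < Re z \<and> Re z < real n + 5 / 8}"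
  define pts where "pts = (\<lambda>k. of_nat k + t) ` {..n}"
  have S_eq: "S = {z. Re z > - 5 / 8} \<inter> {z. Re z < real n + 5 / 8}"
    by (auto simp: S_def)
  have "open S" unfolding S_eq by (intro open_Int open_halfspace_Re_gt open_halfspace_Re_lt)
  have "convex S" unfolding S_eq by (intro convex_Int convex_halfspace_Re_gt convex_halfspace_Re_lt)
  hence "connected S" by (rule convex_connected)
  have nz: "sin (of_real pi * (z - t)) \<noteq> 0" if "z \<in> S - pts" for z
  proof
    assume "sin (of_real pi * (z - t)) = 0"
    then obtain m where m: "z = of_int m + t" by (rule sin_pi_diff_eq_0D)
    hence "- 5 / 8 < of_int m + Re t" "of_int m + Re t < real n + 5 / 8"
      using that by (auto simp: S_def)
    hence "of_int m > (-1 :: real)" "of_int m < real n + 1" using t' by linarith+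
    hence "m \<ge> 0" "nat m \<le> n" by linarith+
    hence "z = of_nat (nat m) + t" using m by simp
    hence "z \<in> pts" using \<open>nat m \<le> n\<close> unfolding pts_def by blast
    thus False using that by simp
  qed
  have holo: "?f holomorphic_on A" if "\<And>z. z \<in> A \<Longrightarrow> sin (of_real pi * (z - t)) \<noteq> 0" for A
    unfolding cot_def using that by (intro holomorphic_intros holomorphic_on_subset[OF F]) auto
  have pimg: "path_image R \<subseteq> S - pts"
  proof
    fix z assume "z \<in> path_image R"
    hence z: "Re z \<in> {-1/2, real n + 1/2} \<and> Im z \<in> {-Y..Y} \<or> Im z \<in> {-Y, Y} \<and> Re z \<in> {-1/2..real n + 1/2}"
      using Y by (auto simp: R_def path_image_rectpath)
    have "z \<noteq> of_nat k + t" if "k \<le> n" for k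
    proof
      assume "z = of_nat k + t"
      hence "Re z = real k + Re t" "Im z = Im t" by auto
      thus False using z t' Y that by auto
    qed
    thus "z \<in> S - pts" using z by (auto simp: S_def pts_def)
  qed
  show "continuous_on (path_image R) ?f"
    using pimg nz by (intro holomorphic_on_imp_continuous_on holo) blast
  have "contour_integral R ?f = 2 * pi * \<i> * (\<Sum>p\<in>pts. winding_number R p * residue ?f p)"
  proof (rule Residue_theorem[of S])
    show "?f holomorphic_on S - pts" by (intro holo nz)
    show "\<forall>z. z \<notin> S \<longrightarrow> winding_number R z = 0"
    proof (intro allI impI)
      fix z assume "z \<notin> S"
      thus "winding_number R z = 0"
        unfolding R_def using Y by (intro winding_number_rectpath_outside) (auto simp: S_def in_cbox_complex_iff)
    qed
  qed (use pimg \<open>open S\<close> \<open>connected S\<close> in \<open>auto simp: R_def pts_def\<close>)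
  also have "(\<Sum>p\<in>pts. winding_number R p * residue ?f p) = (\<Sum>p\<in>pts. F p)"
  proof (rule sum.cong[OF refl])
    fix p assume "p \<in> pts"
    then obtain k where k: "k \<le> n" "p = of_nat k + t" by (auto simp: pts_def)
    have "winding_number R p = 1"
      unfolding R_def using k t' Y by (intro winding_number_rectpath) (auto simp: in_box_complex_iff)
    \<comment> \<open>The sine has a simple zero at p, and the pi in the kernel cancels the pi in
      its derivative.\<close>
    moreover have "residue ?f p = F p"
    proof (rule residue_simple')
      define U where "U = S - (pts - {p})"
      show "open U" unfolding U_def using \<open>open S\<close> by (intro open_Diff finite_imp_closed) (auto simp: pts_def)
      show "p \<in> U" using k t' by (auto simp: U_def S_def)
      show "?f holomorphic_on U - {p}" by (intro holo nz) (auto simp: U_def)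
      have k0: "of_real pi * (p - t) = of_real (pi * real k)" using k by simp
      have sk: "sin (of_real pi * (p - t)) = 0" unfolding k0 sin_of_real by simp
      have ck: "cos (of_real pi * (p - t)) \<noteq> 0" unfolding k0 cos_of_real by simp
      have "((\<lambda>w. sin (of_real pi * (w - t))) has_field_derivative of_real pi * cos (of_real pi * (p - t))) (at p)"
        by (auto intro!: derivative_eq_intros)
      hence "((\<lambda>w. sin (of_real pi * (w - t)) / (w - p)) \<longlongrightarrow> of_real pi * cos (of_real pi * (p - t))) (at p)"
        by (simp add: has_field_derivative_iff sk)
      moreover have "((\<lambda>w. F w * (of_real pi * cos (of_real pi * (w - t)))) \<longlongrightarrow>
            F p * (of_real pi * cos (of_real pi * (p - t)))) (at p)"
      proof -
        have "isCont F p" using holomorphic_on_imp_continuous_on[OF F] 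
          by (simp add: continuous_on_eq_continuous_at)
        thus ?thesis by (intro tendsto_intros) (auto simp: isCont_def)
      qed
      ultimately have "((\<lambda>w. F w * (of_real pi * cos (of_real pi * (w - t))) / (sin (of_real pi * (w - t)) / (w - p))) \<longlongrightarrow>
            F p * (of_real pi * cos (of_real pi * (p - t))) / (of_real pi * cos (of_real pi * (p - t)))) (at p)"
        using ck by (intro tendsto_divide) auto
      thus "((\<lambda>w. ?f w * (w - p)) \<longlongrightarrow> F p) (at p)"
        using ck by (simp add: cot_def mult_ac)
    qed
    ultimately show "winding_number R p * residue ?f p = F p" by simp
  qed
  also have "\<dots> = (\<Sum>k\<le>n. F (of_nat k + t))"
    unfolding pts_def by (subst sum.reindex) (auto intro!: inj_onI)
  finally show "contour_integral R ?f = 2 * of_real pi * \<i> * (\<Sum>k\<le>n. F (of_nat k + t))"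
    by simp
qed

section \<open>The cotangent kernel away from its poles\<close>

lemma norm_cot_plus_i_le:
  assumes "1 / 2 \<le> Im w"
  shows "norm (cot (of_real pi * w) + \<i>) \<le> 4 * exp (- (2 * pi * Im w))"
proof -
  define v where "v = of_real pi * w"
  have "1 \<le> 2 * Im v" using assms pi_gt3 mult_mono[of 3 pi "1/2" "Im w"] by (simp add: v_def)
  hence e: "2 \<le> exp (2 * Im v)" using exp_ge_add_one_self[of "2 * Im v"] by linarith
  have "exp (Im v) - exp (- Im v) = norm (exp (- (\<i> * v))) - norm (exp (\<i> * v))" by simp
  also have "\<dots> \<le> norm (exp (- (\<i> * v)) - exp (\<i> * v))" by (rule norm_triangle_ineq2)
  also have "\<dots> = 2 * norm (sin v)"
    by (simp add: sin_exp_eq norm_divide norm_mult norm_minus_commute)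
  finally have "exp (Im v) - exp (- Im v) \<le> 2 * norm (sin v)" .
  moreover have "exp (- Im v) * 2 \<le> exp (- Im v) * exp (2 * Im v)" using e by (intro mult_left_mono) auto
  hence "2 * exp (- Im v) \<le> exp (Im v)" by (simp add: exp_add[symmetric])
  ultimately have s: "exp (Im v) \<le> 4 * norm (sin v)" by linarith
  hence nz: "sin v \<noteq> 0" by (metis exp_gt_zero mult_zero_right norm_zero not_less)
  \<comment> \<open>The cotangent tends to -i in the upper half plane, and this is the exact
    remainder: exp(-Im v) over a sine of size about exp(Im v).\<close>
  have "cot v + \<i> = exp (\<i> * v) / sin v"
    using nz exp_Euler[of v] by (simp add: cot_def field_simps)
  hence "norm (cot v + \<i>) = exp (- Im v) / norm (sin v)" by (simp add: norm_divide)
  also have "\<dots> \<le> exp (- Im v) / (exp (Im v) / 4)" using s nz by (intro divide_left_mono mult_pos_pos) auto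
  also have "\<dots> = 4 * exp (- (2 * Im v))" by (simp add: exp_minus field_simps exp_add[symmetric])
  finally show ?thesis by (simp add: v_def mult_ac)
qed

lemma norm_cot_minus_i_le:
  assumes "Im w \<le> - 1 / 2"
  shows "norm (cot (of_real pi * w) - \<i>) \<le> 4 * exp (2 * pi * Im w)"
proof -
  have "cot (of_real pi * w) - \<i> = - (cot (of_real pi * (- w)) + \<i>)" by (simp add: cot_def)
  thus ?thesis using norm_cot_plus_i_le[of "- w"] assms by (simp only: norm_minus_cancel) (simp add: mult_ac)
qed

text \<open>|cos(pi w)|^2 - |sin(pi w)|^2 = cos(2 pi Re w) for every Im w, and this is not positive
  within 1/4 of a half-integer. The tolerance 1/4 is there for the shift by t.\<close>

lemma norm_cot_le_one:
  assumes "\<bar>Re w - (real_of_int m + 1 / 2)\<bar> \<le> 1 / 4"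
  shows "norm (cot (of_real pi * w)) \<le> 1"
proof -
  define d where "d = Re w - (real_of_int m + 1 / 2)"
  have "cos (2 * (pi * Re w)) = cos (2 * pi * d + pi + 2 * pi * real_of_int m)"
    by (simp add: d_def algebra_simps)
  also have "\<dots> = cos (2 * pi * d + pi)" by (simp add: cos_add sin_add)
  also have "\<dots> = - cos (2 * pi * d)" by (simp add: cos_add)
  finally have c: "cos (2 * (pi * Re w)) = - cos (2 * pi * d)" .
  have "cos (2 * pi * d) \<ge> 0"
  proof (rule cos_ge_zero)
    have "2 * pi * \<bar>d\<bar> \<le> 2 * pi * (1 / 4)" using assms by (intro mult_left_mono) (auto simp: d_def)
    hence "\<bar>2 * pi * d\<bar> \<le> pi / 2" by (simp add: abs_mult)
    thus "- (pi / 2) \<le> 2 * pi * d" "2 * pi * d \<le> pi / 2" by linarith+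
  qed
  hence c: "cos (2 * (pi * Re w)) \<le> 0" using c by simp
  have "norm (cos (of_real pi * w)) ^ 2 \<le> norm (sin (of_real pi * w)) ^ 2"
  proof -
    have "norm (sin (of_real pi * w)) ^ 2 = norm (cos (of_real (pi / 2) - of_real pi * w)) ^ 2"
      by (simp add: sin_cos_eq)
    also have "\<dots> = sin (pi * Re w) ^ 2 + (exp (pi * Im w) - inverse (exp (pi * Im w))) ^ 2 / 4"
      unfolding norm_cos_squared by (simp add: cos_diff exp_minus power2_commute)
    finally show ?thesis
      using c by (simp add: norm_cos_squared cos_double)
  qed
  hence "norm (cos (of_real pi * w)) \<le> norm (sin (of_real pi * w))"
    by (rule power2_le_imp_le) auto
  thus ?thesis by (simp add: cot_def norm_divide divide_le_eq_1)
qed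

subsection \<open>Shift invariance of the sum up to an exponentially small error\<close>

definition wcbinom :: "real \<Rightarrow> nat \<Rightarrow> complex \<Rightarrow> complex" where
  "wcbinom b n z = cbinom n z * exp (z * of_real (ln b))"

lemma holomorphic_wcbinom [holomorphic_intros]: "wcbinom b n holomorphic_on A"
  unfolding wcbinom_def by (intro holomorphic_intros)

lemma wcbinom_of_nat:
  assumes "0 < b" "k \<le> n"
  shows "wcbinom b n (of_nat k) = of_real (real (n choose k) * b ^ k)"
proof -
  have "exp (of_nat k * complex_of_real (ln b)) = of_real (b ^ k)"
    using assms by (simp add: exp_of_nat_mult exp_of_real)
  thus ?thesis using assms by (simp add: wcbinom_def cbinom_of_nat)
qed

text \<open>The constant equals 2 + b + 1 / b and so dominates both b and 1 / b, which treats b >= 1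
  and b < 1 alike.\<close>

lemma powr_le_power_shift:
  fixes b :: real
  assumes b: "0 < b" and "\<bar>x - real k\<bar> \<le> 1"
  shows "b powr x \<le> (1 + b) * (1 + 1 / b) * b ^ k"
proof -
  have "b powr (x - real k) \<le> (1 + b) * (1 + 1 / b)"
  proof (cases "b \<ge> 1")
    case True
    hence "b powr (x - real k) \<le> b powr 1" using assms by (intro powr_mono) auto
    also have "\<dots> \<le> (1 + b) * (1 + 1 / b)" using b by (simp add: field_simps)
    finally show ?thesis .
  next
    case False
    hence "b powr (x - real k) \<le> b powr (- 1)" using assms by (intro powr_mono') auto
    also have "\<dots> \<le> (1 + b) * (1 + 1 / b)" using b by (simp add: powr_minus field_simps)
    finally show ?thesis .
  qed
  moreover have "b powr x = b powr (x - real k) * b ^ k"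
    using b by (simp add: powr_diff powr_realpow)
  ultimately show ?thesis using b by (simp add: mult_right_mono)
qed

lemma norm_wcbinom_le:
  assumes "0 < b" "\<bar>Re z - real k\<bar> \<le> 1"
  shows "norm (wcbinom b n z) \<le> (1 + b) * (1 + 1 / b) * (norm (cbinom n z) * b ^ k)"
proof -
  have "norm (wcbinom b n z) = norm (cbinom n z) * b powr (Re z)"
    using assms by (simp add: wcbinom_def norm_mult powr_def)
  also have "\<dots> \<le> norm (cbinom n z) * ((1 + b) * (1 + 1 / b) * b ^ k)"
    by (intro mult_left_mono powr_le_power_shift assms) auto
  finally show ?thesis by (simp add: mult_ac)
qed

text \<open>On the horizontal sides, at height Y = \<epsilon> n, an excess exp(\<eta> Y) over (1 +
  b)^n is tolerable because the kernel is small there. On the vertical sides the kernel is merely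
  bounded, so the gain \<open>q ^ n\<close> must come from the summand.\<close>

lemma wcbinom_rectangle_bound:
  fixes b \<eta> :: real
  assumes b: "0 < b" and \<eta>: "0 < \<eta>"
  obtains \<epsilon> K q N where "0 < \<epsilon>" "0 < K" "0 < q" "q < 1"
    "\<And>n. N \<le> n \<Longrightarrow> 1 \<le> \<epsilon> * real n"
    "\<And>n z. N \<le> n \<Longrightarrow> - 1 / 2 \<le> Re z \<Longrightarrow> Re z \<le> real n + 1 / 2 \<Longrightarrow> \<bar>Im z\<bar> = \<epsilon> * real n \<Longrightarrow>
       norm (wcbinom b n z) \<le> K * (real n + 1) * ((1 + b) ^ n * exp (\<eta> * (\<epsilon> * real n)))"
    "\<And>n z. N \<le> n \<Longrightarrow> Re z = - 1 / 2 \<or> Re z = real n + 1 / 2 \<Longrightarrow> \<bar>Im z\<bar> \<le> \<epsilon> * real n \<Longrightarrow>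
       norm (wcbinom b n z) \<le> K * (q * (1 + b)) ^ n"
proof -
  obtain \<delta> \<epsilon>1 q where \<delta>: "0 < \<delta>" and \<epsilon>1: "0 < \<epsilon>1" and q: "0 < q" "q < 1" and edge:
    "\<And>n k. k \<le> n \<Longrightarrow> real k \<le> \<delta> * real n \<or> real (n - k) \<le> 2 * \<delta> * real n \<Longrightarrow>
       real (n choose k) * b ^ k * exp (pi * \<epsilon>1 * real n) \<le> (q * (1 + b)) ^ n"
    using edge_binomial_bound[OF b] by metis
  \<comment> \<open>\<open>\<epsilon> \<le> \<epsilon>1\<close> makes the edge bound available;
    \<open>\<epsilon> \<le> \<eta> * \<delta>\<close> keeps the truncation error exp(Y^2 / (\<delta>
    n)) = exp((\<epsilon> / \<delta>) Y) below exp(\<eta> Y).\<close>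
  define \<epsilon> where "\<epsilon> = min \<epsilon>1 (\<eta> * \<delta>)"
  have \<epsilon>: "0 < \<epsilon>" "\<epsilon> \<le> \<epsilon>1" "\<epsilon> \<le> \<eta> * \<delta>" using \<epsilon>1 \<delta> \<eta> by (auto simp: \<epsilon>_def)
  define M where "M = (1 + b) * (1 + 1 / b)"
  have M: "M > 0" using b by (auto simp: M_def intro!: mult_pos_pos add_pos_pos)
  define K where "K = 4 * M"
  \<comment> \<open>From \<open>N\<close> on the height is at least 1, and \<delta> n >= 1; the
    latter gives k >= 1 and n - k - 1 >= \<delta> n for all k away from the ends.\<close>
  define N where "N = nat \<lceil>1 / \<epsilon>\<rceil> + nat \<lceil>1 / \<delta>\<rceil>"
  have N: "1 \<le> \<epsilon> * real n" "1 \<le> \<delta> * real n" if "N \<le> n" for n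
  proof -
    have "1 / \<epsilon> \<le> real n" "1 / \<delta> \<le> real n" using that \<epsilon>(1) \<delta> unfolding N_def by linarith+
    thus "1 \<le> \<epsilon> * real n" "1 \<le> \<delta> * real n" using \<epsilon>(1) \<delta> by (simp_all add: field_simps)
  qed
  have edge': "real (n choose k) * b ^ k * exp (pi * y) \<le> (q * (1 + b)) ^ n"
    if "k \<le> n" "real k \<le> \<delta> * real n \<or> real (n - k) \<le> 2 * \<delta> * real n" "y \<le> \<epsilon> * real n" for n k y
  proof -
    have "y \<le> \<epsilon>1 * real n" using that(3) \<epsilon>(2) mult_right_mono[of \<epsilon> \<epsilon>1 "real n"] by simp
    hence "pi * y \<le> pi * \<epsilon>1 * real n" by simp
    hence "real (n choose k) * b ^ k * exp (pi * y) \<le> real (n choose k) * b ^ k * exp (pi * \<epsilon>1 * real n)"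
      using b by (intro mult_left_mono) auto
    also have "\<dots> \<le> (q * (1 + b)) ^ n" by (rule edge) (use that in auto)
    finally show ?thesis .
  qed
  have q_le: "(q * (1 + b)) ^ n \<le> (1 + b) ^ n" for n
    using q b by (intro power_mono) auto
  have outside: "norm (wcbinom b n z) \<le> K * (q * (1 + b)) ^ n"
    if z: "- 1 / 2 \<le> Re z \<and> Re z \<le> 0 \<and> 1 / 2 \<le> norm z \<or> 
           real n \<le> Re z \<and> Re z \<le> real n + 1 / 2 \<and> 1 / 2 \<le> norm (of_nat n - z)"
     and y: "\<bar>Im z\<bar> \<le> \<epsilon> * real n" for n z
  proof -
    define k where "k = (if Re z \<le> 0 \<and> 1 / 2 \<le> norm z \<and> - 1 / 2 \<le> Re z then 0 else n)"
    have k: "k = 0 \<or> k = n" "k \<le> n" "\<bar>Re z - real k\<bar> \<le> 1" using z by (auto simp: k_def)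
    have "norm (wcbinom b n z) \<le> M * (norm (cbinom n z) * b ^ k)"
      unfolding M_def by (intro norm_wcbinom_le b k)
    also have "norm (cbinom n z) * b ^ k \<le> exp (pi * \<bar>Im z\<bar>) * b ^ k"
      using z b by (intro mult_right_mono norm_cbinom_le_outside) auto
    \<comment> \<open>For k = 0 and k = n the binomial coefficient is 1; inserting it brings the
      term under the edge bound.\<close>
    also have "\<dots> = real (n choose k) * b ^ k * exp (pi * \<bar>Im z\<bar>)"
      using k(1) by auto
    also have "\<dots> \<le> (q * (1 + b)) ^ n"
      using k \<delta> y by (intro edge') auto
    also have "M * (q * (1 + b)) ^ n \<le> K * (q * (1 + b)) ^ n"
      using M q b by (intro mult_right_mono) (auto simp: K_def)
    finally show ?thesis using M by simp
  qed
  show ?thesis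
  proof (rule that[of \<epsilon> K q N])
    fix n z
    assume n: "N \<le> n" and z: "- 1 / 2 \<le> Re z" "Re z \<le> real n + 1 / 2" "\<bar>Im z\<bar> = \<epsilon> * real n"
    define Q where "Q = (1 + b) ^ n * exp (\<eta> * (\<epsilon> * real n))"
    have pow_le_Q: "(1 + b) ^ n \<le> Q" 
      unfolding Q_def using b \<eta> \<epsilon> by (simp add: mult_le_cancel_left1 not_less)
    have y: "1 \<le> \<bar>Im z\<bar>" using N[OF n] z by simp
    show "norm (wcbinom b n z) \<le> K * (real n + 1) * Q"
    proof (cases "Re z < 0 \<or> Re z \<ge> real n")
      case True
      have "norm (wcbinom b n z) \<le> K * (q * (1 + b)) ^ n"
      proof (rule outside)
        have "1 / 2 \<le> norm z" "1 / 2 \<le> norm (of_nat n - z)"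
          using y abs_Im_le_cmod[of z] abs_Im_le_cmod[of "of_nat n - z"] by auto
        thus "- 1 / 2 \<le> Re z \<and> Re z \<le> 0 \<and> 1 / 2 \<le> norm z \<or> 
           real n \<le> Re z \<and> Re z \<le> real n + 1 / 2 \<and> 1 / 2 \<le> norm (of_nat n - z)"
          using True z by auto
      qed (use z in auto)
      also have "\<dots> \<le> K * 1 * Q"
        using order.trans[OF q_le pow_le_Q] M by (simp add: K_def)
      also have "\<dots> \<le> K * (real n + 1) * Q"
        using M b by (intro mult_right_mono mult_left_mono) (auto simp: K_def Q_def)
      finally show ?thesis .
    next
      case False
      define k where "k = nat \<lfloor>Re z\<rfloor>"
      have k: "real k \<le> Re z" "Re z < real k + 1" "k < n" using False unfolding k_def by linarith+
      have "norm (wcbinom b n z) \<le> M * (norm (cbinom n z) * b ^ k)"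
        unfolding M_def using k by (intro norm_wcbinom_le b) auto
      also have "norm (cbinom n z) * b ^ k \<le> 4 * (real n + 1) * Q"
      \<comment> \<open>Near the ends the small binomial term pays for the crude factor exp(pi y);
        elsewhere both truncated products have length at least \<delta> n.\<close>
      proof (cases "real k \<le> \<delta> * real n \<or> real (n - k) \<le> 2 * \<delta> * real n")
        case True
        have "norm (cbinom n z) * b ^ k \<le> real n * real (n choose k) * exp (pi * \<bar>Im z\<bar>) * b ^ k"
          using k y b by (intro mult_right_mono norm_cbinom_le_any) auto
        also have "\<dots> = real n * (real (n choose k) * b ^ k * exp (pi * \<bar>Im z\<bar>))"
          by (simp add: mult_ac)
        also have "\<dots> \<le> real n * Q"
          using k True z by (intro mult_left_mono order.trans[OF edge' order.trans[OF q_le pow_le_Q]]) auto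
        also have "\<dots> \<le> 4 * (real n + 1) * Q"
          using b by (intro mult_right_mono) (auto simp: Q_def)
        finally show ?thesis .
      next
        case False
        have \<delta>n: "1 \<le> \<delta> * real n" using N[OF n] by simp
        have k': "1 \<le> k" "k + 1 < n" using False k \<delta>n by linarith+
        have l: "\<delta> * real n \<le> real (n - k - 1)" using False \<delta>n k' by linarith
        have "norm (cbinom n z) \<le> 4 * real n * real (n choose k) * 
                exp ((Im z)\<^sup>2 * (1 / real k + 1 / real (n - k - 1)) / 2)"
          using k k' y by (intro norm_cbinom_le_interior) auto
        also have "(Im z)\<^sup>2 * (1 / real k + 1 / real (n - k - 1)) / 2 \<le> 
             (Im z)\<^sup>2 * (1 / (\<delta> * real n) + 1 / (\<delta> * real n)) / 2"
          using False \<delta>n l k' by (intro divide_right_mono mult_left_mono add_mono divide_left_mono) auto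
        also have "(Im z)\<^sup>2 = (\<epsilon> * real n)\<^sup>2" using z(3) by (metis power2_abs)
        also have "(\<epsilon> * real n)\<^sup>2 * (1 / (\<delta> * real n) + 1 / (\<delta> * real n)) / 2 = 
             (\<epsilon> / \<delta>) * (\<epsilon> * real n)"
          using \<delta>n \<delta> by (simp add: field_simps power2_eq_square)
        also have "\<dots> \<le> \<eta> * (\<epsilon> * real n)"
          using \<epsilon> \<delta> by (intro mult_right_mono) (auto simp: field_simps)
        finally have "norm (cbinom n z) * b ^ k \<le> 
            4 * real n * real (n choose k) * exp (\<eta> * (\<epsilon> * real n)) * b ^ k"
          using b by (simp add: mult_left_mono mult_right_mono)
        also have "\<dots> = 4 * real n * ((real (n choose k) * b ^ k) * exp (\<eta> * (\<epsilon> * real n)))"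
          by (simp add: mult_ac)
        also have "\<dots> \<le> 4 * real n * Q"
          using binomial_power_le_tilted[OF b b, of k n] b k 
          unfolding Q_def by (intro mult_left_mono mult_right_mono) auto
        also have "\<dots> \<le> 4 * (real n + 1) * Q"
          using b by (intro mult_right_mono) (auto simp: Q_def)
        finally show ?thesis .
      qed
      finally show ?thesis using M by (simp add: K_def mult_ac)
    qed
  next
    fix n z
    assume n: "N \<le> n" and z: "Re z = - 1 / 2 \<or> Re z = real n + 1 / 2" "\<bar>Im z\<bar> \<le> \<epsilon> * real n"
    show "norm (wcbinom b n z) \<le> K * (q * (1 + b)) ^ n"
    proof (rule outside)
      show "- 1 / 2 \<le> Re z \<and> Re z \<le> 0 \<and> 1 / 2 \<le> norm z \<or> 
         real n \<le> Re z \<and> Re z \<le> real n + 1 / 2 \<and> 1 / 2 \<le> norm (of_nat n - z)"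
        using z abs_Re_le_cmod[of z] abs_Re_le_cmod[of "of_nat n - z"] by auto
    qed fact
  qed (use \<epsilon> q M N in \<open>auto simp: K_def\<close>)
qed

text \<open>Both cotangents are close to the same constant, -i above the real axis and i below,
  which cancels in the difference. The factor exp(pi / 2) pays for |Im t| <= 1/4.\<close>

lemma norm_cot_diff_le:
  assumes z: "1 \<le> \<bar>Im z\<bar>" and t: "norm t \<le> 1 / 4"
  shows "norm (cot (of_real pi * (z - t)) - cot (of_real pi * z)) \<le> 8 * exp (pi / 2) * exp (- (2 * pi * \<bar>Im z\<bar>))"
proof -
  have t': "\<bar>Im t\<bar> \<le> 1 / 4" using t abs_Im_le_cmod[of t] by linarith
  define Y where "Y = \<bar>Im z\<bar>"
  define \<sigma> where "\<sigma> = (if Im z > 0 then \<i> else - \<i>)"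
  have *: "norm (cot (of_real pi * w) + \<sigma>) \<le> 4 * (exp (pi / 2) * exp (- (2 * pi * Y)))"
    if w: "\<bar>Im w - Im z\<bar> \<le> 1 / 4" for w
  proof -
    have "norm (cot (of_real pi * w) + \<sigma>) \<le> 4 * exp (- (2 * pi * \<bar>Im w\<bar>))"
    proof (cases "Im z > 0")
      case True
      hence "1 / 2 \<le> Im w" using w z by linarith
      thus ?thesis using norm_cot_plus_i_le[of w] True by (simp add: \<sigma>_def)
    next
      case False
      hence "Im w \<le> - 1 / 2" using w z by linarith
      thus ?thesis using norm_cot_minus_i_le[of w] False by (simp add: \<sigma>_def)
    qed
    also have "Y - 1 / 4 \<le> \<bar>Im w\<bar>"
      using w unfolding Y_def by linarith
    hence "2 * pi * (Y - 1 / 4) \<le> 2 * pi * \<bar>Im w\<bar>"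
      by (intro mult_left_mono) auto
    hence "4 * exp (- (2 * pi * \<bar>Im w\<bar>)) \<le> 4 * exp (pi / 2 - 2 * pi * Y)"
      by (simp add: algebra_simps)
    also have "exp (pi / 2 - 2 * pi * Y) = exp (pi / 2) * exp (- (2 * pi * Y))"
      by (simp add: exp_add[symmetric])
    finally show ?thesis .
  qed
  have "norm ((cot (of_real pi * (z - t)) + \<sigma>) - (cot (of_real pi * z) + \<sigma>)) \<le>
     4 * (exp (pi / 2) * exp (- (2 * pi * Y))) + 4 * (exp (pi / 2) * exp (- (2 * pi * Y)))"
    by (intro norm_triangle_le_diff add_mono *) (use t' in auto)
  thus ?thesis by (simp add: Y_def)
qed

lemma norm_cot_diff_le_sides:
  assumes z: "Re z = real_of_int m + 1 / 2" and t: "norm t \<le> 1 / 4"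
  shows "norm (cot (of_real pi * (z - t)) - cot (of_real pi * z)) \<le> 2"
proof -
  have t': "\<bar>Re t\<bar> \<le> 1 / 4" using t abs_Re_le_cmod[of t] by linarith
  have "norm (cot (of_real pi * (z - t)) - cot (of_real pi * z)) \<le> 1 + 1"
    by (intro norm_triangle_le_diff add_mono norm_cot_le_one[of _ m]) (use z t' in auto)
  thus ?thesis by simp
qed

text \<open>Both sums are integrals over the same rectangle, so only the difference of the kernels
  matters. The pi of the kernel against the 2 pi i of the residue theorem leaves half the perimeter,
  n + 1 + 2 Y.\<close>

lemma norm_diff_shifted_sums_le:
  fixes F :: "complex \<Rightarrow> complex" and n :: nat
  assumes F: "F holomorphic_on UNIV" and t: "norm t \<le> 1 / 4" and Y: "1 \<le> Y"
    and top: "\<And>z. - 1 / 2 \<le> Re z \<Longrightarrow> Re z \<le> real n + 1 / 2 \<Longrightarrow> \<bar>Im z\<bar> = Y \<Longrightarrow>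
                norm (F z) * (8 * exp (pi / 2) * exp (- (2 * pi * Y))) \<le> B"
    and side: "\<And>z. Re z = - 1 / 2 \<or> Re z = real n + 1 / 2 \<Longrightarrow> \<bar>Im z\<bar> \<le> Y \<Longrightarrow>
                norm (F z) * 2 \<le> B"
  shows "norm ((\<Sum>k\<le>n. F (of_nat k + t)) - (\<Sum>k\<le>n. F (of_nat k))) \<le> B * (real n + 1 + 2 * Y)"
proof -
  define R where "R = rectpath (Complex (- 1 / 2) (- Y)) (Complex (real n + 1 / 2) Y)"
  define D where "D = (\<Sum>k\<le>n. F (of_nat k + t)) - (\<Sum>k\<le>n. F (of_nat k))"
  define f where "f = (\<lambda>t z. F z * (of_real pi * cot (of_real pi * (z - t))))"
  have int: "contour_integral R (f t) = 2 * of_real pi * \<i> * (\<Sum>k\<le>n. F (of_nat k + t))"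
   and cont: "continuous_on (path_image R) (f t)" if "norm t \<le> 1 / 4" for t
    unfolding R_def f_def using contour_integral_rectpath_cot[OF F that, of Y n] Y by auto
  have fint: "f t contour_integrable_on R" if "norm t \<le> 1 / 4" for t
    using cont[OF that] unfolding R_def by (rule contour_integrable_rectpath)
  have "norm (contour_integral R (\<lambda>z. f t z - f 0 z)) \<le> 
         (pi * B) * (2 * (Re (Complex (real n + 1 / 2) Y) - Re (Complex (- 1 / 2) (- Y))) + 
           2 * (Im (Complex (real n + 1 / 2) Y) - Im (Complex (- 1 / 2) (- Y))))"
    unfolding R_def
  proof (rule contour_integral_rectpath_bound)
    show "continuous_on (path_image (rectpath (Complex (- 1 / 2) (- Y)) (Complex (real n + 1 / 2) Y))) 
            (\<lambda>z. f t z - f 0 z)"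
      unfolding R_def[symmetric] by (intro continuous_intros cont t) simp
  next
    fix z assume "z \<in> path_image (rectpath (Complex (- 1 / 2) (- Y)) (Complex (real n + 1 / 2) Y))"
    hence z: "Re z \<in> {-1/2, real n + 1/2} \<and> Im z \<in> {-Y..Y} \<or> Im z \<in> {-Y, Y} \<and> Re z \<in> {-1/2..real n + 1/2}"
      using Y by (auto simp: path_image_rectpath)
    have "f t z - f 0 z = of_real pi * (F z * (cot (of_real pi * (z - t)) - cot (of_real pi * z)))"
      by (simp add: f_def algebra_simps)
    hence "norm (f t z - f 0 z) = pi * (norm (F z) * norm (cot (of_real pi * (z - t)) - cot (of_real pi * z)))"
      by (simp add: norm_mult)
    also have "norm (F z) * norm (cot (of_real pi * (z - t)) - cot (of_real pi * z)) \<le> B"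
      using z
    proof
      assume z': "Re z \<in> {-1/2, real n + 1/2} \<and> Im z \<in> {-Y..Y}"
      hence "Re z = real_of_int (-1) + 1 / 2 \<or> Re z = real_of_int (int n) + 1 / 2" by auto
      hence "norm (cot (of_real pi * (z - t)) - cot (of_real pi * z)) \<le> 2"
        using norm_cot_diff_le_sides[OF _ t] by blast
      hence "norm (F z) * norm (cot (of_real pi * (z - t)) - cot (of_real pi * z)) \<le> norm (F z) * 2"
        by (intro mult_left_mono) auto
      also have "\<dots> \<le> B" using z' by (intro side) auto
      finally show ?thesis .
    next
      assume z': "Im z \<in> {-Y, Y} \<and> Re z \<in> {-1/2..real n + 1/2}"
      hence y: "\<bar>Im z\<bar> = Y" using Y by auto
      have "norm (F z) * norm (cot (of_real pi * (z - t)) - cot (of_real pi * z)) \<le> 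
            norm (F z) * (8 * exp (pi / 2) * exp (- (2 * pi * Y)))"
        using norm_cot_diff_le[of z t] y t Y by (intro mult_left_mono) auto
      also have "\<dots> \<le> B" using z' y by (intro top) auto
      finally show ?thesis .
    qed
    finally show "norm (f t z - f 0 z) \<le> pi * B" by simp
  qed (use Y in auto)
  also have "contour_integral R (\<lambda>z. f t z - f 0 z) = 
      2 * of_real pi * \<i> * D"
    using int[of t] int[of 0] fint[of t] fint[of 0] t
    by (simp add: contour_integral_diff D_def right_diff_distrib)
  finally have "(2 * pi) * norm D \<le> (2 * pi) * (B * (real n + 1 + 2 * Y))"
    by (simp add: norm_mult algebra_simps)
  thus ?thesis unfolding D_def by (subst (asm) mult_le_cancel_left_pos) auto
qed

lemma wcbinom_shift_sum_bound:
  fixes b :: real and s :: nat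
  assumes b: "0 < b" and s: "1 \<le> s"
  obtains K q N where "0 < K" "0 < q" "q < 1"
    "\<And>n t. N \<le> n \<Longrightarrow> norm t \<le> 1 / 4 \<Longrightarrow>
       norm ((\<Sum>k\<le>n. wcbinom b n (of_nat k + t) ^ s) - (\<Sum>k\<le>n. wcbinom b n (of_nat k) ^ s))
         \<le> K * (real n + 1) ^ (s + 1) * (q * (1 + b) ^ s) ^ n"
proof -
  \<comment> \<open>Growth rate 1 / s for the base becomes exp(Y) for the s-th power, which stays
    below the decay exp(-2 pi Y) of the kernel.\<close>
  have "0 < 1 / real s" using s by simp
  then obtain \<epsilon> K q N where \<epsilon>: "0 < \<epsilon>" and K: "0 < K" and q: "0 < q" "q < 1"
    and N: "\<And>n. N \<le> n \<Longrightarrow> 1 \<le> \<epsilon> * real n"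
    and top: "\<And>n z. N \<le> n \<Longrightarrow> - 1 / 2 \<le> Re z \<Longrightarrow> Re z \<le> real n + 1 / 2 \<Longrightarrow> \<bar>Im z\<bar> = \<epsilon> * real n \<Longrightarrow>
       norm (wcbinom b n z) \<le> K * (real n + 1) * ((1 + b) ^ n * exp (1 / real s * (\<epsilon> * real n)))"
    and side: "\<And>n z. N \<le> n \<Longrightarrow> Re z = - 1 / 2 \<or> Re z = real n + 1 / 2 \<Longrightarrow> \<bar>Im z\<bar> \<le> \<epsilon> * real n \<Longrightarrow>
       norm (wcbinom b n z) \<le> K * (q * (1 + b)) ^ n"
    using wcbinom_rectangle_bound[OF b] by metis
  \<comment> \<open>The worse of two rates: \<open>q\<close> from the vertical sides and the net
    rate exp(\<epsilon> - 2 pi \<epsilon>) from the horizontal ones.\<close>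
  define q' where "q' = max q (exp (- (\<epsilon> * (2 * pi - 1))))"
  have q': "0 < q'" "q' < 1" "q \<le> q'" "exp (- (\<epsilon> * (2 * pi - 1))) \<le> q'"
    using q \<epsilon> pi_gt3 by (auto simp: q'_def)
  define K1 where "K1 = 8 * exp (pi / 2) * K ^ s"
  have K1: "0 < K1" using K by (simp add: K1_def)
  have main: "norm ((\<Sum>k\<le>n. wcbinom b n (of_nat k + t) ^ s) - (\<Sum>k\<le>n. wcbinom b n (of_nat k) ^ s))
         \<le> K1 * (1 + 2 * \<epsilon>) * (real n + 1) ^ (s + 1) * (q' * (1 + b) ^ s) ^ n"
    if n: "N \<le> n" and t: "norm t \<le> 1 / 4" for n t
  proof -
    define B where "B = K1 * (real n + 1) ^ s * (q' * (1 + b) ^ s) ^ n"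
    have B: "0 \<le> B" using K1 q' b by (simp add: B_def)
    have "norm ((\<Sum>k\<le>n. wcbinom b n (of_nat k + t) ^ s) - (\<Sum>k\<le>n. wcbinom b n (of_nat k) ^ s))
       \<le> B * (real n + 1 + 2 * (\<epsilon> * real n))"
    proof (rule norm_diff_shifted_sums_le[where F = "\<lambda>z. wcbinom b n z ^ s", OF _ t N[OF n]])
      show "(\<lambda>z. wcbinom b n z ^ s) holomorphic_on UNIV" by (intro holomorphic_intros)
    next
      fix z assume z: "- 1 / 2 \<le> Re z" "Re z \<le> real n + 1 / 2" "\<bar>Im z\<bar> = \<epsilon> * real n"
      have "norm (wcbinom b n z ^ s) \<le> (K * (real n + 1) * ((1 + b) ^ n * exp (1 / real s * (\<epsilon> * real n)))) ^ s"
        unfolding norm_power using top[OF n z] by (intro power_mono) auto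
      also have "\<dots> = K ^ s * (real n + 1) ^ s * ((1 + b) ^ s) ^ n * exp (\<epsilon> * real n)"
        using s by (simp add: power_mult_distrib power_mult[symmetric] mult.commute[of n] exp_of_nat_mult[symmetric])
      finally have "norm (wcbinom b n z ^ s) * (8 * exp (pi / 2) * exp (- (2 * pi * (\<epsilon> * real n)))) \<le> 
         K ^ s * (real n + 1) ^ s * ((1 + b) ^ s) ^ n * exp (\<epsilon> * real n) * 
            (8 * exp (pi / 2) * exp (- (2 * pi * (\<epsilon> * real n))))"
        by (intro mult_right_mono) auto
      also have "\<dots> = K1 * (real n + 1) ^ s * ((1 + b) ^ s) ^ n * (exp (\<epsilon> * real n) * exp (- (2 * pi * (\<epsilon> * real n))))"
        by (simp add: K1_def mult_ac)
      also have "exp (\<epsilon> * real n) * exp (- (2 * pi * (\<epsilon> * real n))) = exp (- (\<epsilon> * (2 * pi - 1)) * real n)"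
        unfolding exp_add[symmetric] by (simp add: algebra_simps)
      also have "\<dots> = exp (- (\<epsilon> * (2 * pi - 1))) ^ n"
        by (rule exp_of_nat2_mult)
      also have "\<dots> \<le> q' ^ n" by (intro power_mono q') auto
      also have "K1 * (real n + 1) ^ s * ((1 + b) ^ s) ^ n * q' ^ n = B"
        by (simp add: B_def power_mult_distrib mult_ac)
      finally show "norm (wcbinom b n z ^ s) * (8 * exp (pi / 2) * exp (- (2 * pi * (\<epsilon> * real n)))) \<le> B"
        using K1 b by (simp add: mult_left_mono)
    next
      fix z assume z: "Re z = - 1 / 2 \<or> Re z = real n + 1 / 2" "\<bar>Im z\<bar> \<le> \<epsilon> * real n"
      have "norm (wcbinom b n z ^ s) * 2 \<le> (K * (q * (1 + b)) ^ n) ^ s * 2"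
        unfolding norm_power using side[OF n z] by (intro mult_right_mono power_mono) auto
      also have "\<dots> = 2 * K ^ s * ((q ^ s) * (1 + b) ^ s) ^ n"
        by (simp add: power_mult_distrib power_mult[symmetric] mult.commute[of n])
      also have "\<dots> \<le> K1 * (q' * (1 + b) ^ s) ^ n"
      proof (intro mult_mono power_mono)
        show "q ^ s \<le> q'" using power_decreasing[OF s, of q] q q' by simp
        have "2 * 1 \<le> 8 * exp (pi / 2)" by (intro mult_mono) auto
        thus "2 * K ^ s \<le> K1" unfolding K1_def using K by (intro mult_right_mono) auto
      qed (use q b K1 q' in auto)
      also have "\<dots> \<le> B"
        unfolding B_def using K1 b q' by (intro mult_right_mono) (auto simp: mult_le_cancel_left1)
      finally show "norm (wcbinom b n z ^ s) * 2 \<le> B" .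
    qed
    \<comment> \<open>The length of the contour is of order n, which turns the exponent s of n + 1
      into s + 1.\<close>
    also have "\<dots> \<le> B * ((1 + 2 * \<epsilon>) * (real n + 1))"
      using \<epsilon> B by (intro mult_left_mono) (auto simp: algebra_simps)
    also have "\<dots> = K1 * (1 + 2 * \<epsilon>) * (real n + 1) ^ (s + 1) * (q' * (1 + b) ^ s) ^ n"
      by (simp add: B_def mult_ac)
    finally show ?thesis .
  qed
  show ?thesis
    by (rule that[of "K1 * (1 + 2 * \<epsilon>)" q' N]) (use main K1 \<epsilon> q' in auto)
qed

subsection \<open>Taylor coefficients of functions with a holomorphic extension\<close>

text \<open>\<open>taylor_coeff\<close> iterates the real \<open>deriv\<close>. A holomorphic
  extension ensures that these derivatives exist and gives access to Cauchy's estimates. The radius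
  1 avoids the possible poles of the deformed sums, the nearest of which are at 1 and -1.\<close>

definition real_restriction :: "(complex \<Rightarrow> complex) \<Rightarrow> (real \<Rightarrow> real) \<Rightarrow> bool" where
  "real_restriction g f \<longleftrightarrow> g holomorphic_on ball 0 1 \<and> (\<forall>t. \<bar>t\<bar> < 1 \<longrightarrow> g (of_real t) = of_real (f t))"

text \<open>The induction runs over all real t with |t| < 1, since the next derivative needs the
  equation in a neighbourhood. Along the real axis the imaginary part is constantly 0, hence so is
  that of the derivative.\<close>

lemma higher_deriv_real_restriction:
  assumes "real_restriction g f" "\<bar>t\<bar> < 1"
  shows "(deriv ^^ r) g (of_real t) = of_real ((deriv ^^ r) f t)"
  using assms(2)
proof (induction r arbitrary: t)
  case 0
  thus ?case using assms by (simp add: real_restriction_def)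
next
  case (Suc r)
  define h where "h = (deriv ^^ r) g"
  have g: "g holomorphic_on ball 0 1" using assms(1) by (simp add: real_restriction_def)
  have "(h has_field_derivative (deriv ^^ Suc r) g (of_real t)) (at (of_real t))"
    unfolding h_def using Suc.prems by (intro has_field_derivative_higher_deriv[OF g]) auto
  hence "((\<lambda>u. h (of_real u)) has_vector_derivative (deriv ^^ Suc r) g (of_real t)) (at t)"
    by (rule has_vector_derivative_real_field)
  moreover have "eventually (\<lambda>u. h (of_real u) = of_real ((deriv ^^ r) f u)) (nhds t)"
  proof -
    have "eventually (\<lambda>u. u \<in> {-1<..<1}) (nhds t)"
      using Suc.prems by (intro eventually_nhds_in_open) auto
    thus ?thesis by eventually_elim (auto simp: h_def Suc.IH)
  qed
  ultimately have d: "((\<lambda>u. complex_of_real ((deriv ^^ r) f u)) has_vector_derivative (deriv ^^ Suc r) g (of_real t)) (at t)"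
    by (subst (asm) has_vector_derivative_cong_ev[where g = "\<lambda>u. complex_of_real ((deriv ^^ r) f u)"])
       (use Suc.prems in \<open>auto simp: h_def Suc.IH elim: eventually_mono\<close>)
  have Re: "((deriv ^^ r) f has_real_derivative Re ((deriv ^^ Suc r) g (of_real t))) (at t)"
    using bounded_linear.has_vector_derivative[OF bounded_linear_Re d]
    by (simp add: has_real_derivative_iff_has_vector_derivative)
  have "((\<lambda>u. 0) has_vector_derivative Im ((deriv ^^ Suc r) g (of_real t))) (at t)"
    using bounded_linear.has_vector_derivative[OF bounded_linear_Im d] by simp
  hence "Im ((deriv ^^ Suc r) g (of_real t)) = 0"
    using has_vector_derivative_const vector_derivative_unique_at by blast
  moreover have "(deriv ^^ Suc r) f t = Re ((deriv ^^ Suc r) g (of_real t))"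
    using DERIV_imp_deriv[OF Re] by simp
  ultimately show ?case by (simp add: complex_eq_iff)
qed

lemma taylor_coeff_real_restriction:
  assumes "real_restriction g f"
  shows "of_real (taylor_coeff f r) = (deriv ^^ r) g 0 / fact r"
  using higher_deriv_real_restriction[OF assms, of 0 r] by (simp add: taylor_coeff_def)

lemma real_restriction_const: "real_restriction (\<lambda>_. of_real c) (\<lambda>_. c)"
  by (simp add: real_restriction_def)

lemma real_restriction_add:
  "real_restriction g f \<Longrightarrow> real_restriction g' f' \<Longrightarrow> real_restriction (\<lambda>t. g t + g' t) (\<lambda>t. f t + f' t)"
  by (auto simp: real_restriction_def intro!: holomorphic_intros)

lemma real_restriction_mult:
  "real_restriction g f \<Longrightarrow> real_restriction g' f' \<Longrightarrow> real_restriction (\<lambda>t. g t * g' t) (\<lambda>t. f t * f' t)"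
  by (auto simp: real_restriction_def intro!: holomorphic_intros)

lemma real_restriction_sum:
  "(\<And>i. i \<in> I \<Longrightarrow> real_restriction (g i) (f i)) \<Longrightarrow>
     real_restriction (\<lambda>t. \<Sum>i\<in>I. g i t) (\<lambda>t. \<Sum>i\<in>I. f i t)"
  by (auto simp: real_restriction_def intro!: holomorphic_intros)

lemma taylor_coeff_add:
  assumes "real_restriction g f" "real_restriction g' f'"
  shows "taylor_coeff (\<lambda>t. f t + f' t) r = taylor_coeff f r + taylor_coeff f' r"
proof -
  have "complex_of_real (taylor_coeff (\<lambda>t. f t + f' t) r) = of_real (taylor_coeff f r) + of_real (taylor_coeff f' r)"
    unfolding taylor_coeff_real_restriction[OF assms(1)] taylor_coeff_real_restriction[OF assms(2)] 
      taylor_coeff_real_restriction[OF real_restriction_add[OF assms]]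
    using assms by (subst higher_deriv_add[of _ "ball 0 1"]) (auto simp: real_restriction_def add_divide_distrib)
  thus ?thesis by (metis of_real_add of_real_eq_iff)
qed

lemma taylor_coeff_cmult:
  assumes "real_restriction g f"
  shows "taylor_coeff (\<lambda>t. c * f t) r = c * taylor_coeff f r"
proof -
  have "complex_of_real (taylor_coeff (\<lambda>t. c * f t) r) = of_real c * of_real (taylor_coeff f r)"
    unfolding taylor_coeff_real_restriction[OF assms] 
      taylor_coeff_real_restriction[OF real_restriction_mult[OF real_restriction_const assms]]
    using assms by (subst higher_deriv_cmult[of _ "ball 0 1"]) (auto simp: real_restriction_def)
  thus ?thesis by (metis of_real_mult of_real_eq_iff)
qed

lemma taylor_coeff_zero: "taylor_coeff (\<lambda>t. 0) r = 0"
proof -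
  have "real_restriction (\<lambda>t. 0) (\<lambda>t. 0)" by (simp add: real_restriction_def)
  from taylor_coeff_cmult[OF this, of 0 r] show ?thesis by simp
qed

lemma taylor_coeff_sum:
  assumes "finite I" "\<And>i. i \<in> I \<Longrightarrow> real_restriction (g i) (f i)"
  shows "taylor_coeff (\<lambda>t. \<Sum>i\<in>I. f i t) r = (\<Sum>i\<in>I. taylor_coeff (f i) r)"
  using assms
proof (induction I rule: finite_induct)
  case empty
  thus ?case by (simp add: taylor_coeff_zero)
next
  case (insert i I)
  thus ?case using taylor_coeff_add[OF insert.prems[of i] real_restriction_sum[of I g f]] by simp
qed

text \<open>The bound on f concerns real t only. If the r-th derivative were the first non-zero one,
  then g = w^r h with h(0) non-zero, whereas |h(t)| <= C |t|^(s - r) tends to 0 along the real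
  axis.\<close>

lemma taylor_coeff_eq_0:
  assumes gf: "real_restriction g f" and "r < s" and f: "f \<in> O[at 0](\<lambda>t. t ^ s)"
  shows "taylor_coeff f r = 0"
proof -
  have g: "g holomorphic_on ball 0 1" and gf': "\<And>t. \<bar>t\<bar> < 1 \<Longrightarrow> g (of_real t) = of_real (f t)"
    using gf by (auto simp: real_restriction_def)
  obtain C where C: "eventually (\<lambda>t. \<bar>f t\<bar> \<le> C * \<bar>t\<bar> ^ s) (at 0)"
    using f by (auto elim!: landau_o.bigE simp: power_abs)
  have ev1: "eventually (\<lambda>t::real. \<bar>t\<bar> < 1) (at 0)"
    using eventually_at_ball[of 1 "0::real" UNIV] by (auto simp: dist_norm)
  \<comment> \<open>The bound is known on a punctured real neighbourhood; continuity yields the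
    value at 0. This serves both for \<open>g\<close> and for its cofactor.\<close>
  have lim0: "h 0 = 0"
    if h: "isCont h 0" and d: "0 < d" and ev: "eventually (\<lambda>t::real. norm (h (of_real t)) \<le> C * \<bar>t\<bar> ^ d) (at 0)" 
    for h :: "complex \<Rightarrow> complex" and d
  proof -
    have "((\<lambda>t::real. C * \<bar>t\<bar> ^ d) \<longlongrightarrow> C * \<bar>0\<bar> ^ d) (at 0)" by (intro tendsto_intros)
    hence "((\<lambda>t::real. C * \<bar>t\<bar> ^ d) \<longlongrightarrow> 0) (at 0)" using d by (simp add: zero_power)
    hence "((\<lambda>t::real. h (of_real t)) \<longlongrightarrow> 0) (at 0)"
      by (rule Lim_null_comparison[OF ev])
    moreover have "isCont (\<lambda>t::real. h (of_real t)) 0"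
      using h by (intro isCont_o2[of 0 of_real h]) auto
    hence "((\<lambda>t::real. h (of_real t)) \<longlongrightarrow> h (of_real 0)) (at 0)"
      by (simp add: isCont_def)
    ultimately show ?thesis using tendsto_unique[OF trivial_limit_at] by fastforce
  qed
  have "(deriv ^^ r) g 0 = 0"
    using \<open>r < s\<close>
  proof (induction r rule: less_induct)
    case (less r)
    have g0: "g 0 = 0"
    proof (rule lim0)
      show "isCont g 0" using holomorphic_on_imp_continuous_on[OF g] 
        by (simp add: continuous_on_eq_continuous_at)
      show "eventually (\<lambda>t::real. norm (g (of_real t)) \<le> C * \<bar>t\<bar> ^ s) (at 0)"
        using C ev1 by eventually_elim (simp add: gf')
    qed (use less.prems in auto)
    show ?case
    proof (cases "r = 0")
      case True
      thus ?thesis using g0 by simp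
    next
      case False
      show ?thesis
      proof (rule ccontr)
        assume "(deriv ^^ r) g 0 \<noteq> 0"
        moreover have "(deriv ^^ i) g 0 = 0" if "0 < i" "i < r" for i
          using less.IH[of i] that less.prems by simp
        ultimately obtain h e where e: "0 < e" and h: "h holomorphic_on ball 0 e"
          and gh: "\<And>w. w \<in> ball 0 e \<Longrightarrow> g w - g 0 = (w - 0) ^ r * h w"
          and hnz: "\<And>w. w \<in> ball 0 e \<Longrightarrow> h w \<noteq> 0"
          using holomorphic_factor_order_of_zero[OF g open_ball, of 0 r] False
          by (metis centre_in_ball gr0I zero_less_one)
        have "h 0 = 0"
        proof (rule lim0)
          show "isCont h 0" using holomorphic_on_imp_continuous_on[OF h] e
            by (simp add: continuous_on_eq_continuous_at)
          have "eventually (\<lambda>t::real. t \<in> ball 0 e \<and> t \<noteq> 0) (at 0)"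
            by (rule eventually_mono[OF eventually_at_ball'[OF e, of 0 UNIV]]) auto
          thus "eventually (\<lambda>t::real. norm (h (of_real t)) \<le> C * \<bar>t\<bar> ^ (s - r)) (at 0)"
            using C ev1
          proof eventually_elim
            case (elim t)
            have "of_real (f t) = of_real t ^ r * h (of_real t)"
              using elim gh[of "of_real t"] g0 gf'[of t] by simp
            hence "\<bar>f t\<bar> = \<bar>t\<bar> ^ r * norm (h (of_real t))"
              by (metis norm_mult norm_of_real norm_power)
            moreover have "\<bar>f t\<bar> \<le> \<bar>t\<bar> ^ r * (C * \<bar>t\<bar> ^ (s - r))"
              using elim less.prems by (simp add: mult.left_commute flip: power_add)
            ultimately have "\<bar>t\<bar> ^ r * norm (h (of_real t)) \<le> \<bar>t\<bar> ^ r * (C * \<bar>t\<bar> ^ (s - r))"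
              by simp
            thus ?case using elim by (simp add: mult_le_cancel_left)
          qed
        qed (use less.prems in auto)
        thus False using hnz e by simp
      qed
    qed
  qed
  hence "complex_of_real (taylor_coeff f r) = 0"
    by (simp add: taylor_coeff_real_restriction[OF gf])
  thus ?thesis by simp
qed

section \<open>The deformed sum on the complex unit disc\<close>

definition cdeformed_term :: "nat \<Rightarrow> nat \<Rightarrow> complex \<Rightarrow> complex" where
  "cdeformed_term n k t = fact n / (pochhammer (1 + t) k * pochhammer (1 - t) (n - k))"

lemma pochhammer_nonzero_unit_disc:
  assumes "norm (t :: complex) < 1"
  shows "pochhammer (1 + t) k \<noteq> 0"
proof
  assume "pochhammer (1 + t) k = 0"
  then obtain j where "1 + t = - of_nat j" by (auto simp: pochhammer_eq_0_iff)
  hence "t = - of_nat j - 1" by (metis add_diff_cancel_left')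
  hence "t = - of_nat (Suc j)" by simp
  hence "norm t = real (Suc j)" by (simp only: norm_minus_cancel norm_of_nat)
  thus False using assms by simp
qed

lemma holomorphic_pochhammer [holomorphic_intros]:
  "f holomorphic_on A \<Longrightarrow> (\<lambda>t. pochhammer (f t) k) holomorphic_on A"
  by (induction k) (auto simp: pochhammer_Suc intro!: holomorphic_intros)

lemma holomorphic_cdeformed_term: "cdeformed_term n k holomorphic_on ball 0 1"
  unfolding cdeformed_term_def
  using pochhammer_nonzero_unit_disc pochhammer_nonzero_unit_disc[of "- _"]
  by (intro holomorphic_intros) auto

definition cdeformed_sum :: "nat \<Rightarrow> real \<Rightarrow> nat \<Rightarrow> complex \<Rightarrow> complex" where
  "cdeformed_sum s a n t = (\<Sum>k=0..n. cdeformed_term n k t ^ s * of_real (a ^ k))"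

lemma cdeformed_term_of_real: 
  "cdeformed_term n k (of_real t) = of_real (fact n / (pochhammer (1 + t) k * pochhammer (1 - t) (n - k)))"
proof -
  have "pochhammer (1 + complex_of_real t) k = of_real (pochhammer (1 + t) k)" for t k
    by (simp add: pochhammer_of_real[symmetric])
  from this[of t] this[of "- t"] show ?thesis
    by (simp add: cdeformed_term_def)
qed

lemma real_restriction_deformed_sum: "real_restriction (cdeformed_sum s a n) (deformed_sum s a n)"
  unfolding real_restriction_def cdeformed_sum_def deformed_sum_def
  by (auto intro!: holomorphic_intros holomorphic_cdeformed_term simp: cdeformed_term_of_real)

subsection \<open>Polynomial identities and the shifted summand\<close>

text \<open>As a predicate on functions, polynomiality of large expressions follows from closure
  rules, without computing any coefficients.\<close>

definition bipoly :: "(real \<Rightarrow> real \<Rightarrow> real) \<Rightarrow> bool" where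
  "bipoly f \<longleftrightarrow> (\<exists>P. \<forall>x y. f x y = eval2 P x y)"

lemma bipoly_eval2: "bipoly (\<lambda>x y. eval2 P x y)"
  unfolding bipoly_def by blast

lemma bipoly_poly: "bipoly (\<lambda>x y. poly q x)"
  unfolding bipoly_def eval2_def by (intro exI[of _ "[:q:]"]) simp

lemma bipoly_const: "bipoly (\<lambda>x y. c)"
  using bipoly_poly[of "[:c:]"] by simp

lemma bipoly_fst: "bipoly (\<lambda>x y. x)"
  using bipoly_poly[of "[:0, 1:]"] by simp

lemma bipoly_snd: "bipoly (\<lambda>x y. y)"
  unfolding bipoly_def eval2_def by (intro exI[of _ "[:0, 1:]"]) simp

lemma bipoly_add: "bipoly f \<Longrightarrow> bipoly g \<Longrightarrow> bipoly (\<lambda>x y. f x y + g x y)"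
  unfolding bipoly_def eval2_def by (metis poly_add)

lemma bipoly_diff: "bipoly f \<Longrightarrow> bipoly g \<Longrightarrow> bipoly (\<lambda>x y. f x y - g x y)"
  unfolding bipoly_def eval2_def by (metis poly_diff)

lemma bipoly_mult: "bipoly f \<Longrightarrow> bipoly g \<Longrightarrow> bipoly (\<lambda>x y. f x y * g x y)"
  unfolding bipoly_def eval2_def by (metis poly_mult)

lemma bipoly_power: "bipoly f \<Longrightarrow> bipoly (\<lambda>x y. f x y ^ k)"
  by (induction k) (auto intro: bipoly_mult bipoly_const)

lemma bipoly_sum: "(\<And>i. i \<in> I \<Longrightarrow> bipoly (f i)) \<Longrightarrow> bipoly (\<lambda>x y. \<Sum>i\<in>I. f i x y)"
  by (induction I rule: infinite_finite_induct) (auto intro: bipoly_add bipoly_const)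

lemma bipoly_prod: "(\<And>i. i \<in> I \<Longrightarrow> bipoly (f i)) \<Longrightarrow> bipoly (\<lambda>x y. \<Prod>i\<in>I. f i x y)"
  by (induction I rule: infinite_finite_induct) (auto intro: bipoly_mult bipoly_const)

lemma bipoly_shift: 
  assumes "bipoly f" shows "bipoly (\<lambda>x y. f x (y + 1))"
proof -
  obtain P where "\<And>x y. f x y = eval2 P x y" using assms by (auto simp: bipoly_def)
  moreover have "poly (pcompose P [:1, 1:]) [:y:] = poly P [:y + 1:]" for y
    by (simp add: poly_pcompose one_pCons add.commute)
  ultimately show ?thesis
    unfolding bipoly_def eval2_def by (intro exI[of _ "pcompose P [:1, 1:]"]) simp
qed

lemmas bipoly_intros = bipoly_eval2 bipoly_poly bipoly_const bipoly_fst bipoly_snd bipoly_add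
  bipoly_diff bipoly_mult bipoly_power bipoly_sum bipoly_prod bipoly_shift

text \<open>The degree bound is independent of \<open>x\<close>, as the count of zeros in
  \<open>bipoly_eq_0\<close> requires.\<close>

lemma eval2_as_poly:
  obtains q where "degree q \<le> degree P" "\<And>y. poly q y = eval2 P x y"
proof
  define q where "q = (\<Sum>i\<le>degree P. monom (poly (coeff P i) x) i)"
  show "degree q \<le> degree P"
    unfolding q_def by (intro degree_sum_le) (auto intro: order.trans[OF degree_monom_le])
  show "poly q y = eval2 P x y" for y
    by (simp add: q_def eval2_def poly_altdef[of P] poly_sum poly_monom)
qed

text \<open>For every large n there are n + 1 zeros in k, more than the degree, so the polynomial in
  y vanishes. Then, for every y, all large integers are zeros of the polynomial in x.\<close>

lemma bipoly_eq_0: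
  assumes "bipoly f" and zero: "\<And>n k :: nat. k \<le> n \<Longrightarrow> f (real n) (real k) = 0"
  shows "f x y = 0"
proof -
  obtain P where P: "\<And>x y. f x y = eval2 P x y" using assms by (auto simp: bipoly_def)
  have *: "f (real n) y = 0" if n: "degree P \<le> n" for n y
  proof -
    obtain q where q: "degree q \<le> degree P" "\<And>y. poly q y = eval2 P (real n) y"
      using eval2_as_poly[where P = P and x = "real n"] by blast
    have "q = 0"
    proof (rule ccontr)
      assume "q \<noteq> 0"
      have "card (real ` {..n}) \<le> card {y. poly q y = 0}"
        using zero by (intro card_mono poly_roots_finite \<open>q \<noteq> 0\<close>) (auto simp: q P[symmetric])
      also have "\<dots> \<le> degree q" by (rule card_poly_roots_bound) fact
      finally show False using q n by (simp add: card_image)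
    qed
    thus ?thesis using q(2)[of y] by (simp add: P)
  qed
  have "poly P [:y:] = 0"
  proof (rule ccontr)
    assume "poly P [:y:] \<noteq> 0"
    hence "finite {x. poly (poly P [:y:]) x = 0}" by (rule poly_roots_finite)
    moreover have "real ` {degree P..} \<subseteq> {x. poly (poly P [:y:]) x = 0}"
      using * by (auto simp: P eval2_def)
    ultimately have "finite (real ` {degree P..})" using finite_subset by blast
    thus False by (simp add: finite_image_iff infinite_Ici)
  qed
  thus ?thesis by (simp add: P eval2_def)
qed

lemma eval2_finite_zeros:
  assumes "eval2 D x y \<noteq> 0"
  shows "finite {y. eval2 D x y = 0}"
proof -
  obtain q where q: "\<And>y. poly q y = eval2 D x y"
    using eval2_as_poly[where P = D and x = x] by blast
  hence "q \<noteq> 0" using assms by force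
  thus ?thesis using poly_roots_finite[of q] by (simp add: q)
qed

text \<open>The ratio \<open>F (n + i) k / F n k\<close> is the \<open>s\<close>-th power of \<open>shift_num L i n k / shift_den L n k\<close>.\<close>

definition shift_den :: "nat \<Rightarrow> real \<Rightarrow> real \<Rightarrow> real" where
  "shift_den L x y = (\<Prod>j=1..L. x + real j - y)"

definition shift_num :: "nat \<Rightarrow> nat \<Rightarrow> real \<Rightarrow> real \<Rightarrow> real" where
  "shift_num L i x y = (\<Prod>j=1..i. x + real j) * (\<Prod>j=Suc i..L. x + real j - y)"

lemma bipoly_shift_den: "bipoly (shift_den L)" and bipoly_shift_num: "bipoly (shift_num L i)"
  unfolding shift_den_def shift_num_def by (intro bipoly_intros)+

lemma shift_den_split:
  "i \<le> L \<Longrightarrow> shift_den L x y = (\<Prod>j=1..i. x + real j - y) * (\<Prod>j=Suc i..L. x + real j - y)"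
  unfolding shift_den_def using prod.ub_add_nat[of 1 i "\<lambda>j. x + real j - y" "L - i"] by simp

lemma binomial_shift:
  assumes "k \<le> n"
  shows "(\<Prod>j=1..i. real n + real j - real k) * real (n + i choose k) = (\<Prod>j=1..i. real n + real j) * real (n choose k)"
proof (induction i)
  case (Suc i)
  have "(n + Suc i - k) * (n + Suc i choose k) = (n + Suc i) * (n + i choose k)"
    using binomial_absorb_comp[of "n + Suc i" k] by simp
  hence eq: "(real n + real (Suc i) - real k) * real (n + Suc i choose k) = (real n + real (Suc i)) * real (n + i choose k)"
    using assms by (metis (no_types, lifting) add_increasing2 of_nat_0_le_iff of_nat_add of_nat_diff of_nat_mult trans_le_add1)
  have "(\<Prod>j=1..Suc i. real n + real j - real k) * real (n + Suc i choose k) = 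
     (\<Prod>j=1..i. real n + real j - real k) * ((real n + real (Suc i) - real k) * real (n + Suc i choose k))"
    by simp
  also have "\<dots> = (real n + real (Suc i)) * ((\<Prod>j=1..i. real n + real j - real k) * real (n + i choose k))"
    unfolding eq by simp
  also have "\<dots> = (\<Prod>j=1..Suc i. real n + real j) * real (n choose k)"
    unfolding Suc.IH by simp
  finally show ?case .
qed simp

lemma summand_shift_n:
  assumes "k \<le> n" "i \<le> L"
  shows "shift_den L (real n) (real k) ^ s * summand s a (n + i) (int k) =
         shift_num L i (real n) (real k) ^ s * summand s a n (int k)"
proof -
  have "shift_den L (real n) (real k) * real (n + i choose k) = shift_num L i (real n) (real k) * real (n choose k)"
    unfolding shift_den_split[OF assms(2)] shift_num_def using binomial_shift[OF assms(1), of i]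
    by (simp add: mult_ac)
  hence "(shift_den L (real n) (real k) * real (n + i choose k)) ^ s = (shift_num L i (real n) (real k) * real (n choose k)) ^ s"
    by simp
  thus ?thesis by (simp add: summand_def power_mult_distrib)
qed

lemma Suc_mult_choose_Suc:
  assumes "k \<le> n"
  shows "real (Suc k) * real (n choose Suc k) = (real n - real k) * real (n choose k)"
proof -
  have "Suc k * (n choose Suc k) = (n - k) * (n choose k)"
    by (metis binomial_absorb_comp binomial_absorption mult.commute add.commute Suc_diff_le assms times_binomial_minus1_eq)
  thus ?thesis using assms by (metis of_nat_diff of_nat_mult)
qed

lemma summand_shift_k:
  assumes "k \<le> n"
  shows "(real k + 1) ^ s * summand s a n (int k + 1) = a * (real n - real k) ^ s * summand s a n (int k)"
proof -
  have "(real (Suc k) * real (n choose Suc k)) ^ s = ((real n - real k) * real (n choose k)) ^ s"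
    by (simp only: Suc_mult_choose_Suc[OF assms])
  moreover have "nat (int k + 1) = Suc k" by simp
  ultimately show ?thesis by (simp add: summand_def power_mult_distrib add.commute)
qed

text \<open>A meromorphic shift of the summand: up to a factor that depends on \<open>t\<close> only, this is
  \<open>F n (m + t)\<close>, now for all integers \<open>m\<close>. The sign of \<open>\<Prod>j\<le>n. j - m\<close> is absorbed in the base
  of the power.\<close>

definition shifted_summand :: "nat \<Rightarrow> real \<Rightarrow> nat \<Rightarrow> int \<Rightarrow> real \<Rightarrow> real" where
  "shifted_summand s a n m t =
     (- t * fact n / (\<Prod>j\<le>n. real j - (of_int m + t))) ^ s * ((- 1) ^ s * a) powi m"

lemma shifted_summand_shift_n:
  assumes "i \<le> L" and nz: "\<And>j. of_int m + t \<noteq> real j"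
  defines "y \<equiv> of_int m + t"
  shows "shift_den L (real n) y ^ s * shifted_summand s a (n + i) m t =
         shift_num L i (real n) y ^ s * shifted_summand s a n m t"
proof -
  have "fact (n + i) / (\<Prod>j\<le>n+i. real j - y) * (\<Prod>j=1..i. real n + real j - y) = 
          fact n / (\<Prod>j\<le>n. real j - y) * (\<Prod>j=1..i. real n + real j)"
  proof (induction i)
    case (Suc i)
    define X where "X = real n + real (Suc i) - y"
    have X: "X \<noteq> 0" using nz[of "n + Suc i"] by (simp add: X_def y_def)
    have eqs: "(fact (n + Suc i) :: real) = (real n + real (Suc i)) * fact (n + i)"
      "(\<Prod>j\<le>n+Suc i. real j - y) = (\<Prod>j\<le>n+i. real j - y) * X"
      "(\<Prod>j=1..Suc i. real n + real j - y) = (\<Prod>j=1..i. real n + real j - y) * X"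
      by (simp_all add: X_def)
    have "fact (n + Suc i) / (\<Prod>j\<le>n+Suc i. real j - y) * (\<Prod>j=1..Suc i. real n + real j - y) = 
       (real n + real (Suc i)) * (fact (n + i) / (\<Prod>j\<le>n+i. real j - y) * (\<Prod>j=1..i. real n + real j - y))"
      unfolding eqs using X by simp
    thus ?case unfolding Suc.IH by simp
  qed simp
  from arg_cong[OF this, of "\<lambda>u. - t * (\<Prod>j=Suc i..L. real n + real j - y) * u"]
  have "shift_den L (real n) y * (- t * fact (n + i) / (\<Prod>j\<le>n+i. real j - y)) = 
        shift_num L i (real n) y * (- t * fact n / (\<Prod>j\<le>n. real j - y))"
    unfolding shift_den_split[OF assms(1)] shift_num_def by (simp add: mult_ac)
  hence "(shift_den L (real n) y * (- t * fact (n + i) / (\<Prod>j\<le>n+i. real j - y))) ^ s = 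
        (shift_num L i (real n) y * (- t * fact n / (\<Prod>j\<le>n. real j - y))) ^ s"
    by (rule arg_cong)
  thus ?thesis
    unfolding shifted_summand_def y_def by (simp only: power_mult_distrib) simp
qed

text \<open>Passing from y to y + 1 moves the window of the product by one: the factor n - y is
  replaced by -(y + 1). The resulting sign (-1)^s is compensated by the base
  \<open>(- 1) ^ s * a\<close>.\<close>

lemma shifted_summand_shift_k:
  assumes "a \<noteq> 0" and nz: "\<And>j. of_int m + t \<noteq> of_int j"
  defines "y \<equiv> of_int m + t"
  shows "(y + 1) ^ s * shifted_summand s a n (m + 1) t = a * (real n - y) ^ s * shifted_summand s a n m t"
proof -
  have nz': "real j - y \<noteq> 0" for j using nz[of "int j"] by (simp add: y_def)
  have nz'': "real j - (y + 1) \<noteq> 0" for j using nz[of "int j - 1"] by (simp add: y_def)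
  have "(y + 1) * (\<Prod>j\<le>n. real j - y) = - (real n - y) * (\<Prod>j\<le>n. real j - (y + 1))"
  proof -
    have "(\<Prod>j\<le>n. real j - (y + 1)) = (- (y + 1)) * (\<Prod>j<n. real j - y)"
      by (simp add: lessThan_Suc_atMost[symmetric] prod.lessThan_Suc_shift del: prod.lessThan_Suc)
    moreover have "(\<Prod>j\<le>n. real j - y) = (real n - y) * (\<Prod>j<n. real j - y)"
      by (simp add: lessThan_Suc_atMost[symmetric])
    ultimately show ?thesis by algebra
  qed
  note prod_eq = this
  have "(y + 1) * (- t * fact n / (\<Prod>j\<le>n. real j - (y + 1))) = - (real n - y) * (- t * fact n / (\<Prod>j\<le>n. real j - y))"
  proof -
    define P1 P2 where "P1 = (\<Prod>j\<le>n. real j - y)" and "P2 = (\<Prod>j\<le>n. real j - (y + 1))"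
    have "P1 \<noteq> 0" "P2 \<noteq> 0" using nz' nz'' by (simp_all add: P1_def P2_def)
    moreover note prod_eq
    ultimately have "(y + 1) / P2 = - (real n - y) / P1"
      unfolding P1_def[symmetric] P2_def[symmetric] by (subst frac_eq_eq) auto
    hence "(- t * fact n) * ((y + 1) / P2) = (- t * fact n) * (- (real n - y) / P1)" by (rule arg_cong)
    thus ?thesis by (simp only: P1_def P2_def times_divide_eq_right mult.commute)
  qed
  hence "((y + 1) * (- t * fact n / (\<Prod>j\<le>n. real j - (y + 1)))) ^ s = (- (real n - y) * (- t * fact n / (\<Prod>j\<le>n. real j - y))) ^ s"
    by (rule arg_cong)
  hence h1: "(y + 1) ^ s * (- t * fact n / (\<Prod>j\<le>n. real j - (y + 1))) ^ s =
        (- 1) ^ s * (real n - y) ^ s * (- t * fact n / (\<Prod>j\<le>n. real j - y)) ^ s"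
    by (simp only: power_mult_distrib[symmetric]) simp
  have h2: "((- 1) ^ s * a) powi (m + 1) = ((- 1) ^ s * a) * ((- 1) ^ s * a) powi m"
    using assms by (subst power_int_add_1') auto
  have h3: "(- 1) ^ s * (- 1) ^ s = (1 :: real)" by (simp flip: power_mult_distrib)
  have alg: "Y * (A1 * p) = a * N * (A2 * q)"
    if "Y * A1 = \<sigma> * N * A2" "p = (\<sigma> * a) * q" "\<sigma> * \<sigma> = 1" for Y A1 p N A2 q \<sigma> :: real
  proof -
    have "Y * (A1 * p) = (Y * A1) * p" by simp
    also have "\<dots> = (\<sigma> * \<sigma>) * (a * N * (A2 * q))" unfolding that(1,2) by (simp only: mult_ac)
    finally show ?thesis using that(3) by simp
  qed
  have y1: "of_int (m + 1) + t = y + 1" by (simp add: y_def)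
  show ?thesis
    unfolding shifted_summand_def y1 unfolding y_def[symmetric] by (rule alg[OF h1 h2 h3])
qed

subsection \<open>The recurrence for the Taylor coefficients of the deformed sum\<close>

text \<open>The factor j = k of the product is -t and cancels the -t in the numerator. The factors
  with j < k and j > k form the two Pochhammer symbols, and the sign (-1)^(k s) from the former
  cancels against the base.\<close>

lemma shifted_summand_eq_deformed_term:
  assumes "k \<le> n" "t \<noteq> 0" "\<bar>t\<bar> < 1"
  shows "shifted_summand s a n (int k) t =
         (fact n / (pochhammer (1 + t) k * pochhammer (1 - t) (n - k))) ^ s * a ^ k"
proof -
  have "(\<Prod>j<k. real j - (real k + t)) = (- 1) ^ k * pochhammer (1 + t) k"
  proof -
    have "(\<Prod>j<k. real j - (real k + t)) = (\<Prod>i<k. - (1 + t + real i))"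
      by (intro prod.reindex_bij_witness[of _ "\<lambda>j. k - Suc j" "\<lambda>j. k - Suc j"]) 
         (auto simp: of_nat_diff algebra_simps)
    also have "\<dots> = (\<Prod>i<k. (- 1) * (1 + t + real i))" by simp
    also have "\<dots> = (- 1) ^ k * (\<Prod>i<k. 1 + t + real i)" by (subst prod.distrib) simp
    finally show ?thesis by (simp add: pochhammer_prod atLeast0LessThan)
  qed
  moreover have "(\<Prod>j=Suc k..n. real j - (real k + t)) = pochhammer (1 - t) (n - k)"
    unfolding pochhammer_prod using assms
    by (intro prod.reindex_bij_witness[of _ "\<lambda>i. i + Suc k" "\<lambda>j. j - Suc k"]) (auto simp: of_nat_diff)
  moreover have "(\<Prod>j\<le>n. real j - (real k + t)) = 
      (\<Prod>j<k. real j - (real k + t)) * (- t * (\<Prod>j=Suc k..n. real j - (real k + t)))"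
  proof -
    have "(\<Prod>j\<le>n. real j - (real k + t)) = (\<Prod>j\<le>k. real j - (real k + t)) * (\<Prod>j=Suc k..n. real j - (real k + t))"
      using assms prod.ub_add_nat[of 0 k "\<lambda>j. real j - (real k + t)" "n - k"]
      by (simp add: atMost_atLeast0)
    thus ?thesis by (simp add: lessThan_Suc_atMost[symmetric])
  qed
  ultimately have "(\<Prod>j\<le>n. real j - (real k + t)) = 
      (- 1) ^ k * (- t) * (pochhammer (1 + t) k * pochhammer (1 - t) (n - k))"
    by simp
  hence "- t * fact n / (\<Prod>j\<le>n. real j - (real k + t)) = 
      (- 1) ^ k * (fact n / (pochhammer (1 + t) k * pochhammer (1 - t) (n - k)))"
    using assms by (cases "even k") auto
  moreover have "((- 1) ^ k * X) ^ s * ((- 1) ^ s * a) ^ k = X ^ s * a ^ k" for X :: real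
  proof -
    have "((- 1) ^ k * X) ^ s * ((- 1) ^ s * a) ^ k = ((- 1) ^ (k * s) * X ^ s) * ((- 1) ^ (s * k) * a ^ k)"
      by (simp only: power_mult_distrib power_mult)
    also have "\<dots> = ((- 1) ^ (k * s) * (- 1) ^ (s * k)) * (X ^ s * a ^ k)"
      by (simp only: mult_ac)
    also have "(- 1) ^ (k * s) * (- 1) ^ (s * k) = (1 :: real)"
      by (simp add: mult.commute[of s k] flip: power_mult_distrib)
    finally show ?thesis by simp
  qed
  ultimately show ?thesis
    by (simp only: shifted_summand_def of_int_of_nat_eq power_int_of_nat)
qed

text \<open>Outside 0, ..., n no factor of the product vanishes at t = 0, so the -t in the numerator
  survives to the power s. This is where the restriction r < s originates.\<close>

lemma shifted_summand_bigo:
  assumes "m < 0 \<or> int n < m"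
  shows "shifted_summand s a n m \<in> O[at 0](\<lambda>t. t ^ s)"
proof -
  define c where "c = (\<lambda>t. (- fact n / (\<Prod>j\<le>n. real j - (of_int m + t))) ^ s * ((- 1) ^ s * a) powi m)"
  have "shifted_summand s a n m = (\<lambda>t. t ^ s * c t)"
    by (simp add: fun_eq_iff shifted_summand_def c_def power_mult_distrib[symmetric])
  moreover have "(\<Prod>j\<le>n. real j - (of_int m + 0)) \<noteq> 0"
  proof -
    have "real j \<noteq> of_int m" if "j \<le> n" for j
    proof
      assume "real j = of_int m"
      hence "m = int j" by (metis of_int_eq_iff of_int_of_nat_eq)
      thus False using assms that by auto
    qed
    thus ?thesis by simp
  qed
  hence "isCont c 0" unfolding c_def by (intro continuous_intros) auto
  hence "(c \<longlongrightarrow> c 0) (at 0)" by (simp add: isCont_def)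
  hence "c \<in> O[at 0](\<lambda>_. 1)" by (intro bigoI_tendsto[of _ _ "c 0"]) auto
  hence "(\<lambda>t. t ^ s * c t) \<in> O[at 0](\<lambda>t. t ^ s * 1)" by (intro landau_o.big.mult) auto
  ultimately show ?thesis by simp
qed

text \<open>The telescoping equation holds at all lattice points \<open>0 \<le> k \<le> n\<close>, which are Zariski dense in
  the plane; hence it is an identity of rational functions and can be evaluated at \<open>k = m + t\<close>.\<close>

lemma certificate_identity:
  fixes a :: real
  assumes a: "a > 0"
    and G: "\<And>n k. eval2 D (real n) (of_int k) \<noteq> 0 \<Longrightarrow>
           G n k = eval2 N (real n) (of_int k) / eval2 D (real n) (of_int k) * summand s a n k"
    and tele: "\<And>n k. (\<Sum>i\<le>L. poly (p i) (real n) * summand s a (n + i) k) = G n (k + 1) - G n k"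
    and nz: "\<And>j. of_int m + t \<noteq> of_int j"
    and D: "eval2 D (real n) (of_int m + t) \<noteq> 0" "eval2 D (real n) (of_int (m + 1) + t) \<noteq> 0"
  shows "(\<Sum>i\<le>L. poly (p i) (real n) * shifted_summand s a (n + i) m t) =
     eval2 N (real n) (of_int (m + 1) + t) / eval2 D (real n) (of_int (m + 1) + t) * shifted_summand s a n (m + 1) t
     - eval2 N (real n) (of_int m + t) / eval2 D (real n) (of_int m + t) * shifted_summand s a n m t"
proof -
  \<comment> \<open>The telescoping equation divided by F n k and multiplied by D(n, k) D(n, k + 1)
    (k + 1)^s \<open>shift_den\<close>^s.\<close>
  define Q where "Q = (\<lambda>x y. eval2 D x y * eval2 D x (y + 1) * (y + 1) ^ s *
            (\<Sum>i\<le>L. poly (p i) x * shift_num L i x y ^ s)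
       - a * eval2 N x (y + 1) * eval2 D x y * (x - y) ^ s * shift_den L x y ^ s
       + eval2 N x y * eval2 D x (y + 1) * (y + 1) ^ s * shift_den L x y ^ s)"
  \<comment> \<open>At lattice points where D vanishes, G is not tied to N / D and \<open>Q\<close>
    may be non-zero. The additional factors make the equation trivial there, so that it holds on the
    whole lattice triangle.\<close>
  have "eval2 D x y * eval2 D x (y + 1) * Q x y = 0" for x y
  proof (rule bipoly_eq_0[where f = "\<lambda>x y. eval2 D x y * eval2 D x (y + 1) * Q x y"])
    show "bipoly (\<lambda>x y. eval2 D x y * eval2 D x (y + 1) * Q x y)"
      unfolding Q_def by (intro bipoly_intros bipoly_shift_den bipoly_shift_num)
  next
    fix n k :: nat assume kn: "k \<le> n"
    define d d' N0 N1 W where "d = eval2 D (real n) (real k)" and "d' = eval2 D (real n) (real k + 1)"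
      and "N0 = eval2 N (real n) (real k)" and "N1 = eval2 N (real n) (real k + 1)"
      and "W = shift_den L (real n) (real k) ^ s"
    define F where "F = summand s a n (int k)"
    have "Q (real n) (real k) = 0" if "d \<noteq> 0" "d' \<noteq> 0"
    proof -
      have G0: "d * G n (int k) = N0 * F"
        using G[of n "int k"] that by (simp add: d_def N0_def F_def)
      have G1: "d' * G n (int k + 1) = N1 * summand s a n (int k + 1)"
        using G[of n "int k + 1"] that by (simp add: d'_def N1_def)
      have S: "W * (\<Sum>i\<le>L. poly (p i) (real n) * summand s a (n + i) (int k)) = 
           (\<Sum>i\<le>L. poly (p i) (real n) * shift_num L i (real n) (real k) ^ s) * F"
        unfolding sum_distrib_left sum_distrib_right
      proof (rule sum.cong[OF refl])
        fix i assume "i \<in> {..L}"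
        thus "W * (poly (p i) (real n) * summand s a (n + i) (int k)) = 
              poly (p i) (real n) * shift_num L i (real n) (real k) ^ s * F"
          using summand_shift_n[OF kn, of i L s a] by (simp add: W_def F_def)
      qed
      have k1: "(real k + 1) ^ s * summand s a n (int k + 1) = a * (real n - real k) ^ s * F"
        unfolding F_def by (rule summand_shift_k[OF kn])
      have alg: "(d * d' * K * S' - a * N1 * d * M * W + N0 * d' * K * W) * F = 0"
        if "d * g0 = N0 * F" "d' * g1 = N1 * f1" "W * (g1 - g0) = S' * F" "K * f1 = a * M * F"
        for d d' K S' a N1 M W N0 F g0 g1 f1 :: real
      proof -
        have "(d * d' * K * S' - a * N1 * d * M * W + N0 * d' * K * W) * F =
            d * d' * K * (S' * F) - N1 * d * W * (a * M * F) + d' * K * W * (N0 * F)"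
          by (simp add: algebra_simps)
        also have "\<dots> = d * d' * K * (W * (g1 - g0)) - d * W * K * (N1 * f1) + d' * K * W * (d * g0)"
          unfolding that(3)[symmetric] that(4)[symmetric] that(1)[symmetric] by (simp only: mult_ac)
        also have "\<dots> = 0"
          unfolding that(2)[symmetric] by (simp add: algebra_simps)
        finally show ?thesis .
      qed
      have "Q (real n) (real k) * F = 0"
        unfolding Q_def d_def[symmetric] d'_def[symmetric] N0_def[symmetric] N1_def[symmetric] W_def[symmetric]
        by (rule alg[OF G0 G1 _ k1]) (use S in \<open>simp add: tele\<close>)
      moreover have "F \<noteq> 0" using kn a by (simp add: F_def summand_def)
      ultimately show ?thesis by simp
    qed
    thus "eval2 D (real n) (real k) * eval2 D (real n) (real k + 1) * Q (real n) (real k) = 0"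
      by (auto simp: d_def d'_def)
  qed
  define y where "y = of_int m + t"
  have y1: "of_int (m + 1) + t = y + 1" by (simp add: y_def)
  define d d' N0 N1 W where "d = eval2 D (real n) y" and "d' = eval2 D (real n) (y + 1)"
      and "N0 = eval2 N (real n) y" and "N1 = eval2 N (real n) (y + 1)"
      and "W = shift_den L (real n) y ^ s"
  define F F' where "F = shifted_summand s a n m t" and "F' = shifted_summand s a n (m + 1) t"
  have dnz: "d \<noteq> 0" "d' \<noteq> 0" using D unfolding y1 by (simp_all add: d_def d'_def y_def)
  \<comment> \<open>Since y is not an integer, the cleared denominators do not vanish at (n, y) and
    can be divided out again.\<close>
  have Wnz: "W \<noteq> 0" 
  proof -
    have "real n + real j - y \<noteq> 0" for j using nz[of "int (n + j)"] by (simp add: y_def)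
    thus ?thesis by (simp add: W_def shift_den_def)
  qed
  have Ynz: "(y + 1) ^ s \<noteq> 0" using nz[of "-1"] by (simp add: y_def add_eq_0_iff2)
  have Q0: "Q (real n) y = 0"
    using \<open>eval2 D (real n) y * eval2 D (real n) (y + 1) * Q (real n) y = 0\<close> dnz 
    by (simp add: d_def d'_def)
  have S: "W * (\<Sum>i\<le>L. poly (p i) (real n) * shifted_summand s a (n + i) m t) = 
           (\<Sum>i\<le>L. poly (p i) (real n) * shift_num L i (real n) y ^ s) * F"
    unfolding sum_distrib_left sum_distrib_right
  proof (rule sum.cong[OF refl])
    fix i assume "i \<in> {..L}"
    moreover have "of_int m + t \<noteq> real j" for j using nz[of "int j"] by simp
    ultimately show "W * (poly (p i) (real n) * shifted_summand s a (n + i) m t) = 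
          poly (p i) (real n) * shift_num L i (real n) y ^ s * F"
      using shifted_summand_shift_n[of i L m t n s a] by (simp add: W_def F_def y_def)
  qed
  have k1: "(y + 1) ^ s * F' = a * (real n - y) ^ s * F"
    using shifted_summand_shift_k[of a m t s n] a nz by (simp add: F_def F'_def y_def)
  have alg: "d * d' * K * W * S1 = d * K * W * N1 * F' - d' * K * W * N0 * F"
    if "d * d' * K * S' - a * N1 * d * M * W + N0 * d' * K * W = 0" "W * S1 = S' * F" "K * F' = a * M * F"
    for d d' K S' a N1 M W N0 F F' S1 :: real
  proof -
    have "0 = (d * d' * K * S' - a * N1 * d * M * W + N0 * d' * K * W) * F" using that(1) by simp
    also have "\<dots> = d * d' * K * (S' * F) - N1 * d * W * (a * M * F) + d' * K * W * N0 * F"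
      by (simp add: algebra_simps)
    also have "\<dots> = d * d' * K * (W * S1) - N1 * d * W * (K * F') + d' * K * W * N0 * F"
      unfolding that(2) that(3) ..
    finally show ?thesis by (simp add: algebra_simps)
  qed
  have eq: "d * d' * (y + 1) ^ s * W * (\<Sum>i\<le>L. poly (p i) (real n) * shifted_summand s a (n + i) m t) =
     d * (y + 1) ^ s * W * N1 * F' - d' * (y + 1) ^ s * W * N0 * F"
    using Q0 unfolding Q_def d_def[symmetric] d'_def[symmetric] N0_def[symmetric] N1_def[symmetric] W_def[symmetric]
    by (rule alg[OF _ S k1])
  have "(\<Sum>i\<le>L. poly (p i) (real n) * shifted_summand s a (n + i) m t) = N1 / d' * F' - N0 / d * F"
  proof -
    have "(d * d' * (y + 1) ^ s * W) * (N1 / d' * F' - N0 / d * F) =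
        d * (y + 1) ^ s * W * N1 * F' - d' * (y + 1) ^ s * W * N0 * F"
      using dnz by (simp add: right_diff_distrib)
    hence eq': "(d * d' * (y + 1) ^ s * W) * (\<Sum>i\<le>L. poly (p i) (real n) * shifted_summand s a (n + i) m t) =
        (d * d' * (y + 1) ^ s * W) * (N1 / d' * F' - N0 / d * F)"
      using eq by (simp only:)
    have "d * d' * (y + 1) ^ s * W \<noteq> 0" using dnz Wnz Ynz by simp
    from mult_left_cancel[THEN iffD1, OF this eq'] show ?thesis .
  qed
  thus ?thesis unfolding y1 y_def[symmetric] d_def d'_def N0_def N1_def F_def F'_def .
qed

lemma bounded_zeros_eval2:
  assumes "eval2 D x y0 \<noteq> 0"
  obtains M :: nat where "\<And>y. real M \<le> \<bar>y\<bar> \<Longrightarrow> eval2 D x y \<noteq> 0"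
proof -
  have "bounded {y. eval2 D x y = 0}" by (rule finite_imp_bounded[OF eval2_finite_zeros[OF assms]])
  then obtain B where B: "\<And>y. eval2 D x y = 0 \<Longrightarrow> \<bar>y\<bar> \<le> B" by (auto simp: bounded_iff)
  show ?thesis
  proof (rule that[of "nat \<lceil>B\<rceil> + 1"])
    fix y :: real assume "real (nat \<lceil>B\<rceil> + 1) \<le> \<bar>y\<bar>"
    thus "eval2 D x y \<noteq> 0" using B[of y] by linarith
  qed
qed

lemma eval2_continuous: "isCont (\<lambda>y. eval2 D x y) y"
proof -
  obtain q where q: "\<And>y. poly q y = eval2 D x y"
    using eval2_as_poly[where P = D and x = x] by blast
  show ?thesis unfolding q[symmetric] by simp
qed

lemma deformed_sum_recurrence_bigo:
  fixes a :: real and n :: nat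
  assumes a: "a > 0" and zeil: "zeilberger_recurrence (summand s a) L p"
  shows "(\<lambda>t. \<Sum>i\<le>L. poly (p i) (real n) * deformed_sum s a (n + i) t) \<in> O[at 0](\<lambda>t. t ^ s)"
proof -
  obtain G N D where Dnz: "\<And>n. \<exists>x. eval2 D (real n) x \<noteq> 0"
    and G: "\<And>n k. eval2 D (real n) (of_int k) \<noteq> 0 \<Longrightarrow>
           G n k = eval2 N (real n) (of_int k) / eval2 D (real n) (of_int k) * summand s a n k"
    and tele: "\<And>n k. (\<Sum>i\<le>L. poly (p i) (real n) * summand s a (n + i) k) = G n (k + 1) - G n k"
    using zeil unfolding zeilberger_recurrence_def by blast
  obtain x0 where x0: "eval2 D (real n) x0 \<noteq> 0" using Dnz by blast
  obtain M0 where M0: "\<And>y. real M0 \<le> \<bar>y\<bar> \<Longrightarrow> eval2 D (real n) y \<noteq> 0"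
    using bounded_zeros_eval2[OF x0] by metis
  \<comment> \<open>Beyond M0 the denominator D(n, .) has no zeros, so N / D is continuous at the
    two boundary points; beyond n + L these points lie outside every range 0, ..., n + i.\<close>
  define M where "M = M0 + n + L + 1"
  define H where "H = (\<lambda>m t. eval2 N (real n) (of_int m + t) / eval2 D (real n) (of_int m + t) * shifted_summand s a n m t)"
  have H_bigo: "H m \<in> O[at 0](\<lambda>t. t ^ s)" if m: "\<bar>m\<bar> = int M" for m
  proof -
    define c where "c = (\<lambda>t. eval2 N (real n) (of_int m + t) / eval2 D (real n) (of_int m + t))"
    have "real M0 \<le> \<bar>real_of_int m\<bar>" using m unfolding M_def by linarith
    hence "isCont c 0" unfolding c_def using M0[of "of_int m"]
      by (intro continuous_intros isCont_o2[OF _ eval2_continuous]) auto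
    hence "(c \<longlongrightarrow> c 0) (at 0)" by (simp add: isCont_def)
    hence "c \<in> O[at 0](\<lambda>_. 1)" by (intro bigoI_tendsto[of _ _ "c 0"]) auto
    moreover have "shifted_summand s a n m \<in> O[at 0](\<lambda>t. t ^ s)"
      using m by (intro shifted_summand_bigo) (auto simp: M_def)
    ultimately have "(\<lambda>t. c t * shifted_summand s a n m t) \<in> O[at 0](\<lambda>t. 1 * t ^ s)"
      by (rule landau_o.big.mult)
    thus ?thesis by (simp add: H_def c_def)
  qed
  \<comment> \<open>The points of the summation range that do not belong to the deformed sum of
    index n + i; each of them contributes O(t^s).\<close>
  define out where "out = (\<lambda>i. {- int M..<int M} - int ` {0..n+i})"
  define E where "E = (\<lambda>t. H (int M) t - H (- int M) t - 
      (\<Sum>i\<le>L. poly (p i) (real n) * (\<Sum>m\<in>out i. shifted_summand s a (n + i) m t)))"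
  have "E \<in> O[at 0](\<lambda>t. t ^ s)"
    unfolding E_def
  proof (intro sum_in_bigo big_sum_in_bigo H_bigo)
    fix i assume "i \<in> {..L}"
    have "(\<lambda>t. \<Sum>m\<in>out i. shifted_summand s a (n + i) m t) \<in> O[at 0](\<lambda>t. t ^ s)"
    proof (rule big_sum_in_bigo)
      fix m assume m: "m \<in> out i"
      have "m < 0 \<or> int (n + i) < m"
      proof (rule ccontr)
        assume "\<not> ?thesis"
        hence "m = int (nat m)" "nat m \<in> {0..n+i}" by auto
        hence "m \<in> int ` {0..n+i}" by blast
        thus False using m by (simp add: out_def)
      qed
      thus "shifted_summand s a (n + i) m \<in> O[at 0](\<lambda>t. t ^ s)" by (rule shifted_summand_bigo)
    qed
    thus "(\<lambda>t. poly (p i) (real n) * (\<Sum>m\<in>out i. shifted_summand s a (n + i) m t)) \<in> O[at 0](\<lambda>t. t ^ s)"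
      by (cases "poly (p i) (real n) = 0") auto
  qed auto
  moreover have "eventually (\<lambda>t. (\<Sum>i\<le>L. poly (p i) (real n) * deformed_sum s a (n + i) t) = E t) (at 0)"
  proof -
    \<comment> \<open>D may well vanish at an integer m inside the range. Its zeros are finite in
      number, so a small t different from 0 avoids them.\<close>
    have "eventually (\<lambda>t. eval2 D (real n) (of_int m + t) \<noteq> 0) (at 0)" for m :: int
    proof -
      have "finite ((\<lambda>y. y - of_int m) ` {y. eval2 D (real n) y = 0})"
        using eval2_finite_zeros[OF x0] by simp
      hence "eventually (\<lambda>t. t \<notin> (\<lambda>y. y - of_int m) ` {y. eval2 D (real n) y = 0}) (at 0)"
        using islimpt_finite islimpt_iff_eventually by blast
      thus ?thesis
      proof eventually_elim
        case (elim t)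
        show ?case
        proof
          assume "eval2 D (real n) (of_int m + t) = 0"
          hence "t \<in> (\<lambda>y. y - of_int m) ` {y. eval2 D (real n) y = 0}"
            by (intro image_eqI[of _ _ "of_int m + t"]) auto
          thus False using elim by simp
        qed
      qed
    qed
    hence "eventually (\<lambda>t. \<forall>m\<in>{- int M..int M}. eval2 D (real n) (of_int m + t) \<noteq> 0) (at 0)"
      by (intro eventually_ball_finite) auto
    moreover have "eventually (\<lambda>t::real. \<bar>t\<bar> < 1 \<and> t \<noteq> 0) (at 0)"
      by (rule eventually_mono[OF eventually_at_ball'[of 1 0 UNIV]]) auto
    ultimately show ?thesis
    proof eventually_elim
      case (elim t)
      have nint: "of_int m + t \<noteq> of_int j" for m j :: int
      proof
        assume "of_int m + t = of_int j"
        hence t: "t = of_int (j - m)" by simp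
        hence "\<bar>real_of_int (j - m)\<bar> < 1" using elim by simp
        hence "j - m = 0" by linarith
        thus False using t elim by simp
      qed
      have step: "(\<Sum>i\<le>L. poly (p i) (real n) * shifted_summand s a (n + i) m t) = H (m + 1) t - H m t"
        if "m \<in> {- int M..<int M}" for m
        unfolding H_def
        using that elim(1)[rule_format, of m] elim(1)[rule_format, of "m + 1"]
        by (intro certificate_identity[where G = G, OF a G tele nint]) auto
      have tele': "(\<Sum>m\<in>{- int M..<- int M + int J}. H (m + 1) t - H m t) = H (- int M + int J) t - H (- int M) t" for J
      proof (induction J)
        case (Suc J)
        have "{- int M..<- int M + int (Suc J)} = insert (- int M + int J) {- int M..<- int M + int J}" by auto
        thus ?case using Suc by (simp add: algebra_simps)
      qed simp
      have "(\<Sum>i\<le>L. poly (p i) (real n) * (\<Sum>m\<in>{- int M..<int M}. shifted_summand s a (n + i) m t)) =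
        (\<Sum>m\<in>{- int M..<int M}. \<Sum>i\<le>L. poly (p i) (real n) * shifted_summand s a (n + i) m t)"
        by (simp only: sum_distrib_left) (rule sum.swap)
      also have "\<dots> = (\<Sum>m\<in>{- int M..<int M}. H (m + 1) t - H m t)"
        by (intro sum.cong refl step)
      also have "\<dots> = H (int M) t - H (- int M) t"
        using tele'[of "2 * M"] by simp
      finally have total: "(\<Sum>i\<le>L. poly (p i) (real n) * (\<Sum>m\<in>{- int M..<int M}. shifted_summand s a (n + i) m t)) =
        H (int M) t - H (- int M) t" .
      have "(\<Sum>m\<in>{- int M..<int M}. shifted_summand s a (n + i) m t) = 
          deformed_sum s a (n + i) t + (\<Sum>m\<in>out i. shifted_summand s a (n + i) m t)" if "i \<le> L" for i
      proof -
        have sub: "int ` {0..n+i} \<subseteq> {- int M..<int M}" using that by (auto simp: M_def)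
        have "(\<Sum>m\<in>int ` {0..n+i}. shifted_summand s a (n + i) m t) = deformed_sum s a (n + i) t"
          unfolding deformed_sum_def using elim
          by (subst sum.reindex) (auto intro!: sum.cong simp: shifted_summand_eq_deformed_term)
        thus ?thesis
          using sum.subset_diff[OF sub, of "\<lambda>m. shifted_summand s a (n + i) m t"] by (simp add: out_def)
      qed
      hence "(\<Sum>i\<le>L. poly (p i) (real n) * (\<Sum>m\<in>{- int M..<int M}. shifted_summand s a (n + i) m t)) = 
         (\<Sum>i\<le>L. poly (p i) (real n) * (deformed_sum s a (n + i) t + (\<Sum>m\<in>out i. shifted_summand s a (n + i) m t)))"
        by (intro sum.cong) auto
      thus ?case using total by (simp add: E_def distrib_left sum.distrib)
    qed
  qed
  ultimately show ?thesis by (subst landau_o.big.in_cong) auto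
qed

lemma taylor_coeff_deformed_sum_satisfies_recurrence:
  assumes a: "a > 0" and zeil: "zeilberger_recurrence (summand s a) L p" and "r < s"
  shows "satisfies_recurrence L p (\<lambda>n. taylor_coeff (deformed_sum s a n) r)"
  unfolding satisfies_recurrence_def
proof
  fix n
  have rr: "real_restriction (\<lambda>t. of_real (poly (p i) (real n)) * cdeformed_sum s a (n + i) t) 
          (\<lambda>t. poly (p i) (real n) * deformed_sum s a (n + i) t)" for i
    by (intro real_restriction_mult real_restriction_const real_restriction_deformed_sum)
  have "0 = taylor_coeff (\<lambda>t. \<Sum>i\<le>L. poly (p i) (real n) * deformed_sum s a (n + i) t) r"
    by (rule taylor_coeff_eq_0[OF real_restriction_sum[OF rr] \<open>r < s\<close> 
         deformed_sum_recurrence_bigo[OF a zeil], symmetric])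
  also have "\<dots> = (\<Sum>i\<le>L. taylor_coeff (\<lambda>t. poly (p i) (real n) * deformed_sum s a (n + i) t) r)"
    by (rule taylor_coeff_sum[OF _ rr]) auto
  also have "\<dots> = (\<Sum>i\<le>L. poly (p i) (real n) * taylor_coeff (deformed_sum s a (n + i)) r)"
    by (intro sum.cong refl taylor_coeff_cmult[OF real_restriction_deformed_sum])
  finally show "(\<Sum>i\<le>L. poly (p i) (real n) * taylor_coeff (deformed_sum s a (n + i)) r) = 0" by simp
qed

text \<open>Where the leading coefficient is non-zero the recurrence determines the next value;
  where it vanishes, the value is prescribed.\<close>

lemma solution_with_initial_values_unique:
  assumes A: "solution_with_initial_values L p v A" and v: "satisfies_recurrence L p v"
  shows "A n = v n"
proof (induction n rule: less_induct)
  case (less n)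
  show ?case
  proof (cases "n < L")
    case True
    thus ?thesis using A by (simp add: solution_with_initial_values_def)
  next
    case False
    then obtain m where n: "n = m + L" by (metis le_add_diff_inverse2 not_less)
    show ?thesis
    proof (cases "poly (p L) (real m) = 0")
      case True
      thus ?thesis using A n by (simp add: solution_with_initial_values_def)
    next
      case False
      have split: "(\<Sum>i\<le>L. poly (p i) (real m) * u (m + i)) = 
         (\<Sum>i<L. poly (p i) (real m) * u (m + i)) + poly (p L) (real m) * u n" for u
        by (simp add: n lessThan_Suc_atMost[symmetric])
      have "(\<Sum>i\<le>L. poly (p i) (real m) * A (m + i)) = (\<Sum>i\<le>L. poly (p i) (real m) * v (m + i))"
        using A v by (simp add: solution_with_initial_values_def satisfies_recurrence_def)
      moreover have "(\<Sum>i<L. poly (p i) (real m) * A (m + i)) = (\<Sum>i<L. poly (p i) (real m) * v (m + i))"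
        by (intro sum.cong refl) (auto simp: less n)
      ultimately show ?thesis unfolding split using False by simp
    qed
  qed
qed

subsection \<open>The limit of the coefficients near the maximum\<close>

text \<open>The exponential is uniformly continuous on bounded sets only. Eventually all f n stay
  within distance 1 of the bounded limit.\<close>

lemma uniform_limit_exp:
  fixes f :: "'b \<Rightarrow> 'a \<Rightarrow> complex"
  assumes lim: "uniform_limit K f l F" and bdd: "bounded (l ` K)"
  shows "uniform_limit K (\<lambda>n t. exp (f n t)) (\<lambda>t. exp (l t)) F"
proof -
  obtain R where R: "\<And>t. t \<in> K \<Longrightarrow> norm (l t) \<le> R" using bdd by (auto simp: bounded_iff)
  have "eventually (\<lambda>n. \<forall>t\<in>K. dist (f n t) (l t) < 1) F"
    using lim by (rule uniform_limitD) simp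
  hence "eventually (\<lambda>n. f n ` K \<subseteq> cball 0 (R + 1)) F"
  proof eventually_elim
    case (elim n)
    have "norm (f n t) \<le> R + 1" if "t \<in> K" for t
      using R[OF that] elim that norm_triangle_sub[of "f n t" "l t"] by (force simp: dist_norm)
    thus ?case by auto
  qed
  moreover have "uniformly_continuous_on (cball 0 (R + 1)) (exp :: complex \<Rightarrow> complex)"
    by (intro compact_uniformly_continuous continuous_intros) auto
  moreover have "l ` K \<subseteq> cball 0 (R + 1)" using R by force
  ultimately show ?thesis
    using uniform_limit_compose[OF lim, of "cball 0 (R + 1)" exp] by (simp add: o_def)
qed

lemma uniform_limit_mult_compact:
  fixes f g :: "'b \<Rightarrow> 'a :: topological_space \<Rightarrow> complex"
  assumes "uniform_limit K f l F" "uniform_limit K g m F"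
    and "compact K" "continuous_on K l" "continuous_on K m"
  shows "uniform_limit K (\<lambda>n t. f n t * g n t) (\<lambda>t. l t * m t) F"
  by (intro uniform_lim_mult assms compact_imp_bounded compact_continuous_image)

lemma uniform_limit_power_compact:
  fixes f :: "'b \<Rightarrow> 'a :: topological_space \<Rightarrow> complex"
  assumes "uniform_limit K f l F" "compact K" "continuous_on K l"
  shows "uniform_limit K (\<lambda>n t. f n t ^ s) (\<lambda>t. l t ^ s) F"
proof (induction s)
  case 0
  show ?case by (simp add: uniform_limit_const)
next
  case (Suc s)
  show ?case unfolding power_Suc
    by (intro uniform_limit_mult_compact assms Suc continuous_intros)
qed

lemma uniform_limit_tendsto_const:
  assumes "(f \<longlongrightarrow> c) F"
  shows "uniform_limit K (\<lambda>n t. f n) (\<lambda>t. c) F"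
  using assms by (intro uniform_limitI) (auto dest: tendstoD)

text \<open>Euler's approximation m! m^t / (1 + t)_m to Gamma (1 + t).\<close>

definition gamma_quotient :: "nat \<Rightarrow> complex \<Rightarrow> complex" where
  "gamma_quotient m t = fact m / pochhammer (1 + t) m * exp (t * of_real (ln (real m)))"

lemma one_plus_notin_nonpos_Ints:
  assumes "norm (t :: complex) < 1"
  shows "1 + t \<notin> \<int>\<^sub>\<le>\<^sub>0"
proof
  assume "1 + t \<in> \<int>\<^sub>\<le>\<^sub>0"
  then obtain n where "1 + t = of_int n" "n \<le> 0" by (auto elim: nonpos_Ints_cases)
  moreover from this(1) have "Re (1 + t) = of_int n" by simp
  ultimately have "Re (1 + t) \<le> 0" by simp
  thus False using abs_Re_le_cmod[of t] assms by simp
qed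

text \<open>\<open>Gamma_series (1 + t) m\<close> has one more Pochhammer factor 1 + t + m and one
  more power of m; their quotient 1 + (1 + t) / m tends to 1.\<close>

lemma gamma_quotient_eq:
  assumes "m > 0" "norm t < 1"
  shows "gamma_quotient m t = exp (ln_Gamma_series (1 + t) m) * (1 + (1 + t) * of_real (inverse (real m)))"
proof -
  have nz: "1 + t + of_nat m \<noteq> 0"
    using pochhammer_nonzero_unit_disc[OF assms(2), of "Suc m"] by (simp add: pochhammer_Suc)
  have "exp (ln_Gamma_series (1 + t) m) = Gamma_series (1 + t) m"
    using assms by (intro exp_ln_Gamma_series_complex one_plus_notin_nonpos_Ints)
  also have "\<dots> = fact m * (of_nat m * exp (t * of_real (ln (real m)))) / (pochhammer (1 + t) m * (1 + t + of_nat m))"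
    using assms by (simp add: Gamma_series_def pochhammer_Suc exp_add distrib_right exp_of_real)
  also have "\<dots> * (1 + (1 + t) * of_real (inverse (real m))) = gamma_quotient m t"
    using assms nz pochhammer_nonzero_unit_disc[OF assms(2), of m]
    by (simp add: gamma_quotient_def divide_simps)
  finally show ?thesis by simp
qed

lemma uniform_limit_gamma_quotient:
  "uniform_limit (cball 0 (1 / 2)) gamma_quotient (\<lambda>t. Gamma (1 + t)) sequentially"
proof -
  let ?K = "cball (0::complex) (1 / 2)"
  have notin: "1 + t \<notin> \<int>\<^sub>\<le>\<^sub>0" if "t \<in> ?K" for t
    using that by (intro one_plus_notin_nonpos_Ints) auto
  \<comment> \<open>This disc contains 1 + t for |t| <= 1/2 and stays away from the non-positive
    integers, whose distance from 1 is at least 1.\<close>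
  have "uniformly_convergent_on (ball 1 (3 / 4)) (\<lambda>n z. ln_Gamma_series z n :: complex)"
  proof (rule ln_Gamma_series_complex_converges)
    show "(1::complex) \<notin> \<int>\<^sub>\<le>\<^sub>0" using one_plus_notin_nonpos_Ints[of 0] by simp
    fix n :: int assume "n \<in> \<int>\<^sub>\<le>\<^sub>0"
    hence "n \<le> 0" by (auto elim!: nonpos_Ints_cases)
    hence "1 \<le> \<bar>Re (1 - of_int n :: complex)\<bar>" by simp
    also have "\<dots> \<le> norm (1 - of_int n :: complex)" by (rule abs_Re_le_cmod)
    finally show "norm (1 - of_int n :: complex) > 3 / 4" by simp
  qed simp
  then obtain l where l: "uniform_limit (ball 1 (3 / 4)) (\<lambda>n (z::complex). ln_Gamma_series z n) l sequentially"
    by (auto simp: uniformly_convergent_on_def)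
  have lG: "l z = ln_Gamma z" if "z \<in> ball 1 (3 / 4)" for z
  proof -
    have "1 + (z - 1) \<notin> \<int>\<^sub>\<le>\<^sub>0" 
      using that by (intro one_plus_notin_nonpos_Ints) (auto simp: dist_norm norm_minus_commute)
    hence "ln_Gamma_series z \<longlonglongrightarrow> ln_Gamma z" by (intro ln_Gamma_complex_LIMSEQ) simp
    moreover have "(\<lambda>n. ln_Gamma_series z n) \<longlonglongrightarrow> l z" using tendsto_uniform_limitI[OF l that] .
    ultimately show ?thesis using LIMSEQ_unique by blast
  qed
  have lim1: "uniform_limit ?K (\<lambda>n t. ln_Gamma_series (1 + t) n) (\<lambda>t. l (1 + t)) sequentially"
    by (rule uniform_limit_compose'[OF l]) (auto simp: dist_norm)
  have "continuous_on ?K (\<lambda>t. ln_Gamma (1 + t :: complex))"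
  proof -
    have "1 + t \<notin> \<real>\<^sub>\<le>\<^sub>0" if "t \<in> ?K" for t
      using that abs_Re_le_cmod[of t] by (auto simp: complex_nonpos_Reals_iff)
    moreover have "continuous_on ?K (\<lambda>t. 1 + t)" by (intro continuous_intros)
    ultimately have "continuous_on ((\<lambda>t. 1 + t) ` ?K) ln_Gamma"
      by (intro continuous_at_imp_continuous_on ballI isCont_ln_Gamma_complex[OF continuous_ident]) blast
    thus ?thesis by (rule continuous_on_compose2) (auto intro: continuous_intros)
  qed
  also have "?this \<longleftrightarrow> continuous_on ?K (\<lambda>t. l (1 + t))"
    by (intro continuous_on_cong refl) (auto simp: lG dist_norm)
  finally have cont_l: "continuous_on ?K (\<lambda>t. l (1 + t))" .
  have lim2: "uniform_limit ?K (\<lambda>n t. exp (ln_Gamma_series (1 + t) n)) (\<lambda>t. exp (l (1 + t))) sequentially"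
    by (intro uniform_limit_exp lim1 compact_imp_bounded compact_continuous_image cont_l) auto
  have "(\<lambda>n. complex_of_real (inverse (real n))) \<longlonglongrightarrow> of_real 0"
    by (intro tendsto_of_real lim_inverse_n)
  hence "uniform_limit ?K (\<lambda>n t. 1 + (1 + t) * of_real (inverse (real n))) (\<lambda>t. 1 + (1 + t) * of_real 0) sequentially"
    by (intro uniform_limit_add uniform_limit_const uniform_limit_mult_compact uniform_limit_tendsto_const continuous_intros) auto
  hence "uniform_limit ?K (\<lambda>n t. exp (ln_Gamma_series (1 + t) n) * (1 + (1 + t) * of_real (inverse (real n))))
     (\<lambda>t. exp (l (1 + t)) * (1 + (1 + t) * of_real 0)) sequentially"
    by (intro uniform_limit_mult_compact lim2 continuous_intros cont_l) auto
  also have "?this \<longleftrightarrow> ?thesis"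
  proof (rule uniform_limit_cong)
    show "\<forall>\<^sub>F n in sequentially. \<forall>t\<in>?K. exp (ln_Gamma_series (1 + t) n) * (1 + (1 + t) * of_real (inverse (real n))) = gamma_quotient n t"
      using eventually_gt_at_top[of 0] by eventually_elim (auto simp: gamma_quotient_eq)
    show "exp (l (1 + t)) * (1 + (1 + t) * of_real 0) = Gamma (1 + t)" if "t \<in> ?K" for t
      using that notin[OF that] lG[of "1 + t"] by (simp add: Gamma_complex_altdef dist_norm)
  qed
  finally show ?thesis .
qed

text \<open>By the reflection formula this is (pi t / sin(pi t) * b^(-t))^s, with value 1 at t =
  0.\<close>

definition gamma_factor :: "nat \<Rightarrow> real \<Rightarrow> complex \<Rightarrow> complex" where
  "gamma_factor s b t = (Gamma (1 + t) * Gamma (1 - t) * exp (- (t * of_real (ln b)))) ^ s"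

lemma holomorphic_gamma_factor: "gamma_factor s b holomorphic_on ball 0 1"
proof -
  have "1 + t \<notin> \<int>\<^sub>\<le>\<^sub>0" "1 - t \<notin> \<int>\<^sub>\<le>\<^sub>0" if "t \<in> ball 0 1" for t :: complex
    using that one_plus_notin_nonpos_Ints[of t] one_plus_notin_nonpos_Ints[of "- t"] by auto
  thus ?thesis unfolding gamma_factor_def by (intro holomorphic_intros) auto
qed

definition c_extension :: "nat \<Rightarrow> nat \<Rightarrow> nat \<Rightarrow> complex \<Rightarrow> complex" where
  "c_extension s n k t = (fact k / pochhammer (1 + t) k * (fact (n - k) / pochhammer (1 - t) (n - k))) ^ s"

lemma holomorphic_c_extension: "c_extension s n k holomorphic_on ball 0 1"
  unfolding c_extension_def
  using pochhammer_nonzero_unit_disc pochhammer_nonzero_unit_disc[of "- _"]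
  by (intro holomorphic_intros) auto

lemma of_real_c_coeff: "of_real (c_coeff s r n k) = (deriv ^^ r) (c_extension s n k) 0 / fact r"
  unfolding c_coeff_def
proof (rule taylor_coeff_real_restriction)
  have "complex_of_real (pochhammer (1 + t) k) = pochhammer (1 + of_real t) k" for t k
    by (simp add: pochhammer_of_real[symmetric])
  from this this[of "- _"]
  have "c_extension s n k (of_real t) = of_real (fact k ^ s * fact (n - k) ^ s / (pochhammer (1 + t) k ^ s * pochhammer (1 - t) (n - k) ^ s))" for t
    by (simp add: c_extension_def power_mult_distrib power_divide)
  thus "real_restriction (c_extension s n k) (\<lambda>t. fact k ^ s * fact (n - k) ^ s / (pochhammer (1 + t) k ^ s * pochhammer (1 - t) (n - k) ^ s))"
    by (simp add: real_restriction_def holomorphic_c_extension)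
qed

text \<open>Euler's limit for k and for n - k leaves the factor ((n - k) / k)^t in the base of the
  power, and this tends to b^(-t) when k / n tends to b / (1 + b).\<close>

lemma c_coeff_tendsto:
  fixes b :: real and k :: "nat \<Rightarrow> nat"
  assumes b: "0 < b" and k: "(\<lambda>n. real (k n) / real n) \<longlonglongrightarrow> b / (1 + b)"
  shows "(\<lambda>n. complex_of_real (c_coeff s r n (k n))) \<longlonglongrightarrow> (deriv ^^ r) (gamma_factor s b) 0 / fact r"
proof -
  let ?K = "cball (0::complex) (1 / 2)"
  define \<alpha> where "\<alpha> = b / (1 + b)"
  note k = k[folded \<alpha>_def]
  have \<alpha>: "0 < \<alpha>" "\<alpha> < 1" using b by (auto simp: \<alpha>_def field_simps)
  have ev: "eventually (\<lambda>n. \<alpha> / 2 < real (k n) / real n \<and> real (k n) / real n < (1 + \<alpha>) / 2) sequentially"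
    using order_tendstoD(1)[OF k, of "\<alpha> / 2"] order_tendstoD(2)[OF k, of "(1 + \<alpha>) / 2"] \<alpha>
    by (auto intro: eventually_conj)
  have ev': "eventually (\<lambda>n. \<alpha> / 2 * real n \<le> real (k n) \<and> (1 - \<alpha>) / 2 * real n \<le> real (n - k n) \<and> 0 < k n \<and> k n < n) sequentially"
    using ev eventually_gt_at_top[of 0]
  proof eventually_elim
    case (elim n)
    have "\<alpha> / 2 * real n < real (k n)" "real (k n) < (1 + \<alpha>) / 2 * real n"
      using elim by (simp_all add: pos_less_divide_eq pos_divide_less_eq)
    moreover have "0 < \<alpha> / 2 * real n" "(1 + \<alpha>) / 2 * real n < 1 * real n"
      using \<alpha> elim by (auto intro!: mult_pos_pos mult_strict_right_mono)
    moreover have "(1 - \<alpha>) / 2 * real n = real n - (1 + \<alpha>) / 2 * real n" by (simp add: field_simps)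
    ultimately have "\<alpha> / 2 * real n < real (k n)" "0 < real (k n)" "real (k n) < real n"
      "(1 - \<alpha>) / 2 * real n < real n - real (k n)" by linarith+
    thus ?case by (simp add: of_nat_diff)
  qed
  have lin: "filterlim (\<lambda>n. c * real n) at_top sequentially" if "0 < c" for c
    using that by (intro filterlim_tendsto_pos_mult_at_top[OF tendsto_const _ filterlim_real_sequentially]) auto
  have k_top: "filterlim k at_top sequentially"
  proof -
    have "filterlim (\<lambda>n. real (k n)) at_top sequentially"
      by (rule filterlim_at_top_mono[OF lin[of "\<alpha> / 2"]]) (use \<alpha> ev' in \<open>auto elim: eventually_mono\<close>)
    thus ?thesis by (simp add: filterlim_sequentially_iff_filterlim_real)
  qed
  have nk_top: "filterlim (\<lambda>n. n - k n) at_top sequentially"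
  proof -
    have "filterlim (\<lambda>n. real (n - k n)) at_top sequentially"
      by (rule filterlim_at_top_mono[OF lin[of "(1 - \<alpha>) / 2"]]) (use \<alpha> ev' in \<open>auto elim: eventually_mono\<close>)
    thus ?thesis by (simp only: filterlim_sequentially_iff_filterlim_real)
  qed
  define \<delta> where "\<delta> = (\<lambda>n. ln (real (n - k n)) - ln (real (k n)))"
  have "\<delta> \<longlonglongrightarrow> - ln b"
  proof -
    have "(\<lambda>n. ln (1 - real (k n) / real n) - ln (real (k n) / real n)) \<longlonglongrightarrow> ln (1 - \<alpha>) - ln \<alpha>"
      using \<alpha> by (intro tendsto_intros k) auto
    also have "ln (1 - \<alpha>) - ln \<alpha> = - ln b"
    proof -
      have "1 - \<alpha> = 1 / (1 + b)" using b by (simp add: \<alpha>_def field_simps)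
      thus ?thesis using b by (simp add: ln_div \<alpha>_def)
    qed
    finally show ?thesis
    proof (rule Lim_transform_eventually)
      show "eventually (\<lambda>n. ln (1 - real (k n) / real n) - ln (real (k n) / real n) = \<delta> n) sequentially"
        using ev'
      proof eventually_elim
        case (elim n)
        hence "1 - real (k n) / real n = real (n - k n) / real n" by (simp add: field_simps of_nat_diff)
        thus ?case using elim by (simp add: ln_div \<delta>_def)
      qed
    qed
  qed
  hence "(\<lambda>n. complex_of_real (\<delta> n)) \<longlonglongrightarrow> of_real (- ln b)" by (rule tendsto_of_real)
  hence lim\<delta>: "uniform_limit ?K (\<lambda>n t. exp (t * of_real (\<delta> n))) (\<lambda>t. exp (t * of_real (- ln b))) sequentially"
    by (intro uniform_limit_exp uniform_limit_mult_compact uniform_limit_const uniform_limit_tendsto_const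
         compact_imp_bounded compact_continuous_image continuous_intros) auto
  have lim1: "uniform_limit ?K (\<lambda>n. gamma_quotient (k n)) (\<lambda>t. Gamma (1 + t)) sequentially"
    by (rule filterlim_compose[OF uniform_limit_gamma_quotient k_top])
  have "uniform_limit ?K (\<lambda>n. gamma_quotient (n - k n)) (\<lambda>t. Gamma (1 + t)) sequentially"
    by (rule filterlim_compose[OF uniform_limit_gamma_quotient nk_top])
  hence lim2: "uniform_limit ?K (\<lambda>n t. gamma_quotient (n - k n) (- t)) (\<lambda>t. Gamma (1 + - t)) sequentially"
    by (rule uniform_limit_compose') auto
  have cont: "continuous_on ?K (\<lambda>t. Gamma (1 + t))" "continuous_on ?K (\<lambda>t. Gamma (1 + - t))"
    by (intro holomorphic_on_imp_continuous_on holomorphic_intros one_plus_notin_nonpos_Ints; force)+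
  have "uniform_limit ?K (\<lambda>n t. (gamma_quotient (k n) t * gamma_quotient (n - k n) (- t) * exp (t * of_real (\<delta> n))) ^ s)
     (\<lambda>t. (Gamma (1 + t) * Gamma (1 + - t) * exp (t * of_real (- ln b))) ^ s) sequentially"
    by (intro uniform_limit_power_compact uniform_limit_mult_compact lim1 lim2 lim\<delta> continuous_intros cont) auto
  also have "?this \<longleftrightarrow> uniform_limit ?K (\<lambda>n. c_extension s n (k n)) (gamma_factor s b) sequentially"
  proof (rule uniform_limit_cong)
    show "\<forall>\<^sub>F n in sequentially. \<forall>t\<in>?K. (gamma_quotient (k n) t * gamma_quotient (n - k n) (- t) * exp (t * of_real (\<delta> n))) ^ s = c_extension s n (k n) t"
    \<comment> \<open>The exponentials cancel for every n, including k n = 0 and n - k n = 0,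
      because \<open>\<delta>\<close> is built from the very same values of
      \<open>ln\<close>.\<close>
    proof (intro always_eventually allI ballI)
      fix n and t :: complex
      have "exp (t * of_real (ln (real (k n)))) * exp (- t * of_real (ln (real (n - k n)))) * exp (t * of_real (\<delta> n)) = 1"
        unfolding exp_add[symmetric] by (simp add: \<delta>_def algebra_simps)
      hence "X * exp (t * of_real (ln (real (k n)))) * (Y * exp (- t * of_real (ln (real (n - k n))))) * exp (t * of_real (\<delta> n)) = X * Y" for X Y
        by (metis (no_types, opaque_lifting) mult.assoc mult.commute mult.right_neutral)
      thus "(gamma_quotient (k n) t * gamma_quotient (n - k n) (- t) * exp (t * of_real (\<delta> n))) ^ s = c_extension s n (k n) t"
        by (simp only: gamma_quotient_def c_extension_def diff_conv_add_uminus[of 1 t])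
    qed
    show "(Gamma (1 + t) * Gamma (1 + - t) * exp (t * of_real (- ln b))) ^ s = gamma_factor s b t" for t
      by (simp add: gamma_factor_def)
  qed
  finally have "uniform_limit (ball 0 (1 / 2)) (\<lambda>n. c_extension s n (k n)) (gamma_factor s b) sequentially"
    by (rule uniform_limit_on_subset) auto
  \<comment> \<open>Uniform limits of holomorphic functions may be differentiated termwise; this is
    why all limits above are taken uniformly on a disc.\<close>
  hence "(\<lambda>n. (deriv ^^ r) (c_extension s n (k n)) 0) \<longlonglongrightarrow> (deriv ^^ r) (gamma_factor s b) 0"
    by (rule higher_deriv_complex_uniform_limit)
       (auto intro!: always_eventually holomorphic_on_subset[OF holomorphic_c_extension])
  thus ?thesis unfolding of_real_c_coeff by (intro tendsto_intros) auto
qed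

subsection \<open>The maximum of the summand and exponential decay\<close>

text \<open>Taking s-th powers is monotone, so the position of the maximum depends on (n choose k)
  b^k alone.\<close>

lemma summand_le_iff:
  assumes b: "0 < b" and s: "0 < s"
  shows "summand s (b ^ s) n (int j) \<le> summand s (b ^ s) n (int k) \<longleftrightarrow>
         real (n choose j) * b ^ j \<le> real (n choose k) * b ^ k"
proof -
  have *: "summand s (b ^ s) n (int k) = (real (n choose k) * b ^ k) ^ s" for k
    by (simp add: summand_def power_mult_distrib mult.commute flip: power_mult)
  show ?thesis unfolding * using b s by (intro power_mono_iff) auto
qed

text \<open>Consecutive terms have ratio (n - j) b / (j + 1). Comparing a maximizer with its two
  neighbours traps \<kappa> (1 + b) between b n - 1 and b (n + 1).\<close>

lemma asymptotic_maximizer_eq: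
  fixes b :: real
  assumes b: "0 < b" and s: "0 < s" and \<alpha>: "asymptotic_maximizer (summand s (b ^ s)) \<alpha>"
  shows "\<alpha> = b / (1 + b)"
proof -
  let ?P = "\<lambda>n k. is_arg_max (\<lambda>k. summand s (b ^ s) n (int k)) (\<lambda>k. k \<le> n) k"
  \<comment> \<open>\<open>asymptotic_maximizer\<close> speaks about all sequences of maximizers;
    one has to exist before it says anything about \<alpha>.\<close>
  have "\<exists>k. ?P n k" for n
  proof -
    define m where "m = Max ((\<lambda>k. summand s (b ^ s) n (int k)) ` {..n})"
    have "m \<in> (\<lambda>k. summand s (b ^ s) n (int k)) ` {..n}" unfolding m_def by (intro Max_in) auto
    then obtain k where k: "k \<le> n" "m = summand s (b ^ s) n (int k)" by auto
    have "summand s (b ^ s) n (int j) \<le> m" if "j \<le> n" for j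
      unfolding m_def using that by (intro Max_ge) auto
    hence "?P n k" using k by (force simp: is_arg_max_def not_less)
    thus ?thesis ..
  qed
  then obtain \<kappa> where \<kappa>: "\<And>n. ?P n (\<kappa> n)" by metis
  have lim: "(\<lambda>n. real (\<kappa> n) / real n) \<longlonglongrightarrow> \<alpha>"
    using \<alpha> \<kappa> unfolding asymptotic_maximizer_def by blast
  have le: "\<kappa> n \<le> n" and max: "j \<le> n \<Longrightarrow> real (n choose j) * b ^ j \<le> real (n choose \<kappa> n) * b ^ \<kappa> n" for n j
    using \<kappa>[of n] summand_le_iff[OF b s, of n j "\<kappa> n"] by (auto simp: is_arg_max_def not_less)
  have upper: "real (\<kappa> n) * (1 + b) \<le> b * (real n + 1)" for n
  proof (cases "\<kappa> n")
    case (Suc j)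
    have j: "j \<le> n" "Suc j \<le> n" using le[of n] Suc by auto
    have pos: "0 < real (n choose j) * b ^ j" using j b by simp
    have "real (n choose j) * b ^ j \<le> real (n choose Suc j) * b ^ Suc j" using max[of j n] j Suc by simp
    hence "real (Suc j) * (real (n choose j) * b ^ j) \<le> (real (Suc j) * real (n choose Suc j)) * b ^ Suc j"
      by (simp add: mult_left_mono mult_ac del: of_nat_Suc)
    also have "real (Suc j) * real (n choose Suc j) = (real n - real j) * real (n choose j)"
      by (rule Suc_mult_choose_Suc[OF j(1)])
    also have "\<dots> * b ^ Suc j = ((real n - real j) * b) * (real (n choose j) * b ^ j)" by simp
    finally have "real (Suc j) \<le> (real n - real j) * b" using pos by (simp only: mult_le_cancel_right_pos)
    thus ?thesis using Suc by (simp add: algebra_simps)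
  qed (use b in auto)
  have lower: "b * real n - 1 \<le> real (\<kappa> n) * (1 + b)" for n
  proof (cases "\<kappa> n = n")
    case True
    thus ?thesis using b by (simp add: algebra_simps)
  next
    case False
    define j where "j = \<kappa> n"
    have j: "j \<le> n" "Suc j \<le> n" using le[of n] False by (auto simp: j_def)
    have pos: "0 < real (n choose j) * b ^ j" using j b by simp
    have "real (n choose Suc j) * b ^ Suc j \<le> real (n choose j) * b ^ j" using max[of "Suc j" n] j by (simp add: j_def)
    hence "(real (Suc j) * real (n choose Suc j)) * b ^ Suc j \<le> real (Suc j) * (real (n choose j) * b ^ j)"
      by (simp add: mult_left_mono mult_ac del: of_nat_Suc)
    also have "real (Suc j) * real (n choose Suc j) = (real n - real j) * real (n choose j)"
      by (rule Suc_mult_choose_Suc[OF j(1)])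
    also have "(real n - real j) * real (n choose j) * b ^ Suc j = ((real n - real j) * b) * (real (n choose j) * b ^ j)" by simp
    finally have "(real n - real j) * b \<le> real (Suc j)" using pos by (simp only: mult_le_cancel_right_pos)
    thus ?thesis by (simp add: j_def algebra_simps)
  qed
  have "(\<lambda>n. real (\<kappa> n) / real n) \<longlonglongrightarrow> b / (1 + b)"
  proof (rule tendsto_sandwich)
    have inv: "(\<lambda>n. inverse (real n)) \<longlonglongrightarrow> 0" by (rule lim_inverse_n)
    have "(\<lambda>n. (b - inverse (real n)) / (1 + b)) \<longlonglongrightarrow> (b - 0) / (1 + b)"
      using b by (intro tendsto_intros inv) auto
    thus "(\<lambda>n. (b - inverse (real n)) / (1 + b)) \<longlonglongrightarrow> b / (1 + b)" by simp
    have "(\<lambda>n. b * (1 + inverse (real n)) / (1 + b)) \<longlonglongrightarrow> b * (1 + 0) / (1 + b)"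
      using b by (intro tendsto_intros inv) auto
    thus "(\<lambda>n. b * (1 + inverse (real n)) / (1 + b)) \<longlonglongrightarrow> b / (1 + b)" by simp
    show "eventually (\<lambda>n. (b - inverse (real n)) / (1 + b) \<le> real (\<kappa> n) / real n) sequentially"
      using eventually_gt_at_top[of 0]
    proof eventually_elim
      case (elim n)
      have "(b - inverse (real n)) / (1 + b) = (b * real n - 1) / (1 + b) / real n"
        using elim b by (simp add: field_simps)
      also have "\<dots> \<le> real (\<kappa> n) / real n"
        using lower[of n] b by (intro divide_right_mono) (simp_all add: pos_divide_le_eq)
      finally show ?case .
    qed
    show "eventually (\<lambda>n. real (\<kappa> n) / real n \<le> b * (1 + inverse (real n)) / (1 + b)) sequentially"
      using eventually_gt_at_top[of 0]
    proof eventually_elim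
      case (elim n)
      have "real (\<kappa> n) / real n \<le> b * (real n + 1) / (1 + b) / real n"
        using upper[of n] b by (intro divide_right_mono) (simp_all add: pos_le_divide_eq)
      also have "\<dots> = b * (1 + inverse (real n)) / (1 + b)"
        using elim b by (simp add: field_simps)
      finally show ?case .
    qed
  qed
  thus ?thesis using LIMSEQ_unique lim by blast
qed

text \<open>Pigeonhole: the n + 1 terms (n choose k) b^k add up to (1 + b)^n, so one of them reaches
  the average. Only a power of n + 1 is lost, which exponential decay absorbs.\<close>

lemma binom_sum_ge:
  fixes b :: real
  assumes b: "0 < b"
  shows "((1 + b) ^ n / (real n + 1)) ^ s \<le> binom_sum s (b ^ s) n"
proof -
  define T where "T = (\<lambda>k. real (n choose k) * b ^ k)"
  have T: "T k \<ge> 0" for k using b by (simp add: T_def)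
  have "\<exists>k\<le>n. (1 + b) ^ n / (real n + 1) \<le> T k"
  proof (rule ccontr)
    assume "\<not> ?thesis"
    hence *: "T k < (1 + b) ^ n / (real n + 1)" if "k \<le> n" for k using that by force
    have "(1 + b) ^ n = (\<Sum>k\<le>n. T k)"
      using binomial_ring[of b 1 n] by (simp add: T_def add.commute mult_ac)
    also have "\<dots> < (\<Sum>k\<le>n. (1 + b) ^ n / (real n + 1))"
      by (intro sum_strict_mono *) auto
    also have "\<dots> = real (Suc n) * ((1 + b) ^ n / real (Suc n))" by (simp add: add.commute)
    also have "\<dots> = (1 + b) ^ n" by (simp del: of_nat_Suc)
    finally show False by simp
  qed
  then obtain k where k: "k \<le> n" "(1 + b) ^ n / (real n + 1) \<le> T k" by blast
  have "((1 + b) ^ n / (real n + 1)) ^ s \<le> T k ^ s"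
    using k b by (intro power_mono) auto
  also have "\<dots> \<le> (\<Sum>k=0..n. T k ^ s)"
    using k T by (intro member_le_sum) auto
  also have "\<dots> = binom_sum s (b ^ s) n"
    unfolding binom_sum_def T_def
    by (intro sum.cong refl) (simp add: power_mult_distrib mult.commute flip: power_mult)
  finally show ?thesis .
qed

lemma power_times_geometric_tendsto_0:
  fixes x :: real
  assumes "0 < x" "x < 1"
  shows "(\<lambda>n. (real n + 1) ^ m * x ^ n) \<longlonglongrightarrow> 0"
proof -
  \<comment> \<open>Writing x = y^(m + 1) provides one y^n for each of the m factors n + 1, and one
    more that tends to 0.\<close>
  define y where "y = root (Suc m) x"
  have y: "0 < y" "y < 1" "y ^ Suc m = x" using assms by (simp_all add: y_def del: power_Suc)
  have "(\<lambda>n. real n * y ^ n) \<longlonglongrightarrow> 0" using y by (intro powser_times_n_limit_0) auto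
  moreover have "(\<lambda>n. y ^ n) \<longlonglongrightarrow> 0" using y by (intro LIMSEQ_realpow_zero) auto
  ultimately have "(\<lambda>n. (real n * y ^ n + y ^ n) ^ m * y ^ n) \<longlonglongrightarrow> (0 + 0) ^ m * 0"
    by (intro tendsto_mult tendsto_power tendsto_add)
  moreover have "(real n * y ^ n + y ^ n) ^ m * y ^ n = (real n + 1) ^ m * x ^ n" for n
  proof -
    have "real n * y ^ n + y ^ n = (real n + 1) * y ^ n" by (simp add: algebra_simps)
    hence "(real n * y ^ n + y ^ n) ^ m * y ^ n = (real n + 1) ^ m * ((y ^ n) ^ m * y ^ n)"
      by (simp add: power_mult_distrib)
    also have "(y ^ n) ^ m * y ^ n = (y ^ Suc m) ^ n"
      by (simp add: power_mult_distrib mult.commute flip: power_mult)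
    finally show ?thesis by (simp only: y)
  qed
  ultimately show ?thesis by simp
qed

text \<open>Half of the decay, \<open>sqrt q\<close>, absorbs the power of n + 1; the other half
  gives \<rho> = 1 / sqrt q.\<close>

lemma exponential_decayI:
  fixes e :: "nat \<Rightarrow> real"
  assumes q: "0 < q" "q < 1" and e: "\<And>n. N \<le> n \<Longrightarrow> \<bar>e n\<bar> \<le> K * ((real n + 1) ^ m * q ^ n)"
  shows "\<exists>C>0. \<exists>\<rho>>1. \<forall>n. \<bar>e n\<bar> \<le> C / \<rho> ^ n"
proof -
  define \<rho> where "\<rho> = 1 / sqrt q"
  have sq: "0 < sqrt q" "sqrt q < 1" "sqrt q * sqrt q = q" using q by auto
  have \<rho>: "\<rho> > 1" using sq by (simp add: \<rho>_def)
  have "(\<lambda>n. K * ((real n + 1) ^ m * sqrt q ^ n)) \<longlonglongrightarrow> K * 0"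
    by (intro tendsto_intros power_times_geometric_tendsto_0 sq)
  hence "(\<lambda>n. K * ((real n + 1) ^ m * sqrt q ^ n)) \<longlonglongrightarrow> 0" by simp
  moreover have "eventually (\<lambda>n. norm (e n * \<rho> ^ n) \<le> K * ((real n + 1) ^ m * sqrt q ^ n)) sequentially"
    using eventually_ge_at_top[of N]
  proof eventually_elim
    case (elim n)
    have "norm (e n * \<rho> ^ n) = \<bar>e n\<bar> * \<rho> ^ n" using \<rho> by (simp add: abs_mult)
    also have "\<dots> \<le> K * ((real n + 1) ^ m * q ^ n) * \<rho> ^ n"
      using e[OF elim] \<rho> by (intro mult_right_mono) auto
    also have "q ^ n = sqrt q ^ n * sqrt q ^ n" using q by (simp flip: power_mult_distrib)
    also have "K * ((real n + 1) ^ m * (sqrt q ^ n * sqrt q ^ n)) * \<rho> ^ n = K * ((real n + 1) ^ m * sqrt q ^ n)"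
      using sq(1) q by (simp add: \<rho>_def power_divide)
    finally show ?case .
  qed
  ultimately have "(\<lambda>n. e n * \<rho> ^ n) \<longlonglongrightarrow> 0" by (rule Lim_null_comparison[rotated])
  \<comment> \<open>Boundedness of the convergent sequence also takes care of the finitely many n <
    N.\<close>
  hence "Bseq (\<lambda>n. e n * \<rho> ^ n)" by (intro convergent_imp_Bseq convergentI)
  then obtain C where C: "C > 0" "\<And>n. norm (e n * \<rho> ^ n) \<le> C" by (auto elim: BseqE)
  have "\<bar>e n\<bar> \<le> C / \<rho> ^ n" for n
    using C(2)[of n] \<rho> by (simp add: abs_mult field_simps)
  thus ?thesis using C(1) \<rho> by blast
qed

subsection \<open>The main theorem\<close>

text \<open>(1 + t)_k = Gamma(1 + k + t) / Gamma(1 + t), and similarly for -t. The prefactor is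
  independent of k, so it can leave the sum.\<close>

lemma cdeformed_term_eq:
  assumes "k \<le> n" "norm t < 1"
  shows "cdeformed_term n k t = Gamma (1 + t) * Gamma (1 - t) * cbinom n (of_nat k + t)"
proof -
  have nz: "rGamma (1 + t) \<noteq> 0" "rGamma (1 - t) \<noteq> 0"
    using one_plus_notin_nonpos_Ints[of t] one_plus_notin_nonpos_Ints[of "- t"] assms
    by (auto simp: rGamma_eq_zero_iff)
  have 1: "rGamma (1 + t) = pochhammer (1 + t) k * rGamma (1 + (of_nat k + t))"
    using pochhammer_rGamma[of "1 + t" k] by (simp add: add_ac)
  have 2: "rGamma (1 - t) = pochhammer (1 - t) (n - k) * rGamma (of_nat n + 1 - (of_nat k + t))"
    using pochhammer_rGamma[of "1 - t" "n - k"] assms by (simp add: of_nat_diff algebra_simps)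
  have 3: "pochhammer (1 + t) k \<noteq> 0" "pochhammer (1 - t) (n - k) \<noteq> 0"
    using nz 1 2 by auto
  have "Gamma (1 + t) * Gamma (1 - t) * cbinom n (of_nat k + t) =
     fact n * (rGamma (1 + (of_nat k + t)) * rGamma (of_nat n + 1 - (of_nat k + t))) / (rGamma (1 + t) * rGamma (1 - t))"
    by (simp add: cbinom_def Gamma_def divide_inverse mult_ac)
  also have "\<dots> = cdeformed_term n k t"
    unfolding cdeformed_term_def using nz unfolding 1 2 by simp
  finally show ?thesis ..
qed

lemma cdeformed_sum_eq:
  assumes b: "0 < b" and t: "norm t < 1"
  shows "cdeformed_sum s (b ^ s) n t = gamma_factor s b t * (\<Sum>k\<le>n. wcbinom b n (of_nat k + t) ^ s)"
  unfolding cdeformed_sum_def sum_distrib_left atMost_atLeast0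
proof (intro sum.cong refl)
  fix k assume "k \<in> {0..n}"
  have "exp ((of_nat k + t) * of_real (ln b)) = of_real b ^ k * exp (t * of_real (ln b))"
    using b by (simp add: distrib_right exp_add exp_of_nat_mult exp_of_real)
  hence "of_real b ^ k = exp (- (t * of_real (ln b))) * exp ((of_nat k + t) * of_real (ln b))"
    by (simp add: exp_minus)
  moreover have "of_real ((b ^ s) ^ k) = (complex_of_real b ^ k) ^ s"
    by (simp add: mult.commute flip: power_mult)
  ultimately show "cdeformed_term n k t ^ s * of_real ((b ^ s) ^ k) = 
        gamma_factor s b t * wcbinom b n (of_nat k + t) ^ s"
    using \<open>k \<in> {0..n}\<close> t
    by (simp add: cdeformed_term_eq gamma_factor_def wcbinom_def mult_ac flip: power_mult_distrib)
qed

lemma of_real_binom_sum: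
  assumes "0 < b"
  shows "complex_of_real (binom_sum s (b ^ s) n) = (\<Sum>k\<le>n. wcbinom b n (of_nat k) ^ s)"
  unfolding binom_sum_def of_real_sum atMost_atLeast0
proof (intro sum.cong refl)
  fix k assume "k \<in> {0..n}"
  hence "wcbinom b n (of_nat k) ^ s = of_real ((real (n choose k) * b ^ k) ^ s)"
    using assms by (subst wcbinom_of_nat) auto
  also have "(real (n choose k) * b ^ k) ^ s = real (n choose k) ^ s * (b ^ s) ^ k"
    by (simp add: power_mult_distrib mult.commute flip: power_mult)
  finally show "complex_of_real (real (n choose k) ^ s * (b ^ s) ^ k) = wcbinom b n (of_nat k) ^ s" ..
qed

lemma taylor_coeff_deformed_sum_approx:
  fixes b :: real
  assumes b: "0 < b" and s: "1 \<le> s"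
  obtains K q N where "0 < q" "q < 1"
    "\<And>n. N \<le> n \<Longrightarrow> norm (of_real (taylor_coeff (deformed_sum s (b ^ s) n) r) 
          - (deriv ^^ r) (gamma_factor s b) 0 / fact r * of_real (binom_sum s (b ^ s) n))
       \<le> K * (real n + 1) ^ (s + 1) * (q * (1 + b) ^ s) ^ n"
proof -
  obtain K q N where K: "0 < K" and q: "0 < q" "q < 1" and
    bound: "\<And>n t. N \<le> n \<Longrightarrow> norm t \<le> 1 / 4 \<Longrightarrow>
       norm ((\<Sum>k\<le>n. wcbinom b n (of_nat k + t) ^ s) - (\<Sum>k\<le>n. wcbinom b n (of_nat k) ^ s))
         \<le> K * (real n + 1) ^ (s + 1) * (q * (1 + b) ^ s) ^ n"
    using wcbinom_shift_sum_bound[OF b s] by metis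
  define f where "f = gamma_factor s b"
  have f: "f holomorphic_on ball 0 1" unfolding f_def by (rule holomorphic_gamma_factor)
  have "continuous_on (cball 0 (1 / 4)) f"
    by (rule continuous_on_subset[OF holomorphic_on_imp_continuous_on[OF f]]) auto
  hence "bounded (f ` cball 0 (1 / 4))"
    by (intro compact_imp_bounded compact_continuous_image) auto
  then obtain M where M: "\<And>t. norm t \<le> 1 / 4 \<Longrightarrow> norm (f t) \<le> M" 
    by (force simp: bounded_iff)
  have M0: "0 \<le> M" using M[of 0] norm_ge_zero order.trans by (metis norm_zero zero_le_divide_1_iff zero_le_numeral)
  have main: "norm (of_real (taylor_coeff (deformed_sum s (b ^ s) n) r) 
          - (deriv ^^ r) f 0 / fact r * of_real (binom_sum s (b ^ s) n))
       \<le> M * K * 4 ^ r * (real n + 1) ^ (s + 1) * (q * (1 + b) ^ s) ^ n" if n: "N \<le> n" for n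
  proof -
    define S where "S = (\<lambda>t. \<Sum>k\<le>n. wcbinom b n (of_nat k + t) ^ s)"
    define B where "B = complex_of_real (binom_sum s (b ^ s) n)"
    have S: "S holomorphic_on A" for A
      unfolding S_def wcbinom_def cbinom_def by (intro holomorphic_intros)
    have S0: "S 0 = B" using b by (simp add: S_def B_def of_real_binom_sum)
    have g: "cdeformed_sum s (b ^ s) n holomorphic_on ball 0 1"
      using real_restriction_deformed_sum by (simp add: real_restriction_def)
    have h: "(\<lambda>t. f t * (S t - B)) holomorphic_on ball 0 1"
      by (intro holomorphic_intros f S)
    \<comment> \<open>Splitting f S = B f + f (S - B) with B = S(0) isolates the main term. The
      remainder is small on the circle |t| = 1/4, and Cauchy's inequality there costs the factor
      4^r.\<close>
    have "(deriv ^^ r) (cdeformed_sum s (b ^ s) n) 0 = (deriv ^^ r) (\<lambda>t. B * f t + f t * (S t - B)) 0"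
    proof (rule higher_deriv_cong_ev)
      have "eventually (\<lambda>t. t \<in> ball 0 1) (nhds (0::complex))"
        by (intro eventually_nhds_in_open) auto
      thus "eventually (\<lambda>t. cdeformed_sum s (b ^ s) n t = B * f t + f t * (S t - B)) (nhds 0)"
        by eventually_elim (simp add: cdeformed_sum_eq[OF b] f_def S_def algebra_simps)
    qed simp
    also have "\<dots> = B * (deriv ^^ r) f 0 + (deriv ^^ r) (\<lambda>t. f t * (S t - B)) 0"
      by (subst higher_deriv_add[of _ "ball 0 1"])
         (auto intro!: holomorphic_intros f h simp: higher_deriv_cmult[OF f])
    finally have eq: "(deriv ^^ r) (cdeformed_sum s (b ^ s) n) 0 - B * (deriv ^^ r) f 0 = 
       (deriv ^^ r) (\<lambda>t. f t * (S t - B)) 0" by simp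
    have "norm ((deriv ^^ r) (\<lambda>t. f t * (S t - B)) 0) \<le> 
        fact r * (M * (K * (real n + 1) ^ (s + 1) * (q * (1 + b) ^ s) ^ n)) / (1 / 4) ^ r"
    proof (rule Cauchy_inequality)
      show "(\<lambda>t. f t * (S t - B)) holomorphic_on ball 0 (1 / 4)"
        by (rule holomorphic_on_subset[OF h]) auto
      show "continuous_on (cball 0 (1 / 4)) (\<lambda>t. f t * (S t - B))"
        by (rule continuous_on_subset[OF holomorphic_on_imp_continuous_on[OF h]]) auto
    next
      fix t :: complex assume "norm (0 - t) = 1 / 4"
      hence t: "norm t \<le> 1 / 4" by simp
      have "norm (S t - B) \<le> K * (real n + 1) ^ (s + 1) * (q * (1 + b) ^ s) ^ n"
        using bound[OF n t] b by (simp add: S_def B_def of_real_binom_sum)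
      thus "norm (f t * (S t - B)) \<le> M * (K * (real n + 1) ^ (s + 1) * (q * (1 + b) ^ s) ^ n)"
        unfolding norm_mult using M[OF t] M0 by (intro mult_mono) auto
    qed simp
    also have "\<dots> = fact r * (M * K * 4 ^ r * (real n + 1) ^ (s + 1) * (q * (1 + b) ^ s) ^ n)"
      by (simp add: power_divide)
    finally have "norm ((deriv ^^ r) (\<lambda>t. f t * (S t - B)) 0) / fact r 
         \<le> M * K * 4 ^ r * (real n + 1) ^ (s + 1) * (q * (1 + b) ^ s) ^ n"
      by (simp add: pos_divide_le_eq mult.commute)
    moreover have "of_real (taylor_coeff (deformed_sum s (b ^ s) n) r) - (deriv ^^ r) f 0 / fact r * B =
        (deriv ^^ r) (\<lambda>t. f t * (S t - B)) 0 / fact r"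
      unfolding taylor_coeff_real_restriction[OF real_restriction_deformed_sum] eq[symmetric]
      by (simp add: diff_divide_distrib mult.commute)
    ultimately show ?thesis by (simp add: norm_divide B_def)
  qed
  show ?thesis
    by (rule that[of q N "M * K * 4 ^ r"]) (use q main in \<open>auto simp: f_def\<close>)
qed

lemma floor_multiple_ratio_tendsto:
  fixes \<alpha> :: real
  assumes "0 \<le> \<alpha>"
  shows "(\<lambda>n. real (nat \<lfloor>\<alpha> * real n\<rfloor>) / real n) \<longlonglongrightarrow> \<alpha>"
proof (rule tendsto_sandwich)
  have "(\<lambda>n. \<alpha> - inverse (real n)) \<longlonglongrightarrow> \<alpha> - 0" by (intro tendsto_intros lim_inverse_n)
  thus "(\<lambda>n. \<alpha> - inverse (real n)) \<longlonglongrightarrow> \<alpha>" by simp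
  show "(\<lambda>n. \<alpha>) \<longlonglongrightarrow> \<alpha>" by simp
  have fl: "real (nat \<lfloor>\<alpha> * real n\<rfloor>) = of_int \<lfloor>\<alpha> * real n\<rfloor>" for n using assms by simp
  show "eventually (\<lambda>n. \<alpha> - inverse (real n) \<le> real (nat \<lfloor>\<alpha> * real n\<rfloor>) / real n) sequentially"
    using eventually_gt_at_top[of 0]
  proof eventually_elim
    case (elim n)
    have "\<alpha> * real n - 1 \<le> of_int \<lfloor>\<alpha> * real n\<rfloor>" by linarith
    hence "(\<alpha> * real n - 1) / real n \<le> of_int \<lfloor>\<alpha> * real n\<rfloor> / real n" by (intro divide_right_mono) auto
    thus ?case unfolding fl using elim by (simp add: diff_divide_distrib inverse_eq_divide)
  qed
  show "eventually (\<lambda>n. real (nat \<lfloor>\<alpha> * real n\<rfloor>) / real n \<le> \<alpha>) sequentially"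
    using eventually_gt_at_top[of 0]
  proof eventually_elim
    case (elim n)
    have "of_int \<lfloor>\<alpha> * real n\<rfloor> \<le> \<alpha> * real n" by linarith
    thus ?case unfolding fl using elim by (simp add: pos_divide_le_eq)
  qed
qed

theorem theorem1:
  fixes a \<alpha> :: real and s r L :: nat and p :: "nat \<Rightarrow> real poly" and A :: "nat \<Rightarrow> real"
  assumes "a \<in> \<rat>" and "a > 0"
    and "s \<ge> 3"
    and "1 \<le> r" and "odd s \<Longrightarrow> r < s" and "even s \<Longrightarrow> r \<le> s - 1"
    and "asymptotic_maximizer (summand s a) \<alpha>"
    and "zeilberger_recurrence (summand s a) L p"
    and "solution_with_initial_values L p (\<lambda>n. taylor_coeff (deformed_sum s a n) r) A"
  shows "\<exists>c. (\<lambda>n. c_coeff s r n (nat \<lfloor>\<alpha> * real n\<rfloor>)) \<longlonglongrightarrow> c \<and>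
             (\<lambda>n. A n / binom_sum s a n) \<longlonglongrightarrow> c \<and>
             (\<exists>C>0. \<exists>\<rho>>1. \<forall>n. \<bar>A n / binom_sum s a n - c\<bar> \<le> C / \<rho> ^ n)"
proof -
  have s: "0 < s" "1 \<le> s" and rs: "r < s" using assms(3,5,6) by (cases "even s"; simp)+
  define b where "b = root s a"
  have b: "0 < b" and a_eq: "a = b ^ s" using assms(2) s by (simp_all add: b_def)
  have \<alpha>: "\<alpha> = b / (1 + b)"
    using asymptotic_maximizer_eq[OF b s(1)] assms(7) by (simp add: a_eq)
  have A_eq: "A n = taylor_coeff (deformed_sum s a n) r" for n
    using solution_with_initial_values_unique[OF assms(9)
      taylor_coeff_deformed_sum_satisfies_recurrence[OF assms(2,8) rs]] .
  define z where "z = (deriv ^^ r) (gamma_factor s b) 0 / fact r"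
  \<comment> \<open>The real part of the complex limit: \<open>Re\<close> is continuous and does not
    increase the error, so both statements about real sequences follow at once.\<close>
  define c where "c = Re z"
  have "(\<lambda>n. real (nat \<lfloor>\<alpha> * real n\<rfloor>) / real n) \<longlonglongrightarrow> b / (1 + b)"
    using floor_multiple_ratio_tendsto[of \<alpha>] b by (simp add: \<alpha>)
  from tendsto_Re[OF c_coeff_tendsto[OF b this]]
  have lim_c: "(\<lambda>n. c_coeff s r n (nat \<lfloor>\<alpha> * real n\<rfloor>)) \<longlonglongrightarrow> c"
    by (simp add: c_def z_def)
  obtain K q N where q: "0 < q" "q < 1" and
    approx: "\<And>n. N \<le> n \<Longrightarrow> norm (of_real (taylor_coeff (deformed_sum s a n) r) - z * of_real (binom_sum s a n))
       \<le> K * (real n + 1) ^ (s + 1) * (q * (1 + b) ^ s) ^ n"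
    using taylor_coeff_deformed_sum_approx[OF b s(2), of r] unfolding a_eq z_def by metis
  \<comment> \<open>The exponent 2 s + 1 consists of s + 1 from the error of the shifted sum and s
    from the lower bound for \<open>binom_sum\<close>; the factors (1 + b)^(s n) cancel.\<close>
  have err: "\<bar>A n / binom_sum s a n - c\<bar> \<le> K * ((real n + 1) ^ (2 * s + 1) * q ^ n)" if n: "N \<le> n" for n
  proof -
    define X where "X = ((1 + b) ^ n / (real n + 1)) ^ s"
    have X: "0 < X" using b by (auto simp: X_def)
    have XB: "X \<le> binom_sum s a n" unfolding X_def a_eq by (rule binom_sum_ge[OF b])
    have "A n - c * binom_sum s a n = Re (of_real (taylor_coeff (deformed_sum s a n) r) - z * of_real (binom_sum s a n))"
      by (simp add: A_eq c_def)
    hence "\<bar>A n - c * binom_sum s a n\<bar> \<le> K * (real n + 1) ^ (s + 1) * (q * (1 + b) ^ s) ^ n"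
      using approx[OF n] abs_Re_le_cmod order.trans by metis
    hence le: "\<bar>A n - c * binom_sum s a n\<bar> / binom_sum s a n \<le> (K * (real n + 1) ^ (s + 1) * (q * (1 + b) ^ s) ^ n) / X"
      using X XB by (intro frac_le) auto
    have "A n / binom_sum s a n - c = (A n - c * binom_sum s a n) / binom_sum s a n"
      using X XB by (simp add: diff_divide_distrib)
    hence "\<bar>A n / binom_sum s a n - c\<bar> = \<bar>A n - c * binom_sum s a n\<bar> / binom_sum s a n"
      using X XB by (simp add: abs_divide)
    also note le
    also have "(K * (real n + 1) ^ (s + 1) * (q * (1 + b) ^ s) ^ n) / X = K * ((real n + 1) ^ (2 * s + 1) * q ^ n)"
    proof -
      have "((1 + b) ^ s) ^ n = X * (real n + 1) ^ s"
      proof -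
        have "(real n + 1) ^ s \<noteq> 0" using of_nat_0_le_iff[of n, where ?'a = real] by (simp add: add_eq_0_iff_both_eq_0)
        thus ?thesis by (simp add: X_def power_divide mult.commute flip: power_mult)
      qed
      hence "K * (real n + 1) ^ (s + 1) * (q * (1 + b) ^ s) ^ n = 
          X * (K * (((real n + 1) ^ (s + 1) * (real n + 1) ^ s) * q ^ n))"
        by (simp only: power_mult_distrib mult_ac)
      also have "(real n + 1) ^ (s + 1) * (real n + 1) ^ s = (real n + 1) ^ (2 * s + 1)"
        by (simp only: power_add[symmetric]) (simp add: mult_2)
      finally have eq: "K * (real n + 1) ^ (s + 1) * (q * (1 + b) ^ s) ^ n = 
          X * (K * ((real n + 1) ^ (2 * s + 1) * q ^ n))" .
      show ?thesis unfolding eq using X by simp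
    qed
    finally show ?thesis .
  qed
  obtain C \<rho> where C: "C > 0" "\<rho> > 1" and decay: "\<And>n. \<bar>A n / binom_sum s a n - c\<bar> \<le> C / \<rho> ^ n"
    using exponential_decayI[where e = "\<lambda>n. A n / binom_sum s a n - c", OF q err] by blast
  have "(\<lambda>n. A n / binom_sum s a n - c) \<longlonglongrightarrow> 0"
  proof (rule Lim_null_comparison)
    show "eventually (\<lambda>n. norm (A n / binom_sum s a n - c) \<le> C * (1 / \<rho>) ^ n) sequentially"
      using decay by (intro always_eventually allI) (simp add: power_divide)
    have "(\<lambda>n. C * (1 / \<rho>) ^ n) \<longlonglongrightarrow> C * 0"
      using C by (intro tendsto_mult tendsto_const LIMSEQ_realpow_zero) auto
    thus "(\<lambda>n. C * (1 / \<rho>) ^ n) \<longlonglongrightarrow> 0" by simp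
  qed
  hence "(\<lambda>n. A n / binom_sum s a n) \<longlonglongrightarrow> c" by (simp add: LIM_zero_iff)
  thus ?thesis using lim_c C decay by blast
qed

end
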